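(* There is a polynomial-time algorithm that, given any instance $(G,w,\mathcal{T})$ of the Steiner Multicycle problem with $w\colon E(G)\to\{1,2\}$, outputs a set of vertex-disjoint cycles of $G$ that respects $\mathcal{T}$ and whose cost is at most $\frac{11}{9}\,\mathrm{opt}(G,w,\mathcal{T})$. That is, there is an $\frac{11}{9}$-approximation algorithm for the $\{1,2\}$-Steiner Multicycle problem.
   Context: Steiner Multicycle problem: the input is a complete graph $G$, a weight function $w$ on $E(G)$, and a collection $\mathcal{T}$ of pairwise disjoint subsets of $V(G)$, each of size at least 2 (terminal sets). A cycle is a nonempty connected subgraph all of whose vertices have degree 2; in addition, for each $T\in\mathcal{T}$ with $|T|=2$, the edge joining the two vertices of $T$ is duplicated, so a cycle of length 2 consisting of these two parallel edges (of cost twice the weight of that edge) is allowed. A cycle $C$ respects $\mathcal{T}$ if for every $T\in\mathcal{T}$ either $T\subseteq V(C)$ or $T\cap V(C)=\emptyset$. A set $\mathcal{C}$ of vertex-disjoint cycles respects $\mathcal{T}$ if every cycle in it respects $\mathcal{T}$ and every vertex of every terminal set lies in some cycle of $\mathcal{C}$. The cost $w(\mathcal{C})$ is the total weight of edges over all cycles of $\mathcal{C}$, and $\mathrm{opt}(G,w,\mathcal{T})$ is the minimum cost of such a set. The $\{1,2\}$-Steiner Multicycle problem is the restriction to instances where every edge weight is 1 or 2. *)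

theory Defs
  imports Complex_Main "HOL-Library.Disjoint_Sets" "HOL-Computational_Algebra.Polynomial"
begin

section \<open>The Steiner Multicycle problem\<close>

definition complete_edges :: "'v set \<Rightarrow> 'v set set" where
  "complete_edges V = {e. e \<subseteq> V \<and> card e = 2}"

definition smc_instance :: "'v set \<Rightarrow> 'v set set \<Rightarrow> bool" where
  "smc_instance V \<T> \<longleftrightarrow>
     finite V \<and> disjoint \<T> \<and> (\<forall>T\<in>\<T>. T \<subseteq> V \<and> 2 \<le> card T)"

text \<open>
  Edges of the multigraph carry a tag: \<open>(e, False)\<close> is the edge \<open>e\<close> of the complete graph,
  \<open>(e, True)\<close> is its parallel copy, present exactly when \<open>e\<close> is a terminal set.
\<close>

definition dup_edges :: "'v set \<Rightarrow> 'v set set \<Rightarrow> ('v set \<times> bool) set" where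
  "dup_edges V \<T> = complete_edges V \<times> {False} \<union> {T \<in> \<T>. card T = 2} \<times> {True}"

record 'v mgraph =
  verts :: "'v set"
  edges :: "('v set \<times> bool) set"

definition is_subgraph :: "'v set \<Rightarrow> 'v set set \<Rightarrow> 'v mgraph \<Rightarrow> bool" where
  "is_subgraph V \<T> H \<longleftrightarrow>
     verts H \<subseteq> V \<and> edges H \<subseteq> dup_edges V \<T> \<and> (\<forall>e\<in>edges H. fst e \<subseteq> verts H)"

definition connected_mgraph :: "'v mgraph \<Rightarrow> bool" where
  "connected_mgraph H \<longleftrightarrow>
     (\<forall>u\<in>verts H. \<forall>v\<in>verts H. (u, v) \<in> {(a, b). \<exists>e\<in>edges H. fst e = {a, b}}\<^sup>*)"

definition degree_in :: "'v mgraph \<Rightarrow> 'v \<Rightarrow> nat" where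
  "degree_in H v = card {e \<in> edges H. v \<in> fst e}"

definition is_cycle :: "'v set \<Rightarrow> 'v set set \<Rightarrow> 'v mgraph \<Rightarrow> bool" where
  "is_cycle V \<T> C \<longleftrightarrow>
     is_subgraph V \<T> C \<and> verts C \<noteq> {} \<and> connected_mgraph C \<and>
     (\<forall>v\<in>verts C. degree_in C v = 2)"

definition cycle_respects :: "'v set set \<Rightarrow> 'v mgraph \<Rightarrow> bool" where
  "cycle_respects \<T> C \<longleftrightarrow> (\<forall>T\<in>\<T>. T \<subseteq> verts C \<or> T \<inter> verts C = {})"

definition disjoint_cycles :: "'v set \<Rightarrow> 'v set set \<Rightarrow> 'v mgraph set \<Rightarrow> bool" where
  "disjoint_cycles V \<T> \<C> \<longleftrightarrow>
     (\<forall>C\<in>\<C>. is_cycle V \<T> C) \<and>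
     (\<forall>C\<in>\<C>. \<forall>D\<in>\<C>. C \<noteq> D \<longrightarrow> verts C \<inter> verts D = {})"

definition respects_terminals :: "'v set set \<Rightarrow> 'v mgraph set \<Rightarrow> bool" where
  "respects_terminals \<T> \<C> \<longleftrightarrow>
     (\<forall>C\<in>\<C>. cycle_respects \<T> C) \<and> (\<forall>T\<in>\<T>. \<forall>v\<in>T. \<exists>C\<in>\<C>. v \<in> verts C)"

definition cost :: "('v set \<Rightarrow> nat) \<Rightarrow> 'v mgraph set \<Rightarrow> nat" where
  "cost w \<C> = (\<Sum>C\<in>\<C>. \<Sum>e\<in>edges C. w (fst e))"

definition opt :: "'v set \<Rightarrow> ('v set \<Rightarrow> nat) \<Rightarrow> 'v set set \<Rightarrow> nat" where
  "opt V w \<T> = Min {cost w \<C> |\<C>. disjoint_cycles V \<T> \<C> \<and> respects_terminals \<T> \<C>}"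

lemma finite_solutions:
  assumes "smc_instance V \<T>"
  shows "finite {\<C>. disjoint_cycles V \<T> \<C> \<and> respects_terminals \<T> \<C>}"
proof -
  have V: "finite V" and T: "\<T> \<subseteq> Pow V"
    using assms by (auto simp: smc_instance_def)
  have "dup_edges V \<T> \<subseteq> Pow V \<times> UNIV"
    using T by (auto simp: dup_edges_def complete_edges_def)
  then have E: "finite (dup_edges V \<T>)"
    by (rule finite_subset) (use V in auto)
  let ?G = "(\<lambda>(A, B). \<lparr>verts = A, edges = B\<rparr>) ` (Pow V \<times> Pow (dup_edges V \<T>))"
  have "C \<in> ?G" if "is_cycle V \<T> C" for C
    using that by (intro image_eqI[where x = "(verts C, edges C)"])
      (auto simp: is_cycle_def is_subgraph_def)
  then have "{\<C>. disjoint_cycles V \<T> \<C> \<and> respects_terminals \<T> \<C>} \<subseteq> Pow ?G"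
    by (auto simp: disjoint_cycles_def)
  then show ?thesis
    by (rule finite_subset) (use V E in auto)
qed


section \<open>Polynomial time\<close>

text \<open>
  The machine model is Jones's WHILE language over binary trees (N. D. Jones, Computability
  and Complexity from a Programming Perspective, MIT Press, 1997), with an additional
  conditional. Every elementary operation takes unit time; there is no equality test on trees
  other than the comparison with \<open>Leaf\<close>. The class of problems solved in polynomial time is
  the same as for Turing machines.
\<close>

datatype tree = Leaf | Node tree tree

fun left :: "tree \<Rightarrow> tree" where
  "left Leaf = Leaf"
| "left (Node l r) = l"

fun right :: "tree \<Rightarrow> tree" where
  "right Leaf = Leaf"
| "right (Node l r) = r"

datatype exp = VarE nat | NilE | ConsE exp exp | HdE exp | TlE exp

type_synonym store = "nat \<Rightarrow> tree"

primrec eval_exp :: "exp \<Rightarrow> store \<Rightarrow> tree" where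
  "eval_exp (VarE x) s = s x"
| "eval_exp NilE s = Leaf"
| "eval_exp (ConsE a b) s = Node (eval_exp a s) (eval_exp b s)"
| "eval_exp (HdE a) s = left (eval_exp a s)"
| "eval_exp (TlE a) s = right (eval_exp a s)"

primrec exp_time :: "exp \<Rightarrow> nat" where
  "exp_time (VarE x) = 1"
| "exp_time NilE = 1"
| "exp_time (ConsE a b) = 1 + exp_time a + exp_time b"
| "exp_time (HdE a) = 1 + exp_time a"
| "exp_time (TlE a) = 1 + exp_time a"

datatype com =
    Skip
  | Assign nat exp
  | Seq com com
  | Cond exp com com
  | While exp com

text \<open>\<open>exec c s t s'\<close>: started in store \<open>s\<close>, \<open>c\<close> halts after exactly \<open>t\<close> steps in \<open>s'\<close>.\<close>

inductive exec :: "com \<Rightarrow> store \<Rightarrow> nat \<Rightarrow> store \<Rightarrow> bool" where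
  Skip: "exec Skip s 1 s"
| Assign: "exec (Assign x e) s (1 + exp_time e) (s(x := eval_exp e s))"
| Seq: "exec c s t s' \<Longrightarrow> exec d s' u s'' \<Longrightarrow> exec (Seq c d) s (t + u) s''"
| CondTrue: "eval_exp e s \<noteq> Leaf \<Longrightarrow> exec c s t s' \<Longrightarrow>
    exec (Cond e c d) s (1 + exp_time e + t) s'"
| CondFalse: "eval_exp e s = Leaf \<Longrightarrow> exec d s t s' \<Longrightarrow>
    exec (Cond e c d) s (1 + exp_time e + t) s'"
| WhileTrue: "eval_exp e s \<noteq> Leaf \<Longrightarrow> exec c s t s' \<Longrightarrow> exec (While e c) s' u s'' \<Longrightarrow>
    exec (While e c) s (1 + exp_time e + t + u) s''"
| WhileFalse: "eval_exp e s = Leaf \<Longrightarrow> exec (While e c) s (1 + exp_time e) s"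

inductive_cases exec_SkipE: "exec Skip s t s'"
inductive_cases exec_AssignE: "exec (Assign x e) s t s'"
inductive_cases exec_SeqE: "exec (Seq c d) s t s'"
inductive_cases exec_CondE: "exec (Cond e c d) s t s'"
inductive_cases exec_WhileE: "exec (While e c) s t s'"

lemma exec_deterministic:
  "exec c s t s' \<Longrightarrow> exec c s u s'' \<Longrightarrow> t = u \<and> s' = s''"
proof (induction arbitrary: u s'' rule: exec.induct)
  case (Skip s)
  then show ?case by (auto elim: exec_SkipE)
next
  case (Assign x e s)
  then show ?case by (auto elim: exec_AssignE)
next
  case (Seq c s t s1 d t' s2)
  from Seq.prems obtain a b r where "exec c s a r" "exec d r b s''" "u = a + b"
    by (rule exec_SeqE)
  with Seq.IH(1)[of a r] Seq.IH(2)[of b s''] show ?case by simp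
next
  case (CondTrue e s c t s1 d)
  from CondTrue.prems CondTrue.hyps obtain a where "exec c s a s''" "u = 1 + exp_time e + a"
    by (auto elim: exec_CondE)
  with CondTrue.IH[of a s''] show ?case by simp
next
  case (CondFalse e s d t s1 c)
  from CondFalse.prems CondFalse.hyps obtain a where "exec d s a s''" "u = 1 + exp_time e + a"
    by (auto elim: exec_CondE)
  with CondFalse.IH[of a s''] show ?case by simp
next
  case (WhileTrue e s c t s1 t' s2)
  from WhileTrue.prems WhileTrue.hyps(1) obtain a b r
    where "exec c s a r" "exec (While e c) r b s''" "u = 1 + exp_time e + a + b"
    by (auto elim: exec_WhileE)
  with WhileTrue.IH(1)[of a r] WhileTrue.IH(2)[of b s''] show ?case by simp
next
  case (WhileFalse e s c)
  then show ?case by (auto elim: exec_WhileE)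
qed

text \<open>Input and output are passed in variable \<open>0\<close>; all other variables are initially \<open>Leaf\<close>.\<close>

definition outputs_within :: "com \<Rightarrow> tree \<Rightarrow> nat \<Rightarrow> tree \<Rightarrow> bool" where
  "outputs_within P x b y \<longleftrightarrow>
     (\<exists>t s. exec P ((\<lambda>_. Leaf)(0 := x)) t s \<and> t \<le> b \<and> s 0 = y)"


section \<open>Input and output format\<close>

primrec enc_list :: "('a \<Rightarrow> tree) \<Rightarrow> 'a list \<Rightarrow> tree" where
  "enc_list f [] = Leaf"
| "enc_list f (x # xs) = Node (f x) (enc_list f xs)"

text \<open>
  Unary numerals suffice: the only numbers occurring are vertex names below the number \<open>n\<close> of
  vertices, of which the weight matrix makes every input at least quadratic, and weights.
\<close>

definition enc_nat :: "nat \<Rightarrow> tree" where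
  "enc_nat n = enc_list (\<lambda>_. Leaf) [0..<n]"

definition enc_bool :: "bool \<Rightarrow> tree" where
  "enc_bool b = (if b then Node Leaf Leaf else Leaf)"

definition enc_matrix :: "nat \<Rightarrow> (nat set \<Rightarrow> nat) \<Rightarrow> tree" where
  "enc_matrix n w =
     enc_list (\<lambda>i. enc_list (\<lambda>j. enc_nat (if i = j then 0 else w {i, j})) [0..<n]) [0..<n]"

text \<open>The terminal sets may be listed in any order, and so may the elements of each of them.\<close>

definition lists_terminals :: "nat list list \<Rightarrow> nat set set \<Rightarrow> bool" where
  "lists_terminals Ts \<T> \<longleftrightarrow>
     distinct (map set Ts) \<and> (\<forall>T\<in>set Ts. distinct T) \<and> set (map set Ts) = \<T>"

definition enc_instance :: "nat \<Rightarrow> (nat set \<Rightarrow> nat) \<Rightarrow> nat list list \<Rightarrow> tree" where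
  "enc_instance n w Ts = Node (enc_matrix n w) (enc_list (enc_list enc_nat) Ts)"

type_synonym edge_code = "nat \<times> nat \<times> bool"

definition edge_of :: "edge_code \<Rightarrow> nat set \<times> bool" where
  "edge_of = (\<lambda>(u, v, b). ({u, v}, b))"

definition enc_edge :: "edge_code \<Rightarrow> tree" where
  "enc_edge = (\<lambda>(u, v, b). Node (enc_nat u) (Node (enc_nat v) (enc_bool b)))"

type_synonym cycle_code = "nat list \<times> edge_code list"

definition cycle_of :: "cycle_code \<Rightarrow> nat mgraph" where
  "cycle_of = (\<lambda>(vs, es). \<lparr>verts = set vs, edges = set (map edge_of es)\<rparr>)"

definition enc_cycle :: "cycle_code \<Rightarrow> tree" where
  "enc_cycle = (\<lambda>(vs, es). Node (enc_list enc_nat vs) (enc_list enc_edge es))"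

text \<open>
  The lists are free of repetitions, so the representation of a set of vertex-disjoint cycles
  has size polynomial in the number of vertices.
\<close>

definition represents_cycles :: "tree \<Rightarrow> nat mgraph set \<Rightarrow> bool" where
  "represents_cycles y \<C> \<longleftrightarrow>
     (\<exists>Cs. y = enc_list enc_cycle Cs \<and>
        distinct (map cycle_of Cs) \<and> set (map cycle_of Cs) = \<C> \<and>
        (\<forall>(vs, es)\<in>set Cs. distinct vs \<and> distinct (map edge_of es)))"

end

theory Submission
  imports Defs "HOL-Library.Multiset"
begin

text \<open>
  Let \<open>t\<close> be the number of terminals and call an edge of weight 1 light. A family of disjoint light
  paths and light cycles that covers the terminals and whose cycles respect the terminal sets yields
  a solution of cost at most \<open>t + p\<close>, where \<open>p\<close> is the number of paths: keep the cycles and join all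
  paths to one further cycle. Such a family is improved by local search. The moves reverse, split,
  join, close and reopen paths and cycles; a family is replaced by one of smaller potential that is
  reachable by 100 moves. The potential is, in order of priority, the number of paths, of cycles, of
  one-vertex paths and of two-vertex paths.

  The light edges between terminals in an optimal solution give two slots to every terminal, except
  for \<open>d \<le> 2 (opt - t)\<close> missing ones. In a local optimum the slots at the ends of paths are charged to
  path edges: an edge from an end to an inner vertex \<open>x\<close> of another path is charged to a path edge at
  \<open>x\<close>, and two charges to the same edge would allow an improvement. Since there are at most \<open>t - p\<close>
  path edges, \<open>5 p \<le> t + d + 2 p\<^sub>1 + p\<^sub>2\<close>, where \<open>p\<^sub>1\<close> counts one-vertex paths and \<open>p\<^sub>2\<close> counts two-vertex
  paths whose edge is used by the optimal solution. One-vertex paths are adjacent only to centres of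
  three-vertex paths, and so are then the ends of the latter; two-vertex paths are adjacent only to
  paths with three to five vertices. Counting these adjacencies gives \<open>8 p\<^sub>1 + 4 p\<^sub>2 \<le> 2 p + 3 d\<close>.
  Hence \<open>18 p \<le> 4 t + 7 d\<close>, that is, \<open>9 (t + p) \<le> 11 opt\<close>.
\<close>

section \<open>The local search\<close>

text \<open>Each path is expected to bring four slots, two at either end. A one-vertex path owns
  only two, and a two-vertex path whose edge is used by the optimal solution only three different
  ones, hence \<open>2 p\<^sub>1 + p\<^sub>2\<close>. The charging meets four obstacles. A slot that
  stays in its own path is charged as in a Posa rotation, to the edge whose removal creates a new
  end. Parallel edges of the optimal solution would charge one edge twice. So would a vertex whose
  two slots lead to neighbours on another path. Finally, a path whose vertices span a light cycle
  need not be closable, as cycles have to respect the terminal sets. But if no slot on its vertex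
  set is missing or leaves the set, then the set is a union of cycles of the optimal solution and
  therefore closable; otherwise some slot of the path goes outside or is missing, and its edges,
  which nobody charges, pay for the rest. The bound of 100 moves is generous for the exchanges
  needed. What matters is that it is constant: all states within 100 moves can then be enumerated in
  polynomial time.\<close>

type_synonym 'v state = "'v list multiset \<times> 'v list multiset"

definition closed_wrt :: "'v set set \<Rightarrow> 'v set \<Rightarrow> bool" where
  "closed_wrt \<T> X \<longleftrightarrow> (\<forall>T\<in>\<T>. T \<subseteq> X \<or> T \<inter> X = {})"

text \<open>\<open>stay\<close> makes reachability monotone in the number of moves. Only
  \<open>close\<close> looks at the terminal sets: the paths end up in one common cycle, which
  respects them automatically.\<close>

inductive move :: "('v \<Rightarrow> 'v \<Rightarrow> bool) \<Rightarrow> 'v set set \<Rightarrow> 'v state \<Rightarrow> 'v state \<Rightarrow> bool"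
  for adj \<T> where
  stay: "move adj \<T> S S"
| reverse: "move adj \<T> (add_mset P R, C) (add_mset (rev P) R, C)"
| split: "A \<noteq> [] \<Longrightarrow> B \<noteq> [] \<Longrightarrow>
    move adj \<T> (add_mset (A @ B) R, C) (add_mset A (add_mset B R), C)"
| join: "A \<noteq> [] \<Longrightarrow> B \<noteq> [] \<Longrightarrow> adj (last A) (hd B) \<Longrightarrow>
    move adj \<T> (add_mset A (add_mset B R), C) (add_mset (A @ B) R, C)"
| close: "P \<noteq> [] \<Longrightarrow> adj (last P) (hd P) \<Longrightarrow> closed_wrt \<T> (set P) \<Longrightarrow>
    move adj \<T> (add_mset P R, C) (R, add_mset P C)"
| unclose: "A @ B \<noteq> [] \<Longrightarrow> move adj \<T> (R, add_mset (A @ B) C) (add_mset (B @ A) R, C)"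

primrec reach :: "('v \<Rightarrow> 'v \<Rightarrow> bool) \<Rightarrow> 'v set set \<Rightarrow> nat \<Rightarrow> 'v state \<Rightarrow> 'v state \<Rightarrow> bool" where
  "reach adj \<T> 0 S S' \<longleftrightarrow> S' = S"
| "reach adj \<T> (Suc n) S S' \<longleftrightarrow> (\<exists>S1. reach adj \<T> n S S1 \<and> move adj \<T> S1 S')"

text \<open>A consecutive pair that is itself closed can be cut out as a cycle of length 2; the potential
  counts the other pairs, and hence prefers such a pair to be consecutive.\<close>

fun unlocked :: "'v set set \<Rightarrow> 'v list \<Rightarrow> nat" where
  "unlocked \<T> (x # y # zs) = (if closed_wrt \<T> {x, y} then 0 else 1) + unlocked \<T> (y # zs)"
| "unlocked \<T> _ = 0"

text \<open>The constants 20 and 10 make it worthwhile to cut a longer path in order to lengthen a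
  one-vertex path, even if a piece of two vertices is left over and \<open>unlocked\<close> grows by
  1; similarly for two-vertex paths and pieces of at least three vertices.\<close>

definition path_weight :: "'v set set \<Rightarrow> 'v list \<Rightarrow> nat" where
  "path_weight \<T> P =
     (if length P \<le> 1 then 20 else if length P = 2 then 10 else 0) + unlocked \<T> P"

definition rest_weight :: "'v set set \<Rightarrow> 'v state \<Rightarrow> nat" where
  "rest_weight \<T> S = (\<Sum>P\<in>#fst S. path_weight \<T> P) + (\<Sum>C\<in>#snd S. unlocked \<T> C)"

text \<open>A move increases \<open>rest_weight\<close> by at most 40 and the number of cycles by at most 1, so over 100
  moves the three summands are compared lexicographically.\<close>

definition potential :: "'v set set \<Rightarrow> 'v state \<Rightarrow> nat" where
  "potential \<T> S = 200000 * size (fst S) + 1000 * size (snd S) + rest_weight \<T> S"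

definition local_opt :: "('v \<Rightarrow> 'v \<Rightarrow> bool) \<Rightarrow> 'v set set \<Rightarrow> 'v state \<Rightarrow> bool" where
  "local_opt adj \<T> S \<longleftrightarrow> (\<forall>S'. reach adj \<T> 100 S S' \<longrightarrow> potential \<T> S \<le> potential \<T> S')"

section \<open>Effect of the moves on the potential\<close>

lemma unlocked_append:
  "unlocked \<T> A + unlocked \<T> B \<le> unlocked \<T> (A @ B)"
  "unlocked \<T> (A @ B) \<le> unlocked \<T> A + unlocked \<T> B + 1"
proof -
  have "unlocked \<T> A + unlocked \<T> B \<le> unlocked \<T> (A @ B) \<and>
    unlocked \<T> (A @ B) \<le> unlocked \<T> A + unlocked \<T> B + 1"
  proof (induction \<T> A rule: unlocked.induct)
    case ("2_2" \<T> x)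
    show ?case by (cases B) auto
  qed auto
  then show "unlocked \<T> A + unlocked \<T> B \<le> unlocked \<T> (A @ B)"
    "unlocked \<T> (A @ B) \<le> unlocked \<T> A + unlocked \<T> B + 1" by auto
qed

lemma unlocked_append_eq:
  assumes "A \<noteq> []" "B \<noteq> []"
  shows "unlocked \<T> (A @ B) =
    unlocked \<T> A + unlocked \<T> B + (if closed_wrt \<T> {last A, hd B} then 0 else 1)"
  using assms
proof (induction \<T> A rule: unlocked.induct)
  case ("2_2" \<T> x)
  then show ?case by (cases B) auto
qed auto

lemma unlocked_rev: "unlocked \<T> (rev P) = unlocked \<T> P"
proof (induction \<T> P rule: unlocked.induct)
  case (1 \<T> x y zs)
  have "unlocked \<T> (rev (x # y # zs)) = unlocked \<T> (rev (y # zs) @ [x])" by simp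
  also have "\<dots> = unlocked \<T> (y # zs) + (if closed_wrt \<T> {x, y} then 0 else 1)"
    using 1 by (subst unlocked_append_eq) (auto simp: last_rev insert_commute)
  finally show ?case by simp
qed auto

locale moves =
  fixes adj :: "'v \<Rightarrow> 'v \<Rightarrow> bool" and \<T> :: "'v set set"
  assumes adj_sym: "\<And>u v. adj u v \<Longrightarrow> adj v u"
begin

abbreviation mv where "mv \<equiv> move adj \<T>"
abbreviation rch where "rch \<equiv> reach adj \<T>"

text \<open>The worst case is \<open>split\<close>, which may create two one-vertex paths of weight
  20 each; \<open>unclose\<close> adds at most 20 + 1 and \<open>join\<close> at most 1.\<close>

lemma rest_weight_move: "mv S S' \<Longrightarrow> rest_weight \<T> S' \<le> rest_weight \<T> S + 40"
proof (induction rule: move.induct)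
  case (split A B R C)
  have "unlocked \<T> A + unlocked \<T> B \<le> unlocked \<T> (A @ B)" by (rule unlocked_append)
  then show ?case by (auto simp: rest_weight_def path_weight_def)
next
  case (join A B R C)
  have "unlocked \<T> (A @ B) \<le> unlocked \<T> A + unlocked \<T> B + 1" by (rule unlocked_append)
  with join show ?case
    by (cases "length A"; cases "length B") (auto simp: rest_weight_def path_weight_def)
next
  case (unclose A B R C)
  have "unlocked \<T> (B @ A) \<le> unlocked \<T> B + unlocked \<T> A + 1"
    "unlocked \<T> A + unlocked \<T> B \<le> unlocked \<T> (A @ B)" by (rule unlocked_append)+
  then show ?case by (auto simp: rest_weight_def path_weight_def)
qed (auto simp: rest_weight_def path_weight_def unlocked_rev)

lemma rest_weight_reach: "rch n S S' \<Longrightarrow> rest_weight \<T> S' \<le> rest_weight \<T> S + 40 * n"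
proof (induction n arbitrary: S')
  case (Suc n)
  then obtain S1 where "rch n S S1" "mv S1 S'" by auto
  with Suc.IH[of S1] rest_weight_move[of S1 S'] show ?case by auto
qed simp

lemma cycles_reach: "rch n S S' \<Longrightarrow> size (snd S') \<le> size (snd S) + n"
proof (induction n arbitrary: S')
  case (Suc n)
  then obtain S1 where "rch n S S1" "mv S1 S'" by auto
  moreover from this(2) have "size (snd S') \<le> size (snd S1) + 1"
    by (induction rule: move.induct) auto
  ultimately show ?case using Suc.IH[of S1] by auto
qed simp

lemma reach_one: "mv S S' \<Longrightarrow> rch 1 S S'"
  by simp

lemma reach_add: "rch n S S' \<Longrightarrow> rch m S' S'' \<Longrightarrow> rch (n + m) S S''"
  by (induction m arbitrary: S'') auto

lemma reach_refl: "rch n S S"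
proof (induction n)
  case (Suc n)
  then show ?case using stay[of adj \<T> S] reach.simps(2) by blast
qed simp

declare reach.simps [simp del]

lemma reach_trans: "rch n S S' \<Longrightarrow> rch m S' S'' \<Longrightarrow> n + m \<le> k \<Longrightarrow> rch k S S''"
  using reach_add[of n S S' m S''] reach_add[of "n + m" S S'' "k - (n + m)" S'']
    reach_refl[of "k - (n + m)" S''] by simp

lemma reach_mono: "rch n S S' \<Longrightarrow> n \<le> k \<Longrightarrow> rch k S S'"
  using reach_trans[of n S S' 0 S' k] reach_refl by simp

text \<open>Unlike \<open>local_opt\<close>, this property passes to every state that is reached
  without additional paths, at the price of the moves spent (\<open>no_fewer_reach\<close>).
  Exchanges can thus be chained.\<close>

definition no_fewer :: "nat \<Rightarrow> 'v state \<Rightarrow> bool" where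
  "no_fewer n S \<longleftrightarrow> (\<forall>S'. rch n S S' \<longrightarrow> size (fst S) \<le> size (fst S'))"

text \<open>Each path weighs 200000, while 100 moves raise the other summands by at most 100 * 1000
  + 100 * 40.\<close>

lemma local_opt_no_fewer: "local_opt adj \<T> S \<Longrightarrow> no_fewer 100 S"
  unfolding no_fewer_def
proof (intro allI impI)
  fix S' assume lo: "local_opt adj \<T> S" and r: "rch 100 S S'"
  have "potential \<T> S \<le> potential \<T> S'"
    using lo r unfolding local_opt_def by blast
  moreover have "rest_weight \<T> S' \<le> rest_weight \<T> S + 4000"
    using rest_weight_reach[OF r] by simp
  moreover have "size (snd S') \<le> size (snd S) + 100"
    using cycles_reach[OF r] by simp
  ultimately show "size (fst S) \<le> size (fst S')"
    unfolding potential_def by linarith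
qed

lemma no_fewerD: "no_fewer n S \<Longrightarrow> rch m S S' \<Longrightarrow> m \<le> n \<Longrightarrow> size (fst S) \<le> size (fst S')"
  unfolding no_fewer_def using reach_mono by blast

lemma no_fewer_reach:
  "no_fewer n S \<Longrightarrow> rch m S S' \<Longrightarrow> size (fst S') \<le> size (fst S) \<Longrightarrow> m + k \<le> n \<Longrightarrow> no_fewer k S'"
  unfolding no_fewer_def using reach_trans by (meson order_trans)

section \<open>Rearrangements of a single path\<close>

definition rearr :: "nat \<Rightarrow> 'v list \<Rightarrow> 'v list \<Rightarrow> bool" where
  "rearr n P P' \<longleftrightarrow> P' \<noteq> [] \<and> (\<forall>R C. rch n (add_mset P R, C) (add_mset P' R, C))"

text \<open>Five moves allow the longest rearrangement needed: three make a crossing path closable,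
  two rotate it.\<close>

definition endable :: "'v list \<Rightarrow> 'v \<Rightarrow> bool" where
  "endable P v \<longleftrightarrow> (\<exists>P'. rearr 5 P P' \<and> last P' = v)"

lemma rearrD: "rearr n P P' \<Longrightarrow> rch n (add_mset P R, C) (add_mset P' R, C)"
  by (simp add: rearr_def)

lemma rearr_refl: "P \<noteq> [] \<Longrightarrow> rearr n P P"
  by (auto simp: rearr_def reach_refl)

lemma rearr_rev: "P \<noteq> [] \<Longrightarrow> rearr 1 P (rev P)"
  by (auto simp: rearr_def intro!: reach_one[unfolded One_nat_def] reverse)

lemma rearr_trans: "rearr n P P' \<Longrightarrow> rearr m P' P'' \<Longrightarrow> n + m \<le> k \<Longrightarrow> rearr k P P''"
  unfolding rearr_def using reach_trans by blast

lemma reach_split: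
  "A \<noteq> [] \<Longrightarrow> B \<noteq> [] \<Longrightarrow> rch 1 (add_mset (A @ B) R, C) (add_mset A (add_mset B R), C)"
  by (intro reach_one move.split)

lemma reach_join:
  "A \<noteq> [] \<Longrightarrow> B \<noteq> [] \<Longrightarrow> adj (last A) (hd B) \<Longrightarrow>
    rch 1 (add_mset A (add_mset B R), C) (add_mset (A @ B) R, C)"
  by (intro reach_one move.join)

lemma reach_close:
  "P \<noteq> [] \<Longrightarrow> adj (last P) (hd P) \<Longrightarrow> closed_wrt \<T> (set P) \<Longrightarrow>
    rch 1 (add_mset P R, C) (R, add_mset P C)"
  by (intro reach_one move.close)

lemma reach_rev: "P \<noteq> [] \<Longrightarrow> rch 1 (add_mset P R, C) (add_mset (rev P) R, C)"
  by (intro reach_one move.reverse)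

lemma rearr_rotate:
  assumes "A \<noteq> []" "B \<noteq> []" "adj (last B) (hd A)"
  shows "rearr 2 (A @ B) (B @ A)"
  unfolding rearr_def
proof (intro conjI allI)
  fix R C
  have "rch 1 (add_mset (A @ B) R, C) (add_mset B (add_mset A R), C)"
    using reach_split[OF assms(1,2), of R C] by (simp add: add_mset_commute)
  from reach_trans[OF this reach_join] assms
  show "rch 2 (add_mset (A @ B) R, C) (add_mset (B @ A) R, C)" by simp
qed (use assms in auto)

lemma rearr_rev_prefix:
  assumes "A \<noteq> []" "B \<noteq> []" "adj (hd A) (hd B)"
  shows "rearr 3 (A @ B) (rev A @ B)"
  unfolding rearr_def
proof (intro conjI allI)
  fix R C
  have "rch 2 (add_mset (A @ B) R, C) (add_mset (rev A) (add_mset B R), C)"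
    using reach_trans[OF reach_split[OF assms(1,2), of R C] reach_rev[of A "add_mset B R" C]] assms
    by simp
  from reach_trans[OF this reach_join] assms
  show "rch 3 (add_mset (A @ B) R, C) (add_mset (rev A @ B) R, C)" by (simp add: last_rev)
qed (use assms in auto)

lemma rearr_rev_suffix:
  assumes "A \<noteq> []" "B \<noteq> []" "adj (last A) (last B)"
  shows "rearr 3 (A @ B) (A @ rev B)"
  unfolding rearr_def
proof (intro conjI allI)
  fix R C
  have "rch 1 (add_mset (A @ B) R, C) (add_mset B (add_mset A R), C)"
    using reach_split[OF assms(1,2), of R C] by (simp add: add_mset_commute)
  from reach_trans[OF this reach_rev[OF assms(2)], of 2]
  have "rch 2 (add_mset (A @ B) R, C) (add_mset A (add_mset (rev B) R), C)"
    by (simp add: add_mset_commute)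
  from reach_trans[OF this reach_join] assms
  show "rch 3 (add_mset (A @ B) R, C) (add_mset (A @ rev B) R, C)" by (simp add: hd_rev)
qed (use assms in auto)

lemma endable_mono: "rearr n P P' \<Longrightarrow> n \<le> 5 \<Longrightarrow> last P' = v \<Longrightarrow> endable P v"
  unfolding endable_def rearr_def using reach_mono by blast

lemma endable_last: "P \<noteq> [] \<Longrightarrow> endable P (last P)"
  using endable_mono[OF rearr_refl[of P 0]] by simp

lemma endable_hd: "P \<noteq> [] \<Longrightarrow> endable P (hd P)"
  using endable_mono[OF rearr_rev[of P]] by (simp add: last_rev)

text \<open>Posa rotation: the chord from \<open>hd A\<close> to \<open>hd B\<close> replaces the
  path edge between \<open>A\<close> and \<open>B\<close>, which makes \<open>last A\<close> an
  end.\<close>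

lemma endable_posa_hd:
  assumes "A \<noteq> []" "B \<noteq> []" "adj (hd A) (hd B)"
  shows "endable (A @ B) (last A)"
proof -
  have "rearr 4 (A @ B) (rev (rev A @ B))"
    using rearr_trans[OF rearr_rev_prefix[OF assms] rearr_rev] assms by simp
  from endable_mono[OF this _ refl] show ?thesis using assms by (simp add: last_rev)
qed

text \<open>The pattern behind the theorems of Dirac and Ore: running through \<open>A\<close> and
  then backwards through \<open>B\<close>, the two chords close a cycle on all vertices of the
  path.\<close>

definition crossing :: "'v list \<Rightarrow> bool" where
  "crossing P \<longleftrightarrow> (\<exists>A B. P = A @ B \<and> A \<noteq> [] \<and> B \<noteq> [] \<and>
     adj (hd A) (hd B) \<and> adj (last A) (last B))"

text \<open>Such a path can be opened at every vertex. With only two vertices the path edge itself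
  would pass for a closing edge, hence the length bound.\<close>

definition spinnable :: "'v list \<Rightarrow> bool" where
  "spinnable P \<longleftrightarrow> length P \<ge> 3 \<and> (adj (hd P) (last P) \<or> crossing P)"

lemma rearr_closable:
  assumes "adj (last P) (hd P)" "v \<in> set P"
  obtains P' where "rearr 2 P P'" "last P' = v"
proof (cases "v = last P")
  case True
  with assms have "rearr 2 P P" by (intro rearr_refl) auto
  with True that show ?thesis by blast
next
  case False
  from assms(2) obtain A B where P: "P = A @ v # B" by (auto simp: in_set_conv_decomp)
  with False have "B \<noteq> []" by auto
  with assms P have "rearr 2 ((A @ [v]) @ B) (B @ (A @ [v]))"
    by (intro rearr_rotate) (auto simp: hd_append)
  with P show ?thesis by (intro that[of "B @ A @ [v]"]) auto
qed

lemma endable_spinnable: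
  assumes "spinnable P" "v \<in> set P"
  shows "endable P v"
proof (cases "adj (hd P) (last P)")
  case True
  then have "adj (last P) (hd P)" by (rule adj_sym)
  from rearr_closable[OF this assms(2)] obtain P' where "rearr 2 P P'" "last P' = v" .
  from endable_mono[OF this(1) _ this(2)] show ?thesis by simp
next
  case False
  with assms obtain A B where AB: "P = A @ B" "A \<noteq> []" "B \<noteq> []" "adj (hd A) (hd B)" "adj (last A) (last B)"
    unfolding spinnable_def crossing_def by blast
  have r: "rearr 3 P (A @ rev B)" using rearr_rev_suffix[of A B] AB by simp
  have "adj (last (A @ rev B)) (hd (A @ rev B))"
    using AB adj_sym by (simp add: last_rev)
  from rearr_closable[OF this, of v] obtain P' where "rearr 2 (A @ rev B) P'" "last P' = v"
    using assms AB by auto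
  with r have "rearr 5 P P'" by (intro rearr_trans[OF r]) auto
  with \<open>last P' = v\<close> show ?thesis by (intro endable_mono) auto
qed

section \<open>Exchanges that save a path\<close>

lemma no_join:
  assumes "no_fewer 12 (add_mset P (add_mset P' R), C)" "endable P u" "endable P' v"
  shows "\<not> adj u v"
proof
  assume a: "adj u v"
  from assms obtain Q Q' where Q: "rearr 5 P Q" "last Q = u" and Q': "rearr 5 P' Q'" "last Q' = v"
    unfolding endable_def by blast
  have ne: "Q \<noteq> []" "Q' \<noteq> []" using Q Q' by (auto simp: rearr_def)
  have 1: "rch 5 (add_mset P (add_mset P' R), C) (add_mset P' (add_mset Q R), C)"
    using rearrD[OF Q(1), of "add_mset P' R" C] by (simp add: add_mset_commute)
  have 2: "rch 10 (add_mset P (add_mset P' R), C) (add_mset Q' (add_mset Q R), C)"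
    by (rule reach_trans[OF 1 rearrD[OF Q'(1)]]) simp
  have 3: "rch 11 (add_mset P (add_mset P' R), C) (add_mset Q (add_mset (rev Q') R), C)"
    using reach_trans[OF 2 reach_rev[OF ne(2)], of 11] by (simp add: add_mset_commute)
  have "rch 12 (add_mset P (add_mset P' R), C) (add_mset (Q @ rev Q') R, C)"
    by (rule reach_trans[OF 3 reach_join]) (use ne a Q Q' in \<open>auto simp: hd_rev\<close>)
  from no_fewerD[OF assms(1) this] show False by simp
qed

text \<open>After cutting between \<open>A\<close> and \<open>B\<close>, the pieces are attached to
  the other two paths, and three paths become two. The first 8 moves produce
  \<open>Q @ rev A\<close>; the remaining 12 are those of \<open>no_join\<close>.\<close>

lemma no_bridge:
  assumes "no_fewer 20 (add_mset P (add_mset P' (add_mset (A @ B) R)), C)"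
    "endable P u" "endable P' v" "A \<noteq> []" "B \<noteq> []" "adj u (last A)"
  shows "\<not> adj v (hd B)"
proof
  assume a: "adj v (hd B)"
  from assms obtain Q where Q: "rearr 5 P Q" "last Q = u"
    unfolding endable_def by blast
  have ne: "Q \<noteq> []" using Q by (auto simp: rearr_def)
  let ?S = "(add_mset P (add_mset P' (add_mset (A @ B) R)), C)"
  have 1: "rch 5 ?S (add_mset (A @ B) (add_mset Q (add_mset P' R)), C)"
    using rearrD[OF Q(1), of "add_mset P' (add_mset (A @ B) R)" C] by (simp add: add_mset_commute)
  have 2: "rch 6 ?S (add_mset A (add_mset B (add_mset Q (add_mset P' R))), C)"
    by (rule reach_trans[OF 1 reach_split]) (use assms in auto)
  have 3: "rch 7 ?S (add_mset Q (add_mset (rev A) (add_mset B (add_mset P' R))), C)"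
    using reach_trans[OF 2 reach_rev[OF assms(4)], of 7] by (simp add: add_mset_commute)
  have 4: "rch 8 ?S (add_mset P' (add_mset B (add_mset (Q @ rev A) R)), C)"
    using reach_trans[OF 3 reach_join, of 8] ne assms Q by (simp add: add_mset_commute hd_rev)
  have "no_fewer 12 (add_mset P' (add_mset B (add_mset (Q @ rev A) R)), C)"
    by (rule no_fewer_reach[OF assms(1) 4]) auto
  from no_join[OF this assms(3) endable_hd[OF assms(5)]] a show False by simp
qed

lemma reach_insert:
  assumes "rearr n P P'" "A \<noteq> []" "B \<noteq> []" "adj (last A) (hd P')" "adj (last P') (hd B)"
  shows "rch (n + 3) (add_mset P (add_mset (A @ B) R), C) (add_mset (A @ P' @ B) R, C)"
proof -
  let ?S = "(add_mset P (add_mset (A @ B) R), C)"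
  have ne: "P' \<noteq> []" using assms by (simp add: rearr_def)
  have 1: "rch n ?S (add_mset (A @ B) (add_mset P' R), C)"
    using rearrD[OF assms(1), of "add_mset (A @ B) R" C] by (simp add: add_mset_commute)
  have 2: "rch (n + 1) ?S (add_mset A (add_mset P' (add_mset B R)), C)"
    using reach_trans[OF 1 reach_split[OF assms(2,3)], of "n + 1"] by (simp add: add_mset_commute)
  have 3: "rch (n + 2) ?S (add_mset (A @ P') (add_mset B R), C)"
    by (rule reach_trans[OF 2 reach_join]) (use assms ne in auto)
  have "rch (n + 3) ?S (add_mset ((A @ P') @ B) R, C)"
    by (rule reach_trans[OF 3 reach_join]) (use assms ne in auto)
  then show ?thesis by simp
qed

lemma no_insert:
  assumes "no_fewer 8 (add_mset P (add_mset (A @ B) R), C)" "rearr n P P'" "n \<le> 5"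
    "A \<noteq> []" "B \<noteq> []" "adj (last A) (hd P')" "adj (last P') (hd B)"
  shows False
  using no_fewerD[OF assms(1) reach_insert[OF assms(2,4-7)]] assms(3) by simp

lemma no_close:
  assumes "no_fewer 1 (add_mset P R, C)" "P \<noteq> []" "adj (last P) (hd P)"
  shows "\<not> closed_wrt \<T> (set P)"
  using no_fewerD[OF assms(1) reach_close[OF assms(2,3)]] by auto

end

section \<open>Local optima\<close>

lemma append_eq_splitE:
  assumes "A @ B = A' @ B'"
  obtains C where "A = A' @ C" "B' = C @ B" | C where "A' = A @ C" "B = C @ B'"
  using assms by (auto simp: append_eq_append_conv2)

lemma path_weight_rev: "path_weight \<T> (rev P) = path_weight \<T> P"
  by (simp add: path_weight_def unlocked_rev)

lemma potential_add_path:
  "potential \<T> (add_mset P R, C) = 200000 + path_weight \<T> P + potential \<T> (R, C)"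
  by (simp add: potential_def rest_weight_def)

text \<open>\<open>G\<close> stands for the edges of weight 1 between terminals in an optimal solution; the flag
  distinguishes parallel edges.\<close>

locale local_optimum = moves adj \<T> for adj :: "'v \<Rightarrow> 'v \<Rightarrow> bool" and \<T> +
  fixes U :: "'v set" and Ps Cs :: "'v list multiset" and G :: "('v set \<times> bool) set"
  assumes adj_irrefl: "\<not> adj u u"
    and finite_U: "finite U"
    and not_closed_singleton: "x \<in> U \<Longrightarrow> \<not> closed_wrt \<T> {x}"
    and cover: "(\<Sum>P\<in>#Ps. mset P) + (\<Sum>C\<in>#Cs. mset C) = mset_set U"
    and nonempty: "P \<in># Ps \<Longrightarrow> P \<noteq> []"
    and optimal: "local_opt adj \<T> (Ps, Cs)"
    and finite_G: "finite G"
    and G_edge: "e \<in> G \<Longrightarrow> \<exists>u v. fst e = {u, v} \<and> u \<in> U \<and> v \<in> U \<and> adj u v"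
    and G_deg: "v \<in> U \<Longrightarrow> card {e \<in> G. v \<in> fst e} \<le> 2"
    and G_closed: "X \<subseteq> U \<Longrightarrow>
      (\<And>v. v \<in> X \<Longrightarrow> card {e \<in> G. v \<in> fst e} = 2 \<and> (\<forall>e\<in>G. v \<in> fst e \<longrightarrow> fst e \<subseteq> X)) \<Longrightarrow>
      closed_wrt \<T> X"
begin

text \<open>Admitting both directions of every path halves the case distinctions below.\<close>

definition dir :: "'v list \<Rightarrow> bool" where
  "dir D \<longleftrightarrow> D \<in># Ps \<or> rev D \<in># Ps"

lemma dir_rev: "dir (rev D) \<longleftrightarrow> dir D"
  by (auto simp: dir_def)

lemma dir_mem: "P \<in># Ps \<Longrightarrow> dir P"
  by (auto simp: dir_def)

lemma dir_nonempty: "dir D \<Longrightarrow> D \<noteq> []"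
  using nonempty by (force simp: dir_def)

lemma count_le_one: "count (\<Sum>P\<in>#Ps. mset P) v + count (\<Sum>C\<in>#Cs. mset C) v \<le> 1"
  using arg_cong[OF cover, of "\<lambda>M. count M v"] count_mset_set(1)[OF finite_U, of v]
  by (cases "v \<in> U") (auto simp: finite_U)

lemma Ps_vertices: "P \<in># Ps \<Longrightarrow> distinct P \<and> set P \<subseteq> U"
proof -
  assume P: "P \<in># Ps"
  then obtain R where R: "Ps = add_mset P R" by (metis insert_DiffM)
  have 1: "count (mset P) v \<le> 1" for v
    using count_le_one[of v] R by simp
  then have "distinct P" by (simp add: distinct_count_atmost_1 le_Suc_eq not_in_iff)
  moreover have "set P \<subseteq> U"
  proof
    fix v assume "v \<in> set P"
    then have "v \<in># (\<Sum>P\<in>#Ps. mset P) + (\<Sum>C\<in>#Cs. mset C)" using R by simp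
    then show "v \<in> U" using cover finite_U by simp
  qed
  ultimately show ?thesis by simp
qed

lemma dir_distinct: "dir D \<Longrightarrow> distinct D"
  using Ps_vertices by (force simp: dir_def)

lemma dir_subset: "dir D \<Longrightarrow> set D \<subseteq> U"
  using Ps_vertices by (force simp: dir_def)

lemma Ps_disjoint:
  assumes "Ps = add_mset P (add_mset P' R)" shows "set P \<inter> set P' = {}"
proof (rule ccontr)
  assume "set P \<inter> set P' \<noteq> {}"
  then obtain v where "v \<in> set P" "v \<in> set P'" by auto
  then have "count (mset P) v \<ge> 1" "count (mset P') v \<ge> 1"
    by (simp_all add: Suc_le_eq)
  moreover have "count (\<Sum>P\<in>#Ps. mset P) v \<ge> count (mset P) v + count (mset P') v"
    using assms by simp
  ultimately show False using count_le_one[of v] by linarith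
qed

lemma Ps_two: "P \<in># Ps \<Longrightarrow> P' \<in># Ps \<Longrightarrow> P \<noteq> P' \<Longrightarrow> \<exists>R. Ps = add_mset P (add_mset P' R)"
  by (metis insert_DiffM insert_noteq_member)

lemma Ps_three: "P \<in># Ps \<Longrightarrow> P' \<in># Ps \<Longrightarrow> P'' \<in># Ps \<Longrightarrow> P \<noteq> P' \<Longrightarrow> P \<noteq> P'' \<Longrightarrow> P' \<noteq> P'' \<Longrightarrow>
    \<exists>R. Ps = add_mset P (add_mset P' (add_mset P'' R))"
  by (metis insert_DiffM insert_noteq_member)

lemma Ps_unique:
  assumes "P \<in># Ps" "P' \<in># Ps" "v \<in> set P" "v \<in> set P'" shows "P = P'"
  using assms Ps_two[of P P'] Ps_disjoint by blast

text \<open>The paths are disjoint and nonempty, so none is repeated; counting may take place over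
  \<open>set_mset\<close>.\<close>

lemma Ps_mset_set: "Ps = mset_set (set_mset Ps)"
proof -
  have "count Ps P = 1" if P: "P \<in># Ps" for P
  proof (rule ccontr)
    assume "count Ps P \<noteq> 1"
    with P have "count Ps P \<ge> 2"
      by (metis One_nat_def Suc_1 Suc_leI count_greater_zero_iff le_neq_implies_less)
    then have "count (Ps - {#P#}) P \<ge> 1" by simp
    then have "P \<in># Ps - {#P#}" by (simp only: count_greater_eq_one_iff)
    with P obtain R where "Ps = add_mset P (add_mset P R)" by (metis insert_DiffM)
    from Ps_disjoint[OF this] nonempty[OF P] show False by simp
  qed
  then show ?thesis
    by (intro multiset_eqI) (auto simp: count_mset_set' count_eq_zero_iff)
qed

lemma dir_same:
  assumes "dir D" "dir D'" "v \<in> set D" "v \<in> set D'" shows "D' = D \<or> D' = rev D"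
  using assms Ps_unique[of D D' v] Ps_unique[of "rev D" D' v] Ps_unique[of D "rev D'" v]
    Ps_unique[of "rev D" "rev D'" v] by (auto simp: dir_def rev_swap)

lemma dir_disjoint:
  assumes "dir D" "dir D'" "set D \<noteq> set D'" shows "set D \<inter> set D' = {}"
proof (rule ccontr)
  assume "set D \<inter> set D' \<noteq> {}"
  then obtain v where "v \<in> set D" "v \<in> set D'" by auto
  from dir_same[OF assms(1,2) this] assms(3) show False by auto
qed

lemma dir_orient:
  assumes "dir D"
  obtains P where "P \<in># Ps" "P = D \<or> P = rev D" "\<And>R C. rch 1 (add_mset P R, C) (add_mset D R, C)"
proof (cases "D \<in># Ps")
  case True
  then show ?thesis using that[of D] reach_refl by blast
next
  case False
  with assms have r: "rev D \<in># Ps" by (auto simp: dir_def)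
  have "rch 1 (add_mset (rev D) R, C) (add_mset D R, C)" for R C
    using reach_rev[of "rev D" R C] dir_nonempty[OF assms] by simp
  with r that[of "rev D"] show ?thesis by simp
qed

text \<open>Passes from the symmetric notion \<open>dir\<close> to an actual state: at most one
  reversal per path, under which the potential is invariant.\<close>

lemma start_one:
  assumes "dir D"
  obtains R where "rch 1 (Ps, Cs) (add_mset D R, Cs)" "size Ps = Suc (size R)"
    "potential \<T> (add_mset D R, Cs) = potential \<T> (Ps, Cs)"
proof -
  from dir_orient[OF assms] obtain P where P: "P \<in># Ps" "P = D \<or> P = rev D"
    "\<And>R C. rch 1 (add_mset P R, C) (add_mset D R, C)" by blast
  from P(1) obtain R where "Ps = add_mset P R" by (metis insert_DiffM)
  with P that[of R] show ?thesis by (auto simp: potential_add_path path_weight_rev)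
qed

lemma start_two:
  assumes "dir D" "dir D'" "set D \<noteq> set D'"
  obtains R where "rch 2 (Ps, Cs) (add_mset D (add_mset D' R), Cs)" "size Ps = Suc (Suc (size R))"
    "potential \<T> (add_mset D (add_mset D' R), Cs) = potential \<T> (Ps, Cs)"
proof -
  from dir_orient[OF assms(1)] obtain P where P: "P \<in># Ps" "P = D \<or> P = rev D"
    "\<And>R C. rch 1 (add_mset P R, C) (add_mset D R, C)" by blast
  from dir_orient[OF assms(2)] obtain P' where P': "P' \<in># Ps" "P' = D' \<or> P' = rev D'"
    "\<And>R C. rch 1 (add_mset P' R, C) (add_mset D' R, C)" by blast
  have "P \<noteq> P'" using P(2) P'(2) assms(3) by (metis set_rev)
  from Ps_two[OF P(1) P'(1) this] obtain R where R: "Ps = add_mset P (add_mset P' R)" ..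
  have "rch 1 (Ps, Cs) (add_mset P' (add_mset D R), Cs)"
    using P(3)[of "add_mset P' R" Cs] R by (simp add: add_mset_commute)
  from reach_trans[OF this P'(3), of 2]
  have "rch 2 (Ps, Cs) (add_mset D (add_mset D' R), Cs)" by (simp add: add_mset_commute)
  moreover have "potential \<T> (add_mset D (add_mset D' R), Cs) = potential \<T> (Ps, Cs)"
    using P(2) P'(2) R by (auto simp: potential_add_path path_weight_rev)
  ultimately show ?thesis using that R by simp
qed

lemma start_three:
  assumes "dir D" "dir D'" "dir D''" "set D \<noteq> set D'" "set D \<noteq> set D''" "set D' \<noteq> set D''"
  obtains R where "rch 3 (Ps, Cs) (add_mset D (add_mset D' (add_mset D'' R)), Cs)"
    "size Ps = Suc (Suc (Suc (size R)))"
    "potential \<T> (add_mset D (add_mset D' (add_mset D'' R)), Cs) = potential \<T> (Ps, Cs)"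
proof -
  from dir_orient[OF assms(1)] obtain P where P: "P \<in># Ps" "P = D \<or> P = rev D"
    "\<And>R C. rch 1 (add_mset P R, C) (add_mset D R, C)" by blast
  from dir_orient[OF assms(2)] obtain P' where P': "P' \<in># Ps" "P' = D' \<or> P' = rev D'"
    "\<And>R C. rch 1 (add_mset P' R, C) (add_mset D' R, C)" by blast
  from dir_orient[OF assms(3)] obtain P'' where P'': "P'' \<in># Ps" "P'' = D'' \<or> P'' = rev D''"
    "\<And>R C. rch 1 (add_mset P'' R, C) (add_mset D'' R, C)" by blast
  have "P \<noteq> P'" "P \<noteq> P''" "P' \<noteq> P''" using P(2) P'(2) P''(2) assms(4-6) by (metis set_rev)+
  from Ps_three[OF P(1) P'(1) P''(1) this]
  obtain R where R: "Ps = add_mset P (add_mset P' (add_mset P'' R))" ..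
  have "rch 1 (Ps, Cs) (add_mset P' (add_mset D (add_mset P'' R)), Cs)"
    using P(3)[of "add_mset P' (add_mset P'' R)" Cs] R by (simp add: add_mset_commute)
  from reach_trans[OF this P'(3), of 2]
  have "rch 2 (Ps, Cs) (add_mset P'' (add_mset D (add_mset D' R)), Cs)" by (simp add: add_mset_commute)
  from reach_trans[OF this P''(3), of 3]
  have "rch 3 (Ps, Cs) (add_mset D (add_mset D' (add_mset D'' R)), Cs)" by (simp add: add_mset_commute)
  moreover have "potential \<T> (add_mset D (add_mset D' (add_mset D'' R)), Cs) = potential \<T> (Ps, Cs)"
    using P(2) P'(2) P''(2) R by (auto simp: potential_add_path path_weight_rev)
  ultimately show ?thesis using that R by simp
qed

section \<open>Adjacencies excluded by the number of paths\<close>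

lemma no_fewer_start: "no_fewer 100 (Ps, Cs)"
  using local_opt_no_fewer[OF optimal] .

lemma no_fewer_after: "rch m (Ps, Cs) (R, C) \<Longrightarrow> size R \<le> size Ps \<Longrightarrow> m + k \<le> 100 \<Longrightarrow> no_fewer k (R, C)"
  using no_fewer_reach[OF no_fewer_start] by simp

lemma endable_not_adj:
  assumes "dir D" "dir D'" "set D \<noteq> set D'" "endable D u" "endable D' v"
  shows "\<not> adj u v"
proof -
  from start_two[OF assms(1-3)] obtain R where
    "rch 2 (Ps, Cs) (add_mset D (add_mset D' R), Cs)" "size Ps = Suc (Suc (size R))" by metis
  from no_fewer_after[OF this(1)] this(2) have "no_fewer 12 (add_mset D (add_mset D' R), Cs)" by simp
  from no_join[OF this assms(4,5)] show ?thesis .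
qed

lemma bridge_not_adj:
  assumes "dir D" "dir D'" "dir (A @ B)" "set D \<noteq> set D'" "set D \<noteq> set (A @ B)" "set D' \<noteq> set (A @ B)"
    "endable D u" "endable D' v" "A \<noteq> []" "B \<noteq> []" "adj u (last A)"
  shows "\<not> adj v (hd B)"
proof -
  from start_three[OF assms(1-6)] obtain R where
    "rch 3 (Ps, Cs) (add_mset D (add_mset D' (add_mset (A @ B) R)), Cs)" "size Ps = Suc (Suc (Suc (size R)))" by metis
  from no_fewer_after[OF this(1)] this(2) have "no_fewer 20 (add_mset D (add_mset D' (add_mset (A @ B) R)), Cs)" by simp
  from no_bridge[OF this assms(7-)] show ?thesis .
qed

lemma insert_impossible:
  assumes "dir D" "dir (A @ B)" "set D \<noteq> set (A @ B)" "rearr n D D'" "n \<le> 5"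
    "A \<noteq> []" "B \<noteq> []" "adj (last A) (hd D')" "adj (last D') (hd B)"
  shows False
proof -
  from start_two[OF assms(1-3)] obtain R where
    "rch 2 (Ps, Cs) (add_mset D (add_mset (A @ B) R), Cs)" "size Ps = Suc (Suc (size R))" by metis
  from no_fewer_after[OF this(1)] this(2) have "no_fewer 8 (add_mset D (add_mset (A @ B) R), Cs)" by simp
  from no_insert[OF this assms(4-)] show ?thesis .
qed

lemma close_impossible:
  assumes "dir D" "adj (last D) (hd D)" shows "\<not> closed_wrt \<T> (set D)"
proof -
  from start_one[OF assms(1)] obtain R where
    "rch 1 (Ps, Cs) (add_mset D R, Cs)" "size Ps = Suc (size R)" by blast
  from no_fewer_after[OF this(1)] this(2) have "no_fewer 1 (add_mset D R, Cs)" by simp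
  from no_close[OF this dir_nonempty[OF assms(1)] assms(2)] show ?thesis .
qed

text \<open>\<open>u\<close> leaves its path and moves into an edge of another path, both of whose
  ends are adjacent to it. The number of paths does not change, so optimality persists, while the
  rest \<open>D1\<close> has gained a new end. Of the seven moves, three rearrange \<open>D\<close>,
  one splits off \<open>u\<close>, and three insert it.\<close>

lemma reach_shift:
  assumes "dir D" "rearr 3 D (u # D1)" "D1 \<noteq> []" "dir (A @ B)" "set D \<noteq> set (A @ B)" "A \<noteq> []" "B \<noteq> []"
    "adj u (last A)" "adj u (hd B)"
    "rch m (Ps, Cs) (add_mset D (add_mset (A @ B) R), C)"
  shows "rch (m + 7) (Ps, Cs) (add_mset D1 (add_mset (A @ [u] @ B) R), C)"
proof -
  have 1: "rch (m + 3) (Ps, Cs) (add_mset (u # D1) (add_mset (A @ B) R), C)"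
    by (rule reach_trans[OF assms(10) rearrD[OF assms(2)]]) simp
  have 2: "rch (m + 4) (Ps, Cs) (add_mset [u] (add_mset (A @ B) (add_mset D1 R)), C)"
    using reach_trans[OF 1 reach_split[of "[u]" D1, simplified], of "m + 4"] assms(3)
    by (simp add: add_mset_commute)
  have "rearr 0 [u] [u]" by (rule rearr_refl) simp
  from reach_trans[OF 2 reach_insert[OF this assms(6,7)], of "m + 7"] assms(8,9) adj_sym
  show ?thesis by (simp add: add_mset_commute)
qed

lemma shift_no_fewer:
  assumes "dir D" "rearr 3 D (u # D1)" "D1 \<noteq> []" "dir (A @ B)" "set D \<noteq> set (A @ B)" "A \<noteq> []" "B \<noteq> []"
    "adj u (last A)" "adj u (hd B)"
  obtains R where "no_fewer 50 (add_mset D1 (add_mset (A @ [u] @ B) R), Cs)"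
proof -
  from start_two[OF assms(1,4,5)] obtain R where
    R: "rch 2 (Ps, Cs) (add_mset D (add_mset (A @ B) R), Cs)" "size Ps = Suc (Suc (size R))" by metis
  from reach_shift[OF assms R(1)]
  have "no_fewer 50 (add_mset D1 (add_mset (A @ [u] @ B) R), Cs)"
    by (rule no_fewer_after) (use R in auto)
  with that show ?thesis .
qed

text \<open>After the shift of \<open>u\<close>, the vertex \<open>hd D1\<close> is an end, and
  \<open>w\<close> is still one.\<close>

lemma shift_nbr_not_hit_same:
  assumes "dir (u # D1)" "D1 \<noteq> []" "dir (A @ B)" "set (u # D1) \<noteq> set (A @ B)" "A \<noteq> []" "B \<noteq> []"
    "adj u (last A)" "adj u (hd B)" "w = hd A \<or> w = last B"
  shows "\<not> adj w (hd D1)"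
proof -
  have "rearr 3 (u # D1) (u # D1)" by (rule rearr_refl) simp
  from shift_no_fewer[OF assms(1) this assms(2-8)] obtain R where
    "no_fewer 50 (add_mset D1 (add_mset (A @ [u] @ B) R), Cs)" .
  then have n: "no_fewer 12 (add_mset (A @ [u] @ B) (add_mset D1 R), Cs)"
    using no_fewer_reach[OF _ reach_refl[of 0]] by (fastforce simp: add_mset_commute)
  have "endable (A @ [u] @ B) w"
    using assms endable_hd[of "A @ [u] @ B"] endable_last[of "A @ [u] @ B"] by auto
  from no_join[OF n this endable_hd[OF assms(2)]] show ?thesis .
qed

lemma shift_nbr_not_hit_other:
  assumes "dir (u # D1)" "D1 \<noteq> []" "dir (A @ B)" "set (u # D1) \<noteq> set (A @ B)" "A \<noteq> []" "B \<noteq> []"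
    "adj u (last A)" "adj u (hd B)" "dir W" "set W \<noteq> set (u # D1)" "set W \<noteq> set (A @ B)" "endable W w"
  shows "\<not> adj w (hd D1)"
proof -
  have r: "rearr 3 (u # D1) (u # D1)" by (rule rearr_refl) simp
  from start_three[OF assms(1,3,9,4)] assms(10,11) obtain R where
    R: "rch 3 (Ps, Cs) (add_mset (u # D1) (add_mset (A @ B) (add_mset W R)), Cs)"
    "size Ps = Suc (Suc (Suc (size R)))" by metis
  from reach_shift[OF assms(1) r assms(2-8) R(1)]
  have "no_fewer 12 (add_mset D1 (add_mset (A @ [u] @ B) (add_mset W R)), Cs)"
    by (rule no_fewer_after) (use R in auto)
  then have "no_fewer 12 (add_mset W (add_mset D1 (add_mset (A @ [u] @ B) R)), Cs)"
    by (simp add: add_mset_commute)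
  from no_join[OF this assms(12) endable_hd[OF assms(2)]] show ?thesis .
qed

lemma shift_close_impossible:
  assumes "dir D" "rearr 3 D (u # D1)" "D1 \<noteq> []" "dir (A @ B)" "set D \<noteq> set (A @ B)" "A \<noteq> []" "B \<noteq> []"
    "adj u (last A)" "adj u (hd B)" "adj (last D1) (hd D1)" "closed_wrt \<T> (set D1)"
  shows False
proof -
  from shift_no_fewer[OF assms(1-9)] obtain R where
    "no_fewer 50 (add_mset D1 (add_mset (A @ [u] @ B) R), Cs)" .
  from no_fewer_reach[OF this reach_refl[of 0], of 1] no_close[OF _ assms(3,10)] assms(11) show False by simp
qed

text \<open>Both vertices of the pair are absorbed by edges of other paths, so a path is saved. If
  the two edges lie on the same path, the insertion of \<open>a\<close> leaves the other edge
  intact; if they coincide, the pair is inserted as a whole.\<close>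

lemma two_shifts_impossible:
  assumes "dir [a, b]" "dir (A @ B)" "set [a, b] \<noteq> set (A @ B)" "A \<noteq> []" "B \<noteq> []"
    "adj a (last A)" "adj a (hd B)"
    "dir (A' @ B')" "set [a, b] \<noteq> set (A' @ B')" "A' \<noteq> []" "B' \<noteq> []"
    "adj b (last A')" "adj b (hd B')"
  shows False
proof -
  have r: "rearr 3 [a, b] (a # [b])" by (rule rearr_refl) simp
  have rb: "rearr 0 [b] [b]" by (rule rearr_refl) simp
  show False
  proof (cases "set (A' @ B') = set (A @ B)")
    case False
    from start_three[OF assms(1,2,8,3)] False assms(9) obtain R where
      R: "rch 3 (Ps, Cs) (add_mset [a, b] (add_mset (A @ B) (add_mset (A' @ B') R)), Cs)"
      "size Ps = Suc (Suc (Suc (size R)))" by metis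
    from reach_shift[OF assms(1) r _ assms(2-7) R(1)]
    have "rch 10 (Ps, Cs) (add_mset [b] (add_mset (A' @ B') (add_mset (A @ [a] @ B) R)), Cs)"
      by (simp add: add_mset_commute)
    then have "no_fewer 8 (add_mset [b] (add_mset (A' @ B') (add_mset (A @ [a] @ B) R)), Cs)"
      by (rule no_fewer_after) (use R in auto)
    from no_insert[OF this rb _ assms(10,11)] assms(12,13) adj_sym show False by auto
  next
    case True
    have ab: "set (A @ B) \<inter> set (A' @ B') \<noteq> {}" using True assms(4) by auto
    have "\<exists>A' B'. A' @ B' = A @ B \<and> A' \<noteq> [] \<and> B' \<noteq> [] \<and> adj b (last A') \<and> adj b (hd B')"
    proof (cases "A' @ B' = A @ B")
      case False
      with ab dir_same[OF assms(2,8)] have "A' @ B' = rev (A @ B)" by blast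
      then have "rev B' @ rev A' = A @ B" by (metis rev_append rev_rev_ident)
      then show ?thesis using assms
        by (intro exI[of _ "rev B'"] exI[of _ "rev A'"]) (auto simp: last_rev hd_rev)
    qed (use assms in blast)
    then obtain A' B' where AB': "A' @ B' = A @ B" "A' \<noteq> []" "B' \<noteq> []" "adj b (last A')" "adj b (hd B')"
      by blast
    from shift_no_fewer[OF assms(1) r _ assms(2-7)] obtain R where
      "no_fewer 50 (add_mset [b] (add_mset (A @ [a] @ B) R), Cs)" by auto
    from no_fewer_reach[OF this reach_refl[of 0]]
    have n: "no_fewer 8 (add_mset [b] (add_mset (A @ [a] @ B) R), Cs)" by simp
    show False
    proof (cases "A' = A")
      case True
      with AB' have "B' = B" by simp
      with insert_impossible[OF assms(1-3) r _ assms(4,5)] assms adj_sym AB' show False by auto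
    next
      case ne: False
      from AB'(1) show False
      proof (cases rule: append_eq_splitE)
        case (1 C)
        with ne have C: "C \<noteq> []" by auto
        with 1 n have "no_fewer 8 (add_mset [b] (add_mset ((A @ [a] @ C) @ B') R), Cs)" by simp
        from no_insert[OF this rb _ _ AB'(3)] AB' adj_sym 1 C show False by auto
      next
        case (2 C)
        with ne have C: "C \<noteq> []" by auto
        with 2 n have "no_fewer 8 (add_mset [b] (add_mset (A' @ (C @ [a] @ B)) R), Cs)" by simp
        from no_insert[OF this rb _ AB'(2)] AB' adj_sym 2 C show False by auto
      qed
    qed
  qed
qed

text \<open>The pair \<open>a\<close>, \<open>b\<close> is cut off and closed to a cycle of length
  2. The number of paths is unchanged, but now \<open>c\<close> is an end.\<close>

lemma split_close_not_hit:
  assumes "dir (a # b # c # D)" "adj a b" "closed_wrt \<T> {a, b}"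
    "dir W" "set W \<noteq> set (a # b # c # D)" "endable W w"
  shows "\<not> adj w c"
proof -
  from start_two[OF assms(1,4)] assms(5) obtain R where
    R: "rch 2 (Ps, Cs) (add_mset (a # b # c # D) (add_mset W R), Cs)" "size Ps = Suc (Suc (size R))"
    by metis
  from reach_trans[OF R(1) reach_split[of "[a, b]" "c # D", simplified], of 3]
  have 1: "rch 3 (Ps, Cs) (add_mset [a, b] (add_mset W (add_mset (c # D) R)), Cs)"
    by (simp add: add_mset_commute)
  from reach_trans[OF 1 reach_close, of 4] assms(2,3) adj_sym
  have "rch 4 (Ps, Cs) (add_mset W (add_mset (c # D) R), add_mset [a, b] Cs)" by simp
  then have "no_fewer 12 (add_mset W (add_mset (c # D) R), add_mset [a, b] Cs)"
    by (rule no_fewer_after) (use R in auto)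
  from no_join[OF this assms(6) endable_hd[of "c # D"]] show ?thesis by simp
qed

lemma split_close_close_impossible:
  assumes "dir [a, b, c, d]" "adj a b" "closed_wrt \<T> {a, b}" "adj c d" "closed_wrt \<T> {c, d}"
  shows False
proof -
  from start_one[OF assms(1)] obtain R where
    R: "rch 1 (Ps, Cs) (add_mset [a, b, c, d] R, Cs)" "size Ps = Suc (size R)" by blast
  from reach_trans[OF R(1) reach_split[of "[a, b]" "[c, d]", simplified], of 2]
  have 1: "rch 2 (Ps, Cs) (add_mset [a, b] (add_mset [c, d] R), Cs)" by simp
  from reach_trans[OF 1 reach_close, of 3] assms adj_sym
  have "rch 3 (Ps, Cs) (add_mset [c, d] R, add_mset [a, b] Cs)" by simp
  from no_fewer_after[OF this, of 1] R have "no_fewer 1 (add_mset [c, d] R, add_mset [a, b] Cs)" by simp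
  from no_close[OF this] assms adj_sym show False by auto
qed


section \<open>Adjacencies excluded by cycles and short paths\<close>

lemma potential_reach: "rch m (Ps, Cs) S \<Longrightarrow> m \<le> 100 \<Longrightarrow> potential \<T> (Ps, Cs) \<le> potential \<T> S"
  using optimal reach_mono unfolding local_opt_def by blast

lemma reach_absorb:
  assumes "rearr n D D'" "last D' = u" "adj u v" "v \<in> set c"
  obtains D'' where "rch (n + 2) (add_mset D R, add_mset c C) (add_mset D'' R, C)"
proof -
  from assms(4) obtain A B where c: "c = A @ v # B" by (auto simp: in_set_conv_decomp)
  have ne: "D' \<noteq> []" using assms(1) by (simp add: rearr_def)
  let ?S = "(add_mset D R, add_mset c C)"
  have 1: "rch n ?S (add_mset D' R, add_mset c C)" by (rule rearrD[OF assms(1)])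
  have "rch 1 (add_mset D' R, add_mset c C) (add_mset ((v # B) @ A) (add_mset D' R), C)"
    unfolding c by (intro reach_one unclose) simp
  from reach_trans[OF 1 this, of "n + 1"]
  have 2: "rch (n + 1) ?S (add_mset D' (add_mset ((v # B) @ A) R), C)"
    by (simp add: add_mset_commute)
  from reach_trans[OF 2 reach_join, of "n + 2"] ne assms(2,3)
  have "rch (n + 2) ?S (add_mset (D' @ (v # B) @ A) R, C)" by simp
  with that show ?thesis .
qed

text \<open>The cycle could be opened at \<open>v\<close> and appended to the path. This saves a
  cycle, that is 1000, whereas the 8 moves involved raise \<open>rest_weight\<close> by at most
  320.\<close>

lemma endable_cycle_not_adj:
  assumes "dir D" "endable D u" "c \<in># Cs" "v \<in> set c"
  shows "\<not> adj u v"
proof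
  assume a: "adj u v"
  from assms(2) obtain D' where D': "rearr 5 D D'" "last D' = u" unfolding endable_def by blast
  from start_one[OF assms(1)] obtain R where
    R: "rch 1 (Ps, Cs) (add_mset D R, Cs)" "size Ps = Suc (size R)" by metis
  from assms(3) obtain C where C: "Cs = add_mset c C" by (metis insert_DiffM)
  from reach_absorb[OF D' a assms(4)] obtain D'' where
    "rch (5 + 2) (add_mset D R, Cs) (add_mset D'' R, C)" unfolding C by blast
  from reach_trans[OF R(1) this, of 8] have r: "rch 8 (Ps, Cs) (add_mset D'' R, C)" by simp
  from potential_reach[OF r] rest_weight_reach[OF r] R(2) C show False
    by (simp add: potential_def)
qed

text \<open>Reversing \<open>A\<close> makes a closed pair consecutive in place of
  \<open>last A\<close> and \<open>hd B\<close>. The latter pair is not closed: intersections of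
  closed sets are closed, and \<open>{hd B}\<close> is not. So \<open>unlocked\<close> would
  drop.\<close>

lemma chord_not_closed:
  assumes "dir (A @ B)" "2 \<le> length A" "B \<noteq> []" "adj (hd A) (hd B)"
  shows "\<not> closed_wrt \<T> {hd A, hd B}"
proof
  assume cl: "closed_wrt \<T> {hd A, hd B}"
  have A: "A \<noteq> []" using assms(2) by auto
  from start_one[OF assms(1)] obtain R where
    R: "rch 1 (Ps, Cs) (add_mset (A @ B) R, Cs)"
    "potential \<T> (add_mset (A @ B) R, Cs) = potential \<T> (Ps, Cs)" by metis
  from reach_trans[OF R(1) rearrD[OF rearr_rev_prefix[OF A assms(3,4)]], of 4]
  have r: "rch 4 (Ps, Cs) (add_mset (rev A @ B) R, Cs)" by simp
  have d: "distinct (A @ B)" using dir_distinct[OF assms(1)] .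
  have "hd A \<noteq> last A"
    using assms(2) d by (cases A) (auto split: if_splits)
  moreover have "hd A \<noteq> hd B" "last A \<noteq> hd B" using d A assms(3) by (metis IntI distinct_append empty_iff hd_in_set last_in_set)+
  moreover have "hd B \<in> U" using dir_subset[OF assms(1)] assms(3) by auto
  ultimately have "\<not> closed_wrt \<T> {last A, hd B}"
    using cl not_closed_singleton[of "hd B"] unfolding closed_wrt_def by blast
  then have "unlocked \<T> (A @ B) > unlocked \<T> (rev A @ B)"
    using cl A assms(3) by (simp add: unlocked_append_eq unlocked_rev last_rev)
  then have "path_weight \<T> (A @ B) > path_weight \<T> (rev A @ B)"
    by (simp add: path_weight_def)
  with potential_reach[OF r] R(2) show False by (simp add: potential_add_path)
qed

text \<open>The slack 2 covers the exchange of a one-vertex path with a leaf of a three-vertex path;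
  the improvements that may follow such an exchange are larger.\<close>

definition near_opt :: "'v state \<Rightarrow> bool" where
  "near_opt S \<longleftrightarrow> (\<forall>S'. rch 4 S S' \<longrightarrow> potential \<T> S \<le> potential \<T> S' + 2)"

text \<open>\<open>M\<close> is cut off and \<open>u\<close> put in its place. This saves 20 for
  \<open>[u]\<close> and adds at most 10 for \<open>M\<close>, which has at least two vertices, and
  at most 1 in \<open>unlocked\<close>.\<close>

lemma near_opt_single_aux:
  assumes "near_opt (add_mset [u] (add_mset (L @ x # M) R), C)" "L \<noteq> []" "2 \<le> length M" "adj u x"
  shows False
proof -
  let ?S = "(add_mset [u] (add_mset (L @ x # M) R), C)"
  have "rch 1 ?S (add_mset (L @ [x]) (add_mset [u] (add_mset M R)), C)"
    using reach_split[of "L @ [x]" M "add_mset [u] R" C] assms(3)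
    by (cases M) (auto simp: add_mset_commute)
  from reach_trans[OF this reach_join, of 4] adj_sym[OF assms(4)]
  have "rch 4 ?S (add_mset (L @ [x] @ [u]) (add_mset M R), C)" by simp
  then have "potential \<T> ?S \<le> potential \<T> (add_mset (L @ [x] @ [u]) (add_mset M R), C) + 2"
    using assms(1) unfolding near_opt_def by blast
  then have 1: "path_weight \<T> [u] + path_weight \<T> (L @ x # M)
      \<le> path_weight \<T> (L @ [x] @ [u]) + path_weight \<T> M + 2"
    by (simp add: potential_add_path)
  have "unlocked \<T> (L @ [x]) + unlocked \<T> M \<le> unlocked \<T> ((L @ [x]) @ M)"
    "unlocked \<T> ((L @ [x]) @ [u]) \<le> unlocked \<T> (L @ [x]) + unlocked \<T> [u] + 1"
    by (rule unlocked_append)+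
  moreover have "length (L @ [x] @ [u]) \<ge> 3" "length (L @ x # M) \<ge> 4"
    using assms(2,3) by (cases L; simp)+
  ultimately show False using 1 assms(3) by (simp add: path_weight_def split: if_splits)
qed

text \<open>Among four vertices, one side of \<open>x\<close> has at least two; that side is the one
  to cut off.\<close>

lemma near_opt_single:
  assumes "near_opt (add_mset [u] (add_mset (L @ x # M) R), C)" "L \<noteq> []" "M \<noteq> []"
    "4 \<le> length (L @ x # M)"
  shows "\<not> adj u x"
proof
  assume a: "adj u x"
  show False
  proof (cases "2 \<le> length M")
    case True
    with near_opt_single_aux[OF assms(1,2) _ a] show False by blast
  next
    case False
    let ?S = "(add_mset [u] (add_mset (L @ x # M) R), C)"
    let ?S' = "(add_mset [u] (add_mset (rev M @ x # rev L) R), C)"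
    from False assms have len: "2 \<le> length (rev L)" by (cases M) auto
    have "rch 1 ?S (add_mset [u] (add_mset (rev M @ x # rev L) R), C)"
      using reach_rev[of "L @ x # M" "add_mset [u] R" C] by (simp add: add_mset_commute)
    note r = this
    let ?S1 = "(add_mset (rev M @ [x]) (add_mset [u] (add_mset (rev L) R)), C)"
    have "rch 1 ?S' ?S1"
      using reach_split[of "rev M @ [x]" "rev L" "add_mset [u] R" C] assms(2)
      by (auto simp: add_mset_commute)
    from reach_trans[OF r this, of 2] have "rch 2 ?S ?S1" by simp
    from reach_trans[OF this reach_join, of 4] adj_sym[OF a]
    have "rch 4 ?S (add_mset (rev M @ [x] @ [u]) (add_mset (rev L) R), C)" by simp
    then have "potential \<T> ?S \<le> potential \<T> (add_mset (rev M @ [x] @ [u]) (add_mset (rev L) R), C) + 2"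
      using assms(1) unfolding near_opt_def by blast
    then have 1: "path_weight \<T> [u] + path_weight \<T> (L @ x # M)
        \<le> path_weight \<T> (rev M @ [x] @ [u]) + path_weight \<T> L + 2"
      by (simp add: potential_add_path path_weight_rev)
    have "unlocked \<T> L + unlocked \<T> (x # M) \<le> unlocked \<T> (L @ (x # M))"
      "unlocked \<T> ((rev M @ [x]) @ [u]) \<le> unlocked \<T> (rev M @ [x]) + unlocked \<T> [u] + 1"
      by (rule unlocked_append)+
    moreover have "length (rev M @ [x] @ [u]) \<ge> 3" using assms(3) by (cases M) auto
    ultimately show False using 1 assms(4) len unlocked_rev[of \<T> "x # M"]
      by (simp add: path_weight_def split: if_splits)
  qed
qed

lemma single_not_adj_long:
  assumes "dir [u]" "dir (L @ x # M)" "u \<notin> set (L @ x # M)" "L \<noteq> []" "M \<noteq> []" "4 \<le> length (L @ x # M)"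
  shows "\<not> adj u x"
proof -
  have "set [u] \<noteq> set (L @ x # M)" using assms(3) by auto
  from start_two[OF assms(1,2) this] obtain R where
    R: "rch 2 (Ps, Cs) (add_mset [u] (add_mset (L @ x # M) R), Cs)"
    "potential \<T> (add_mset [u] (add_mset (L @ x # M) R), Cs) = potential \<T> (Ps, Cs)" by metis
  have "near_opt (add_mset [u] (add_mset (L @ x # M) R), Cs)"
    unfolding near_opt_def
  proof (intro allI impI)
    fix S' assume "rch 4 (add_mset [u] (add_mset (L @ x # M) R), Cs) S'"
    from reach_trans[OF R(1) this, of 100] have "rch 100 (Ps, Cs) S'" by simp
    from potential_reach[OF this] R(2)
    show "potential \<T> (add_mset [u] (add_mset (L @ x # M) R), Cs) \<le> potential \<T> S' + 2" by simp
  qed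
  from near_opt_single[OF this assms(4-6)] show ?thesis .
qed

text \<open>Exchanging \<open>u\<close> with the leaf \<open>q\<close> increases the potential by at most 2, so that \<open>q\<close> inherits the
  restrictions on one-vertex paths.\<close>

lemma star_leaf_not_adj_long:
  assumes "dir [u]" "dir [q, y, r]" "adj u y" "u \<notin> {q, y, r}" "dir (L @ x # M)" "u \<notin> set (L @ x # M)"
    "set [q, y, r] \<noteq> set (L @ x # M)" "L \<noteq> []" "M \<noteq> []" "4 \<le> length (L @ x # M)"
  shows "\<not> adj q x"
proof -
  let ?W = "L @ x # M"
  have s: "set [u] \<noteq> set [q, y, r]" "set [u] \<noteq> set ?W" using assms(4,6) by auto
  from start_three[OF assms(1,2,5) s assms(7)] obtain R where
    R: "rch 3 (Ps, Cs) (add_mset [u] (add_mset [q, y, r] (add_mset ?W R)), Cs)"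
    "potential \<T> (add_mset [u] (add_mset [q, y, r] (add_mset ?W R)), Cs) = potential \<T> (Ps, Cs)"
    by metis
  have "rch 3 (Ps, Cs) (add_mset ([q] @ [y, r]) (add_mset [u] (add_mset ?W R)), Cs)"
    using R(1) by (simp add: add_mset_commute)
  from reach_trans[OF this reach_split, of 4]
  have 1: "rch 4 (Ps, Cs) (add_mset [u] (add_mset [y, r] (add_mset [q] (add_mset ?W R))), Cs)"
    by (simp add: add_mset_commute)
  from reach_trans[OF 1 reach_join, of 5] assms(3)
  have 2: "rch 5 (Ps, Cs) (add_mset [q] (add_mset ?W (add_mset [u, y, r] R)), Cs)"
    by (simp add: add_mset_commute)
  have "near_opt (add_mset [q] (add_mset ?W (add_mset [u, y, r] R)), Cs)"
    unfolding near_opt_def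
  proof (intro allI impI)
    fix S' assume "rch 4 (add_mset [q] (add_mset ?W (add_mset [u, y, r] R)), Cs) S'"
    from reach_trans[OF 2 this, of 100] have "rch 100 (Ps, Cs) S'" by simp
    from potential_reach[OF this] R(2)
    show "potential \<T> (add_mset [q] (add_mset ?W (add_mset [u, y, r] R)), Cs) \<le> potential \<T> S' + 2"
      by (auto simp: potential_add_path path_weight_def split: if_splits)
  qed
  from near_opt_single[OF this assms(8-10)] show ?thesis .
qed

text \<open>Here only 10 is saved, so the piece \<open>M\<close> that is cut off must not be a
  two-vertex path itself.\<close>

lemma two_path_not_adj_long:
  assumes "dir [u, v]" "dir (L @ x # M)" "u \<notin> set (L @ x # M)" "3 \<le> length M"
  shows "\<not> adj u x"
proof
  assume a: "adj u x"
  have "set [u, v] \<noteq> set (L @ x # M)" using assms(3) by auto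
  from start_two[OF assms(1,2) this] obtain R where
    R: "rch 2 (Ps, Cs) (add_mset [u, v] (add_mset (L @ x # M) R), Cs)"
    "potential \<T> (add_mset [u, v] (add_mset (L @ x # M) R), Cs) = potential \<T> (Ps, Cs)" by metis
  have "rch 2 (Ps, Cs) (add_mset ((L @ [x]) @ M) (add_mset [u, v] R), Cs)"
    using R(1) by (simp add: add_mset_commute)
  from reach_trans[OF this reach_split, of 3]
  have 1: "rch 3 (Ps, Cs) (add_mset (L @ [x]) (add_mset [u, v] (add_mset M R)), Cs)"
    using assms(4) by (cases M) (auto simp: add_mset_commute)
  from reach_trans[OF 1 reach_join, of 4] adj_sym[OF a]
  have "rch 4 (Ps, Cs) (add_mset ((L @ [x]) @ [u, v]) (add_mset M R), Cs)" by simp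
  from potential_reach[OF this] R(2)
  have 2: "path_weight \<T> [u, v] + path_weight \<T> (L @ x # M)
      \<le> path_weight \<T> ((L @ [x]) @ [u, v]) + path_weight \<T> M"
    by (simp add: potential_add_path)
  have "unlocked \<T> (L @ [x]) + unlocked \<T> M \<le> unlocked \<T> ((L @ [x]) @ M)"
    "unlocked \<T> ((L @ [x]) @ [u, v]) \<le> unlocked \<T> (L @ [x]) + unlocked \<T> [u, v] + 1"
    by (rule unlocked_append)+
  with 2 assms(4) show False by (simp add: path_weight_def split: if_splits)
qed

end

section \<open>Charging slots to path edges\<close>

lemma (in moves) spinnable_rev: "spinnable (rev P) \<longleftrightarrow> spinnable P"
proof -
  have "crossing (rev P)" if c: "crossing P" for P
  proof -
    from c obtain A B where "P = A @ B" "A \<noteq> []" "B \<noteq> []" "adj (hd A) (hd B)" "adj (last A) (last B)"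
      unfolding crossing_def by blast
    then show ?thesis unfolding crossing_def
      by (intro exI[of _ "rev B"] exI[of _ "rev A"]) (auto simp: hd_rev last_rev intro: adj_sym)
  qed
  from this[of P] this[of "rev P"] have "crossing (rev P) = crossing P" by auto
  then show ?thesis
    unfolding spinnable_def using adj_sym by (cases "P = []") (auto simp: hd_rev last_rev)
qed

context local_optimum
begin

text \<open>A slot is an edge of \<open>G\<close> as seen from one of its ends. For a fixed vertex
  the edge alone identifies it; later sets of slots consist of pairs, since every edge is a slot of
  both its ends.\<close>

definition slots_at :: "'v \<Rightarrow> ('v set \<times> bool) set" where "slots_at v = {e \<in> G. v \<in> fst e}"

definition deficit :: "'v \<Rightarrow> nat" where "deficit v = 2 - card (slots_at v)"

lemma finite_slots_at: "finite (slots_at v)"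
  using finite_G by (simp add: slots_at_def)

lemma card_slots_at: "v \<in> U \<Longrightarrow> card (slots_at v) \<le> 2"
  using G_deg by (simp add: slots_at_def)

lemma card_slots_at_deficit: "v \<in> U \<Longrightarrow> card (slots_at v) + deficit v = 2"
  using card_slots_at by (simp add: deficit_def)

lemma three_slots:
  assumes "v \<in> U" "e1 \<in> slots_at v" "e2 \<in> slots_at v" "e3 \<in> slots_at v" "e1 \<noteq> e2" "e1 \<noteq> e3" "e2 \<noteq> e3"
  shows False
proof -
  have "card {e1, e2, e3} \<le> card (slots_at v)" using assms finite_slots_at by (intro card_mono) auto
  with card_slots_at[OF assms(1)] assms show False by simp
qed

lemma slot_pair: "v \<in> U \<Longrightarrow> e1 \<in> slots_at v \<Longrightarrow> e2 \<in> slots_at v \<Longrightarrow> e1 \<noteq> e2 \<Longrightarrow> slots_at v = {e1, e2}"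
  using three_slots by blast

lemma slotE:
  assumes "e \<in> G" "u \<in> fst e"
  obtains x where "fst e = {u, x}" "x \<noteq> u" "adj u x" "x \<in> U" "u \<in> U" "e \<in> slots_at u" "e \<in> slots_at x"
proof -
  from G_edge[OF assms(1)] obtain a b where ab: "fst e = {a, b}" "a \<in> U" "b \<in> U" "adj a b" by blast
  have "a \<noteq> b" using ab adj_irrefl by metis
  show ?thesis
  proof (cases "u = a")
    case True
    then show ?thesis using that[of b] ab \<open>a \<noteq> b\<close> assms by (auto simp: slots_at_def)
  next
    case False
    then show ?thesis using that[of a] ab \<open>a \<noteq> b\<close> assms adj_sym by (auto simp: slots_at_def)
  qed
qed

lemma edge_adj: "e \<in> G \<Longrightarrow> fst e = {u, x} \<Longrightarrow> adj u x \<and> u \<noteq> x \<and> u \<in> U \<and> x \<in> U"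
proof -
  assume e: "e \<in> G" "fst e = {u, x}"
  then have "u \<in> fst e" by simp
  from slotE[OF e(1) this] obtain y where "fst e = {u, y}" "y \<noteq> u" "adj u y" "y \<in> U" "u \<in> U" .
  then show ?thesis using e(2) by (auto simp: doubleton_eq_iff)
qed

text \<open>The parallel edges fill both slots of \<open>a\<close> and of \<open>b\<close>, so no
  edge of \<open>G\<close> leaves the pair.\<close>

lemma doubled_closed:
  assumes "e \<in> G" "e' \<in> G" "e \<noteq> e'" "fst e = {a, b}" "fst e' = {a, b}"
  shows "closed_wrt \<T> {a, b}"
proof (rule G_closed)
  show "{a, b} \<subseteq> U" using edge_adj[OF assms(1,4)] by auto
  fix v assume v: "v \<in> {a, b}"
  then have "slots_at v = {e, e'}"
    using assms edge_adj[OF assms(1,4)] by (intro slot_pair) (auto simp: slots_at_def)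
  then show "card {e \<in> G. v \<in> fst e} = 2 \<and> (\<forall>e\<in>G. v \<in> fst e \<longrightarrow> fst e \<subseteq> {a, b})"
    using assms(3-5) unfolding slots_at_def[symmetric] by (auto simp: slots_at_def)
qed

text \<open>The second of two parallel edges of \<open>G\<close> needs a charging rule of its own.\<close>

definition primary :: "'v set \<times> bool \<Rightarrow> bool" where
  "primary e \<longleftrightarrow> \<not> (snd e \<and> (fst e, False) \<in> G)"

lemma primary_eq: "e \<in> G \<Longrightarrow> e' \<in> G \<Longrightarrow> fst e = fst e' \<Longrightarrow> primary e \<Longrightarrow> primary e' \<Longrightarrow> e = e'"
  unfolding primary_def by (cases e; cases e'; cases "snd e"; cases "snd e'") auto

lemma not_primary:
  assumes "\<not> primary e"
  shows "snd e" "(fst e, False) \<in> G" "e \<noteq> (fst e, False)"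
  using assms unfolding primary_def by (cases e; simp)+

text \<open>A light neighbour of an end can be neither on a cycle nor a possible end of another
  path. What remains is an inner vertex of a path that is not spinnable.\<close>

lemma locate:
  assumes "dir D" "endable D u" "e \<in> G" "fst e = {u, x}" "x \<notin> set D"
  obtains L M where "dir (L @ x # M)" "L \<noteq> []" "M \<noteq> []" "\<not> spinnable (L @ x # M)"
    "set D \<noteq> set (L @ x # M)" "\<not> endable (L @ x # M) x"
proof -
  have a: "adj u x" "x \<in> U" using edge_adj[OF assms(3,4)] by auto
  then have "x \<in># (\<Sum>P\<in>#Ps. mset P) + (\<Sum>C\<in>#Cs. mset C)" using cover finite_U by simp
  then consider c where "c \<in># Cs" "x \<in> set c" | W where "W \<in># Ps" "x \<in> set W" by auto
  then show ?thesis
  proof cases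
    case 1
    with endable_cycle_not_adj[OF assms(1,2)] a show ?thesis by blast
  next
    case 2
    from 2(2) obtain L M where W: "W = L @ x # M" by (auto simp: in_set_conv_decomp)
    have d: "dir W" using 2(1) by (rule dir_mem)
    have ne: "set D \<noteq> set W" using assms(5) 2(2) by auto
    have ne': "\<not> endable W x" using endable_not_adj[OF assms(1) d ne assms(2)] a by blast
    have "L \<noteq> []" using ne' endable_hd[of W] W by auto
    moreover have "M \<noteq> []" using ne' endable_last[of W] W by auto
    moreover have "\<not> spinnable W" using ne' endable_spinnable[of W x] 2(2) by blast
    ultimately show ?thesis using that d ne ne' W by blast
  qed
qed

lemma rearr_close_impossible:
  assumes "dir D" "rearr 3 D D'" "adj (last D') (hd D')" shows "\<not> closed_wrt \<T> (set D')"
proof -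
  from start_one[OF assms(1)] obtain R where
    R: "rch 1 (Ps, Cs) (add_mset D R, Cs)" "size Ps = Suc (size R)" by metis
  from reach_trans[OF R(1) rearrD[OF assms(2)], of 4]
  have "rch 4 (Ps, Cs) (add_mset D' R, Cs)" by simp
  from no_fewer_after[OF this, of 1] R(2) have "no_fewer 1 (add_mset D' R, Cs)" by simp
  from no_close[OF this _ assms(3)] assms(2) show ?thesis by (auto simp: rearr_def)
qed

lemma spinnable_not_closed:
  assumes "dir D" "spinnable D" shows "\<not> closed_wrt \<T> (set D)"
proof (cases "adj (hd D) (last D)")
  case True
  with close_impossible[OF assms(1)] adj_sym show ?thesis by blast
next
  case False
  with assms(2) obtain A B where AB: "D = A @ B" "A \<noteq> []" "B \<noteq> []" "adj (hd A) (hd B)" "adj (last A) (last B)"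
    unfolding spinnable_def crossing_def by blast
  have "rearr 3 D (A @ rev B)" using rearr_rev_suffix[OF AB(2,3,5)] AB(1) by simp
  from rearr_close_impossible[OF assms(1) this] AB adj_sym show ?thesis by (auto simp: last_rev)
qed

definition outs :: "'v list \<Rightarrow> ('v \<times> 'v set \<times> bool) set" where
  "outs P = {(v, e). v \<in> set P \<and> e \<in> slots_at v \<and> \<not> fst e \<subseteq> set P}"

lemma finite_outs: "finite (outs P)"
proof -
  have "outs P \<subseteq> set P \<times> G" by (auto simp: outs_def slots_at_def)
  then show ?thesis using finite_G finite_subset by blast
qed

text \<open>Every vertex of a spinnable path can become an end, so none of its edges is charged from outside:
  with five vertices or more its own edges pay for it, otherwise the missing units come from the
  selected outgoing slots or from deficits.\<close>

lemma spinnable_selection: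
  assumes "P \<in># Ps" "spinnable P"
  shows "\<exists>X \<subseteq> outs P. 5 \<le> card X + (\<Sum>v\<in>set P. deficit v) + length P \<and>
    (\<forall>s\<in>X. \<forall>s'\<in>X. s \<noteq> s' \<longrightarrow> length P = 3 \<and> (fst s = fst s' \<longrightarrow>
      (\<exists>b c. set P = {fst s, b, c} \<and> adj b c \<and> closed_wrt \<T> {b, c})))"
proof -
  \<comment> \<open>A vertex is leaky, \<open>lv\<close>, if one of its slots is missing or leads
    out of the path.\<close>
  define lv where "lv v \<longleftrightarrow> deficit v \<noteq> 0 \<or> (\<exists>e. (v, e) \<in> outs P)" for v
  have P: "set P \<subseteq> U" "distinct P" using Ps_vertices[OF assms(1)] by auto
  have not_lv: "card (slots_at v) = 2 \<and> (\<forall>e\<in>slots_at v. fst e \<subseteq> set P)" if "v \<in> set P" "\<not> lv v" for v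
  proof -
    have "deficit v = 0" "\<And>e. (v, e) \<notin> outs P" using that by (auto simp: lv_def)
    then have "deficit v = 0" "\<And>e. e \<in> slots_at v \<Longrightarrow> fst e \<subseteq> set P" using that(1) unfolding outs_def by blast+
    then show ?thesis using card_slots_at_deficit[of v] P that(1) by auto
  qed
  \<comment> \<open>Otherwise \<open>G\<close> has full degree on the path and never leaves it, so
    the path could be turned into a cycle that respects the terminal sets.\<close>
  have ex: "\<exists>v\<in>set P. lv v"
  proof (rule ccontr)
    assume nex: "\<not> (\<exists>v\<in>set P. lv v)"
    have "closed_wrt \<T> (set P)"
    proof (intro G_closed[OF P(1)])
      fix v assume v: "v \<in> set P"
      with nex have "\<not> lv v" by blast
      from not_lv[OF v this] show "card {e \<in> G. v \<in> fst e} = 2 \<and> (\<forall>e\<in>G. v \<in> fst e \<longrightarrow> fst e \<subseteq> set P)"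
        unfolding slots_at_def by blast
    qed
    then show False using spinnable_not_closed[OF dir_mem[OF assms(1)] assms(2)] by blast
  qed
  have one: "\<exists>X \<subseteq> outs P. X \<subseteq> {v} \<times> UNIV \<and> 1 \<le> card X + deficit v \<and> card X \<le> 1" if "lv v" for v
  proof (cases "deficit v = 0")
    case True
    with that obtain e where "(v, e) \<in> outs P" by (auto simp: lv_def)
    then show ?thesis by (intro exI[of _ "{(v, e)}"]) auto
  qed (auto intro!: exI[of _ "{}"])
  have len: "length P \<ge> 3" using assms(2) by (simp add: spinnable_def)
  show ?thesis
  proof (cases "length P = 3")
    case False
    \<comment> \<open>With four or more vertices a single unit is enough.\<close>
    from ex obtain v where v: "v \<in> set P" "lv v" by blast
    from one[OF v(2)] obtain X where X: "X \<subseteq> outs P" "1 \<le> card X + deficit v" "card X \<le> 1" by blast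
    have "deficit v \<le> (\<Sum>v\<in>set P. deficit v)" using v by (intro member_le_sum) auto
    moreover have "finite X" using X finite_outs finite_subset by blast
    ultimately show ?thesis using X False len
      by (intro exI[of _ X]) (auto simp: card_le_Suc0_iff_eq)
  next
    case True
    then obtain a b c where Pabc: "P = [a, b, c]"
      by (metis length_0_conv length_Suc_conv numeral_3_eq_3)
    show ?thesis
    proof (cases "\<exists>v\<in>set P. \<exists>w\<in>set P. v \<noteq> w \<and> lv v \<and> lv w")
      case True
      then obtain v w where vw: "v \<in> set P" "w \<in> set P" "v \<noteq> w" "lv v" "lv w" by blast
      from one[OF vw(4)] obtain X where X: "X \<subseteq> outs P" "X \<subseteq> {v} \<times> UNIV" "1 \<le> card X + deficit v" "card X \<le> 1" by blast
      from one[OF vw(5)] obtain Y where Y: "Y \<subseteq> outs P" "Y \<subseteq> {w} \<times> UNIV" "1 \<le> card Y + deficit w" "card Y \<le> 1" by blast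
      have fin: "finite X" "finite Y" using X(1) Y(1) finite_outs finite_subset by blast+
      have "card (X \<union> Y) = card X + card Y" using X(2) Y(2) vw(3) fin by (intro card_Un_disjoint) auto
      moreover have "deficit v + deficit w \<le> (\<Sum>v\<in>set P. deficit v)"
        using sum_mono2[of "set P" "{v, w}" "\<lambda>v. deficit v"] vw by auto
      moreover have "\<forall>s\<in>X \<union> Y. \<forall>s'\<in>X \<union> Y. s \<noteq> s' \<longrightarrow> fst s \<noteq> fst s'"
      proof -
        have "s = s'" if "s \<in> X" "s' \<in> X" for s s' using that X(4) fin by (simp add: card_le_Suc0_iff_eq)
        moreover have "s = s'" if "s \<in> Y" "s' \<in> Y" for s s' using that Y(4) fin by (simp add: card_le_Suc0_iff_eq)
        moreover have "fst s = v" if "s \<in> X" for s using that X(2) by auto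
        moreover have "fst s = w" if "s \<in> Y" for s using that Y(2) by auto
        ultimately show ?thesis using vw(3) by (metis Un_iff)
      qed
      moreover have "5 \<le> card (X \<union> Y) + (\<Sum>v\<in>set P. deficit v) + length P"
        using calculation X(3) Y(3) \<open>length P = 3\<close> by linarith
      moreover have "X \<union> Y \<subseteq> outs P" using X(1) Y(1) by blast
      ultimately show ?thesis using \<open>length P = 3\<close> by (intro exI[of _ "X \<union> Y"]) blast
    next
      \<comment> \<open>Only \<open>z\<close> is leaky, so the other two vertices \<open>a\<close>
        and \<open>b\<close> have all their slots inside. If one of these led to \<open>z\<close>,
        then counting slots would give each of \<open>a\<close> and \<open>b\<close> an edge to
        \<open>z\<close>, and \<open>z\<close> would not be leaky. So they are two parallel edges
        between \<open>a\<close> and \<open>b\<close>, and both slots of \<open>z\<close> leave the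
        path or are missing.\<close>
      case only: False
      from ex obtain z where z: "z \<in> set P" "lv z" by blast
      have "\<exists>a b. set P = {z, a, b} \<and> distinct [z, a, b]"
        using z(1) P(2) unfolding Pabc by auto
      then obtain a b where ab: "set P = {z, a, b}" "distinct [z, a, b]" by blast
      have nlv: "\<not> lv a" "\<not> lv b" using only z ab by auto
      have ea: "card (slots_at a) = 2" "\<And>e. e \<in> slots_at a \<Longrightarrow> fst e = {a, b} \<or> fst e = {a, z}"
      proof -
        show "card (slots_at a) = 2" using not_lv[of a] nlv ab by simp
        fix e assume e: "e \<in> slots_at a"
        then have "fst e \<subseteq> {z, a, b}" using not_lv[of a] nlv ab by simp
        moreover have "e \<in> G" "a \<in> fst e" using e by (auto simp: slots_at_def)
        then obtain x where "fst e = {a, x}" "x \<noteq> a" by (rule slotE)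
        ultimately show "fst e = {a, b} \<or> fst e = {a, z}" by auto
      qed
      have eb: "card (slots_at b) = 2" "\<And>e. e \<in> slots_at b \<Longrightarrow> fst e = {a, b} \<or> fst e = {b, z}"
      proof -
        show "card (slots_at b) = 2" using not_lv[of b] nlv ab by simp
        fix e assume e: "e \<in> slots_at b"
        then have "fst e \<subseteq> {z, a, b}" using not_lv[of b] nlv ab by simp
        moreover have "e \<in> G" "b \<in> fst e" using e by (auto simp: slots_at_def)
        then obtain x where "fst e = {b, x}" "x \<noteq> b" by (rule slotE)
        ultimately show "fst e = {a, b} \<or> fst e = {b, z}" by auto
      qed
      have abz: "a \<in> U" "b \<in> U" "z \<in> U" using ab P by auto
      obtain e1 e2 where e12: "slots_at a = {e1, e2}" "e1 \<noteq> e2" using ea(1) by (auto simp: card_2_iff)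
      obtain d1 d2 where d12: "slots_at b = {d1, d2}" "d1 \<noteq> d2" using eb(1) by (auto simp: card_2_iff)
      have dbl: "fst e1 = {a, b} \<and> fst e2 = {a, b}"
      proof (rule ccontr)
        assume "\<not> ?thesis"
        then obtain e where e: "e \<in> slots_at a" "fst e = {a, z}" using ea(2) e12 by blast
        show False
        proof (cases "\<exists>d\<in>slots_at b. fst d = {b, z}")
          case True
          then obtain d where d: "d \<in> slots_at b" "fst d = {b, z}" by blast
          have "e \<noteq> d" using e d ab by (auto simp: doubleton_eq_iff)
          then have "slots_at z = {e, d}" using e d abz by (intro slot_pair) (auto simp: slots_at_def)
          then have "\<not> lv z" using e d ab \<open>e \<noteq> d\<close> by (auto simp: lv_def outs_def deficit_def)
          then show False using z by blast
        next
          case False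
          then have "fst d1 \<noteq> {b, z}" "fst d2 \<noteq> {b, z}" using d12(1) by blast+
          then have "fst d1 = {a, b}" "fst d2 = {a, b}" using eb(2)[of d1] eb(2)[of d2] d12(1) by blast+
          then have "d1 \<in> slots_at a" "d2 \<in> slots_at a" using d12 by (auto simp: slots_at_def)
          moreover have "e \<noteq> d1" "e \<noteq> d2" using e ab \<open>fst d1 = {a, b}\<close> \<open>fst d2 = {a, b}\<close>
            by (auto simp: doubleton_eq_iff)
          ultimately show False using three_slots[OF abz(1) e(1)] d12(2) by blast
        qed
      qed
      have G12: "e1 \<in> G" "e2 \<in> G" using e12 by (auto simp: slots_at_def)
      have cl: "closed_wrt \<T> {a, b}" using doubled_closed[OF G12 e12(2)] dbl by blast
      have adjab: "adj a b" using edge_adj[OF G12(1)] dbl by blast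
      have "e1 \<in> slots_at b" "e2 \<in> slots_at b" using G12 dbl by (auto simp: slots_at_def)
      have outz: "(z, e) \<in> outs P" if "e \<in> slots_at z" for e
      proof -
        have "e \<notin> slots_at a" "e \<notin> slots_at b"
        proof -
          show "e \<notin> slots_at a"
            using that e12 dbl ab by (auto simp: slots_at_def)
          show "e \<notin> slots_at b"
            using that slot_pair[OF abz(2) \<open>e1 \<in> slots_at b\<close> \<open>e2 \<in> slots_at b\<close> e12(2)] dbl ab by (auto simp: slots_at_def)
        qed
        moreover have "e \<in> G" "z \<in> fst e" using that by (auto simp: slots_at_def)
        then obtain x where "fst e = {z, x}" "x \<noteq> z" by (rule slotE)
        ultimately show ?thesis using that ab unfolding outs_def by (auto simp: slots_at_def)
      qed
      let ?X = "{z} \<times> slots_at z"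
      have "card ?X + deficit z = 2" using card_slots_at_deficit[OF abz(3)] by (simp add: card_cartesian_product_singleton)
      moreover have "deficit z \<le> (\<Sum>v\<in>set P. deficit v)" using z by (intro member_le_sum) auto
      ultimately show ?thesis using outz \<open>length P = 3\<close> ab cl adjab
        by (intro exI[of _ ?X]) auto
    qed
  qed
qed

definition selection :: "'v list \<Rightarrow> ('v \<times> 'v set \<times> bool) set" where
  "selection P = (SOME X. X \<subseteq> outs P \<and> 5 \<le> card X + (\<Sum>v\<in>set P. deficit v) + length P \<and>
    (\<forall>s\<in>X. \<forall>s'\<in>X. s \<noteq> s' \<longrightarrow> length P = 3 \<and> (fst s = fst s' \<longrightarrow>
      (\<exists>b c. set P = {fst s, b, c} \<and> adj b c \<and> closed_wrt \<T> {b, c}))))"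

lemma selection:
  assumes "P \<in># Ps" "spinnable P"
  shows "selection P \<subseteq> outs P" "5 \<le> card (selection P) + (\<Sum>v\<in>set P. deficit v) + length P"
    "\<And>s s'. s \<in> selection P \<Longrightarrow> s' \<in> selection P \<Longrightarrow> s \<noteq> s' \<Longrightarrow> length P = 3 \<and> (fst s = fst s' \<longrightarrow>
      (\<exists>b c. set P = {fst s, b, c} \<and> adj b c \<and> closed_wrt \<T> {b, c}))"
proof -
  from someI_ex[OF spinnable_selection[OF assms, unfolded Bex_def]] show "selection P \<subseteq> outs P" "5 \<le> card (selection P) + (\<Sum>v\<in>set P. deficit v) + length P"
    "\<And>s s'. s \<in> selection P \<Longrightarrow> s' \<in> selection P \<Longrightarrow> s \<noteq> s' \<Longrightarrow> length P = 3 \<and> (fst s = fst s' \<longrightarrow>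
      (\<exists>b c. set P = {fst s, b, c} \<and> adj b c \<and> closed_wrt \<T> {b, c}))"
    unfolding selection_def[symmetric] by blast+
qed

text \<open>A spinnable path contributes only as many slots as the counting requires. On a
  two-vertex path an edge of \<open>G\<close> between the two vertices is a slot of both ends,
  although there is only one path edge to charge; it is kept at \<open>hd P\<close> alone.\<close>

definition slots :: "'v list \<Rightarrow> ('v \<times> 'v set \<times> bool) set" where
  "slots P = (if spinnable P then selection P
     else {(u, e). u \<in> {hd P, last P} \<and> e \<in> slots_at u \<and>
       \<not> (length P = 2 \<and> u = last P \<and> fst e = set P)})"

definition arcs :: "('v \<times> 'v set \<times> bool) set" where
  "arcs = (\<Union>P\<in>set_mset Ps. slots P)"

lemma arcsE:
  assumes "(u, e) \<in> arcs"
  obtains P where "P \<in># Ps" "u \<in> set P" "endable P u" "e \<in> slots_at u" "(u, e) \<in> slots P"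
    "\<not> spinnable P \<Longrightarrow> u = hd P \<or> u = last P" "spinnable P \<Longrightarrow> \<not> fst e \<subseteq> set P"
proof -
  from assms obtain P where P: "P \<in># Ps" "(u, e) \<in> slots P" by (auto simp: arcs_def)
  have ne: "P \<noteq> []" using nonempty[OF P(1)] .
  show ?thesis
  proof (cases "spinnable P")
    case True
    with P selection(1)[OF P(1)] have "(u, e) \<in> outs P" by (auto simp: slots_def)
    then show ?thesis using that P True endable_spinnable[OF True, of u] by (auto simp: outs_def)
  next
    case False
    with P(2) have "u = hd P \<or> u = last P" "e \<in> slots_at u" by (auto simp: slots_def)
    moreover from this(1) have "u \<in> set P" "endable P u" using ne endable_hd[OF ne] endable_last[OF ne] by auto
    ultimately show ?thesis using that[OF P(1) _ _ _ P(2)] False by blast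
  qed
qed

text \<open>Both slots of such an end \<open>u\<close> would be charged to the edge between \<open>last A\<close> and \<open>hd B\<close>. Moving \<open>u\<close>
  between these two vertices makes its neighbour an end, which therefore is not hit from outside.
  This leaves the path edge at \<open>u\<close> free for one of the two slots, called \<open>dropped u\<close>.\<close>

definition double_hitter :: "'v \<Rightarrow> bool" where
  "double_hitter u \<longleftrightarrow> (\<exists>D A B e1 e2. dir (u # D) \<and> D \<noteq> [] \<and> \<not> spinnable (u # D) \<and> dir (A @ B) \<and> A \<noteq> [] \<and> B \<noteq> [] \<and>
     u \<notin> set (A @ B) \<and> e1 \<in> G \<and> e2 \<in> G \<and> fst e1 = {u, last A} \<and> fst e2 = {u, hd B})"

lemma double_hitterE:
  assumes "double_hitter u"
  obtains D A B e1 e2 where "dir (u # D)" "D \<noteq> []" "\<not> spinnable (u # D)" "dir (A @ B)" "A \<noteq> []" "B \<noteq> []"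
    "u \<notin> set (A @ B)" "slots_at u = {e1, e2}" "e1 \<noteq> e2" "fst e1 = {u, last A}" "fst e2 = {u, hd B}"
    "adj u (last A)" "adj u (hd B)" "set (u # D) \<noteq> set (A @ B)"
proof -
  from assms obtain D A B e1 e2 where *: "dir (u # D)" "D \<noteq> []" "\<not> spinnable (u # D)" "dir (A @ B)" "A \<noteq> []" "B \<noteq> []"
     "u \<notin> set (A @ B)" "e1 \<in> G" "e2 \<in> G" "fst e1 = {u, last A}" "fst e2 = {u, hd B}"
    unfolding double_hitter_def by blast
  have "last A \<noteq> hd B" using dir_distinct[OF *(4)] *(5,6) by (metis disjoint_iff distinct_append hd_in_set last_in_set)
  then have ne: "e1 \<noteq> e2" using *(10,11) by (auto simp: doubleton_eq_iff)
  have "u \<in> U" using dir_subset[OF *(1)] by auto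
  then have "slots_at u = {e1, e2}" using slot_pair[of u e1 e2] * ne by (auto simp: slots_at_def)
  then show ?thesis using that[of D A B e1 e2] * ne edge_adj[OF *(8,10)] edge_adj[OF *(9,11)] by auto
qed

lemma double_hitter_slots:
  assumes "double_hitter u" "e \<in> slots_at u" "dir D" "u \<in> set D" shows "\<not> fst e \<subseteq> set D"
proof -
  from assms(1) obtain A B e1 e2 where *: "dir (A @ B)" "A \<noteq> []" "B \<noteq> []"
    "u \<notin> set (A @ B)" "slots_at u = {e1, e2}" "fst e1 = {u, last A}" "fst e2 = {u, hd B}" by (rule double_hitterE)
  have "set D \<noteq> set (A @ B)" using assms(4) *(4) by auto
  from dir_disjoint[OF assms(3) *(1) this] have "last A \<notin> set D" "hd B \<notin> set D"
    using *(2,3) by (auto simp: disjoint_iff)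
  then show ?thesis using assms(2) * by auto
qed

definition dropped :: "'v \<Rightarrow> 'v set \<times> bool" where "dropped u = (SOME e. e \<in> slots_at u)"

lemma dropped: "double_hitter u \<Longrightarrow> dropped u \<in> slots_at u"
proof -
  assume "double_hitter u"
  then obtain e where "e \<in> slots_at u" by (rule double_hitterE) blast
  then show ?thesis unfolding dropped_def by (rule someI)
qed

section \<open>Slots arriving from other paths\<close>

definition out_arcs :: "'v \<Rightarrow> ('v \<times> 'v set \<times> bool) set" where
  "out_arcs x = {(u, e). (u, e) \<in> arcs \<and> fst e = {u, x} \<and> (\<forall>D. dir D \<longrightarrow> u \<in> set D \<longrightarrow> x \<notin> set D) \<and>
     \<not> (double_hitter u \<and> e = dropped u)}"

lemma out_arcsE:
  assumes "s \<in> out_arcs x" "dir D" "x \<in> set D"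
  obtains u e W where "s = (u, e)" "W \<in># Ps" "dir W" "u \<in> set W" "endable W u" "e \<in> G" "e \<in> slots_at u" "e \<in> slots_at x"
    "fst e = {u, x}" "adj u x" "set W \<noteq> set D" "u \<notin> set D" "(u, e) \<in> slots W" "\<not> (double_hitter u \<and> e = dropped u)"
    "\<not> spinnable W \<Longrightarrow> u = hd W \<or> u = last W" "x \<in> U"
proof -
  obtain u e where s: "s = (u, e)" by (cases s)
  with assms(1) have *: "(u, e) \<in> arcs" "fst e = {u, x}" "\<And>D. dir D \<Longrightarrow> u \<in> set D \<Longrightarrow> x \<notin> set D"
    "\<not> (double_hitter u \<and> e = dropped u)" by (auto simp: out_arcs_def)
  from arcsE[OF *(1)] obtain W where W: "W \<in># Ps" "u \<in> set W" "endable W u" "e \<in> slots_at u" "(u, e) \<in> slots W"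
    "\<not> spinnable W \<Longrightarrow> u = hd W \<or> u = last W" by metis
  have e: "e \<in> G" using W(4) by (simp add: slots_at_def)
  have "u \<notin> set D" using *(3)[OF assms(2)] assms(3) by blast
  then show ?thesis using that[OF s W(1) dir_mem[OF W(1)] W(2,3) e W(4) _ *(2)] edge_adj[OF e *(2)] W * e
    by (auto simp: slots_at_def)
qed

text \<open>The path edges at \<open>x\<close> that are not already charged from inside the path of \<open>x\<close>.\<close>

definition free_edges :: "'v \<Rightarrow> 'v set set" where
  "free_edges x = {f. \<exists>A B. dir (A @ B) \<and> A \<noteq> [] \<and> B \<noteq> [] \<and> hd B = x \<and> f = {last A, x} \<and>
     \<not> (\<exists>e\<in>G. fst e = {last A, x} \<or> fst e = {hd A, x}) \<and> \<not> spinnable (A @ B)}"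

text \<open>Two path edges meet at \<open>x\<close>. One that is not free is blocked by an edge of
  \<open>G\<close> from \<open>x\<close> to a vertex on the same side of \<open>x\<close>; the two
  sides are disjoint, so the blocking edges are different and stay inside the path. Each of them
  takes one of the two slots of \<open>x\<close> away from arcs coming from outside.\<close>

lemma out_arcs_le_free_edges:
  shows "finite (free_edges x) \<and> finite (out_arcs x) \<and> card (out_arcs x) \<le> card (free_edges x)"
proof -
  have finA: "finite (free_edges x)"
  proof (rule finite_subset)
    show "free_edges x \<subseteq> Pow U"
    proof
      fix f assume "f \<in> free_edges x"
      then obtain A B where "dir (A @ B)" "A \<noteq> []" "B \<noteq> []" "f = {last A, hd B}" by (auto simp: free_edges_def)
      then show "f \<in> Pow U" using dir_subset[of "A @ B"] last_in_set[of A] hd_in_set[of B] by auto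
    qed
  qed (use finite_U in simp)
  have arcs_sub: "arcs \<subseteq> U \<times> G"
  proof
    fix s assume s: "s \<in> arcs"
    obtain u e where ue: "s = (u, e)" by (cases s)
    from s arcsE[of u e] obtain P where "P \<in># Ps" "u \<in> set P" "e \<in> slots_at u" unfolding ue by metis
    then show "s \<in> U \<times> G" using Ps_vertices[of P] ue by (auto simp: slots_at_def)
  qed
  have finO: "finite (out_arcs x)"
    by (rule finite_subset[of _ "U \<times> G"]) (use arcs_sub finite_U finite_G in \<open>auto simp: out_arcs_def\<close>)
  show ?thesis
  proof (cases "out_arcs x = {}")
    case False
    then obtain u e where ue: "(u, e) \<in> out_arcs x" by auto
    then have a: "(u, e) \<in> arcs" "fst e = {u, x}" "\<And>D. dir D \<Longrightarrow> u \<in> set D \<Longrightarrow> x \<notin> set D" by (auto simp: out_arcs_def)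
    from arcsE[OF a(1)] obtain W where W: "W \<in># Ps" "u \<in> set W" "endable W u" "e \<in> slots_at u" by metis
    have eG: "e \<in> G" using W(4) by (simp add: slots_at_def)
    from locate[OF dir_mem[OF W(1)] W(3) eG a(2) a(3)[OF dir_mem[OF W(1)] W(2)]]
    obtain L M where LM: "dir (L @ x # M)" "L \<noteq> []" "M \<noteq> []" "\<not> spinnable (L @ x # M)" by metis
    have xU: "x \<in> U" using dir_subset[OF LM(1)] by simp
    have xin: "x \<in> set (L @ x # M)" by simp
    have dist: "distinct (L @ x # M)" using dir_distinct[OF LM(1)] .
    define bl where "bl a b \<longleftrightarrow> (\<exists>e\<in>G. fst e = {a, x} \<or> fst e = {b, x})" for a b
    have f1: "{last L, x} \<in> free_edges x" if "\<not> bl (last L) (hd L)"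
      using that LM unfolding free_edges_def bl_def
      by (intro CollectI exI[of _ L] exI[of _ "x # M"]) auto
    have f2: "{hd M, x} \<in> free_edges x" if "\<not> bl (hd M) (last M)"
    proof -
      have "dir (rev M @ x # rev L)" using LM(1) dir_rev[of "L @ x # M"] by simp
      moreover have "\<not> spinnable (rev M @ x # rev L)" using LM(4) spinnable_rev[of "L @ x # M"] by simp
      ultimately show ?thesis using that LM unfolding free_edges_def bl_def
        by (intro CollectI exI[of _ "rev M"] exI[of _ "x # rev L"]) (auto simp: hd_rev last_rev)
    qed
    have ne: "{last L, x} \<noteq> {hd M, x}"
    proof -
      have "last L \<in> set L" "hd M \<in> set M" using LM(2,3) by auto
      then have "last L \<noteq> hd M" using dist by auto
      then show ?thesis by (auto simp: doubleton_eq_iff)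
    qed
    define E where "E = snd ` out_arcs x"
    have inj: "inj_on snd (out_arcs x)"
    proof (rule inj_onI)
      fix s s' assume s: "s \<in> out_arcs x" "s' \<in> out_arcs x" "snd s = snd s'"
      obtain u e where [simp]: "s = (u, e)" by (cases s)
      obtain u' e' where [simp]: "s' = (u', e')" by (cases s')
      have "fst e = {u, x}" "fst e' = {u', x}" "e = e'" using s by (auto simp: out_arcs_def)
      moreover have "u \<noteq> x" by (rule out_arcsE[OF s(1) LM(1) xin]) (use adj_irrefl in auto)
      moreover have "u' \<noteq> x" by (rule out_arcsE[OF s(2) LM(1) xin]) (use adj_irrefl in auto)
      ultimately show "s = s'" by (auto simp: doubleton_eq_iff)
    qed
    have E_sub: "E \<subseteq> slots_at x"
    proof
      fix e assume "e \<in> E"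
      then obtain u where "(u, e) \<in> out_arcs x" by (auto simp: E_def)
      then show "e \<in> slots_at x" by (rule out_arcsE[OF _ LM(1) xin]) auto
    qed
    have E_out: "\<not> fst e \<subseteq> set (L @ x # M)" if "e \<in> E" for e
    proof -
      from that obtain u where "(u, e) \<in> out_arcs x" by (auto simp: E_def)
      then show ?thesis by (rule out_arcsE[OF _ LM(1) xin]) auto
    qed
    have cE: "card (out_arcs x) = card E" using card_image[OF inj] by (simp add: E_def)
    have bl_slot: "\<exists>e. e \<in> slots_at x - E \<and> (fst e = {a, x} \<or> fst e = {b, x})"
      if "bl a b" "a \<in> set (L @ x # M)" "b \<in> set (L @ x # M)" for a b
    proof -
      from that(1) obtain e where e: "e \<in> G" "fst e = {a, x} \<or> fst e = {b, x}" by (auto simp: bl_def)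
      then have "fst e \<subseteq> set (L @ x # M)" "e \<in> slots_at x" using that(2,3) by (auto simp: slots_at_def)
      then show ?thesis using e E_out by blast
    qed
    have fsl: "finite (slots_at x)" "card (slots_at x) \<le> 2" using finite_slots_at card_slots_at[OF xU] by auto
    have mem: "last L \<in> set (L @ x # M)" "hd L \<in> set (L @ x # M)" "hd M \<in> set (L @ x # M)" "last M \<in> set (L @ x # M)"
      using LM by auto
    have "card E \<le> card (free_edges x)"
    proof (cases "bl (last L) (hd L)")
      case b1: True
      from bl_slot[OF b1 mem(1,2)] obtain e1 where e1: "e1 \<in> slots_at x - E" "fst e1 = {last L, x} \<or> fst e1 = {hd L, x}" by blast
      show ?thesis
      proof (cases "bl (hd M) (last M)")
        case True
        from bl_slot[OF True mem(3,4)] obtain e2 where e2: "e2 \<in> slots_at x - E" "fst e2 = {hd M, x} \<or> fst e2 = {last M, x}" by blast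
        have "last L \<notin> set M" "hd L \<notin> set M" "hd M \<in> set M" "last M \<in> set M" "x \<notin> set M" "x \<noteq> last L" "x \<noteq> hd L"
        proof -
          have "last L \<in> set L" "hd L \<in> set L" "hd M \<in> set M" "last M \<in> set M" using LM(2,3) by auto
          moreover have "set L \<inter> set M = {}" "x \<notin> set L" "x \<notin> set M" using dist by auto
          ultimately show "last L \<notin> set M" "hd L \<notin> set M" "hd M \<in> set M" "last M \<in> set M" "x \<notin> set M" "x \<noteq> last L" "x \<noteq> hd L"
            by blast+
        qed
        then have "e1 \<noteq> e2" using e1(2) e2(2) by (auto simp: doubleton_eq_iff)
        then have "slots_at x = {e1, e2}" using slot_pair[OF xU] e1(1) e2(1) by blast
        then have E0: "E = {}" using E_sub e1(1) e2(1) by auto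
        show ?thesis unfolding E0 by simp
      next
        case False
        have "E \<subseteq> slots_at x - {e1}" using E_sub e1 by blast
        then have "card E \<le> card (slots_at x - {e1})" using fsl by (intro card_mono) auto
        also have "\<dots> \<le> 1" using fsl e1 by (simp add: card_Diff_singleton)
        also have "1 \<le> card (free_edges x)" using f2[OF False] finA by (metis One_nat_def Suc_leI card_gt_0_iff empty_iff)
        finally show ?thesis .
      qed
    next
      case b1: False
      show ?thesis
      proof (cases "bl (hd M) (last M)")
        case True
        from bl_slot[OF True mem(3,4)] obtain e2 where e2: "e2 \<in> slots_at x - E" by blast
        have "E \<subseteq> slots_at x - {e2}" using E_sub e2 by blast
        then have "card E \<le> card (slots_at x - {e2})" using fsl by (intro card_mono) auto
        also have "\<dots> \<le> 1" using fsl e2 by (simp add: card_Diff_singleton)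
        also have "1 \<le> card (free_edges x)" using f1[OF b1] finA by (metis One_nat_def Suc_leI card_gt_0_iff empty_iff)
        finally show ?thesis .
      next
        case False
        have "card E \<le> 2" using card_mono[OF fsl(1) E_sub] fsl(2) by simp
        also have "2 = card {{last L, x}, {hd M, x}}" using ne by simp
        also have "\<dots> \<le> card (free_edges x)" using f1[OF b1] f2[OF False] finA by (intro card_mono) auto
        finally show ?thesis .
      qed
    qed
    then show ?thesis using cE finA finO by simp
  qed (use finA in simp)
qed


lemma edge_same:
  assumes "dir (A @ B)" "dir (A' @ B')" "A \<noteq> []" "B \<noteq> []" "A' \<noteq> []" "B' \<noteq> []"
    "{last A, hd B} = {last A', hd B'}"
  obtains "A' = A" "B' = B" | "A' = rev B" "B' = rev A"
proof -
  have same: "A1 = A \<and> B1 = B" if "A1 @ B1 = A @ B" "A1 \<noteq> []" "B1 \<noteq> []" "{last A, hd B} = {last A1, hd B1}" for A1 B1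
  proof -
    have d: "distinct (A @ B)" "distinct (A1 @ B1)" using dir_distinct[OF assms(1)] that(1) by auto
    from that(1) show ?thesis
    proof (cases rule: append_eq_splitE)
      case (1 C)
      have "C = []"
      proof (rule ccontr)
        assume C: "C \<noteq> []"
        have "last A1 \<in> set C" "last A \<in> set A" "hd B \<in> set C" "hd B1 \<in> set B1"
          using C 1 assms(3) that(3) by auto
        moreover have "last A1 \<noteq> last A" "hd B1 \<noteq> last A"
          using d(2) 1 calculation by (auto simp: disjoint_iff)
        ultimately show False using that(4) by (auto simp: doubleton_eq_iff)
      qed
      with 1 show ?thesis by simp
    next
      case (2 C)
      have "C = []"
      proof (rule ccontr)
        assume C: "C \<noteq> []"
        have "last A \<in> set C" "last A1 \<in> set A1" "hd B1 \<in> set C" "hd B \<in> set B"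
          using C 2 assms(4) that(2) by auto
        moreover have "last A1 \<noteq> last A" "hd B \<noteq> last A1"
          using d(1) 2 calculation by (auto simp: disjoint_iff)
        ultimately show False using that(4) by (auto simp: doubleton_eq_iff)
      qed
      with 2 show ?thesis by simp
    qed
  qed
  have "last A \<in> set (A' @ B')" using assms(5-7) by (metis Un_iff hd_in_set insertCI insertE last_in_set set_append singletonD)
  then have "A' @ B' = A @ B \<or> A' @ B' = rev (A @ B)"
    using dir_same[OF assms(1,2), of "last A"] assms(3) by auto
  then show ?thesis
  proof
    assume "A' @ B' = A @ B"
    from same[OF this assms(5,6,7)] that(1) show ?thesis by simp
  next
    assume "A' @ B' = rev (A @ B)"
    then have "rev B' @ rev A' = A @ B" by (metis rev_append rev_rev_ident)
    from same[OF this] assms(5-7) have "rev B' = A" "rev A' = B"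
      by (auto simp: last_rev hd_rev insert_commute)
    then show ?thesis using that(2) by auto
  qed
qed

text \<open>The four ways in which a slot is charged to the edge between \<open>last A\<close> and \<open>hd B\<close> of the path
  \<open>A @ B\<close>. Two different slots charged to the same edge give rise to an improvement.\<close>

definition use_own where
  "use_own s A B \<longleftrightarrow> dir (A @ B) \<and> A \<noteq> [] \<and> B \<noteq> [] \<and> \<not> spinnable (A @ B) \<and> s \<in> arcs \<and>
     snd s \<in> G \<and> fst s = hd A \<and> fst (snd s) = {hd A, hd B} \<and> primary (snd s)"

text \<open>The primary one of the parallel edges already charges the first path edge through
  \<open>use_own\<close>. The second one takes the following path edge instead.\<close>

definition use_double where
  "use_double s A B \<longleftrightarrow> dir (A @ B) \<and> B \<noteq> [] \<and> \<not> spinnable (A @ B) \<and> s \<in> arcs \<and>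
     snd s \<in> G \<and> (\<exists>b. A = [fst s, b] \<and> fst (snd s) = {fst s, b}) \<and> \<not> primary (snd s)"

definition use_double_hitter where
  "use_double_hitter s A B \<longleftrightarrow> dir (A @ B) \<and> A = [fst s] \<and> B \<noteq> [] \<and> \<not> spinnable (A @ B) \<and> s \<in> arcs \<and>
     double_hitter (fst s) \<and> snd s = dropped (fst s)"

definition use_out where
  "use_out s A B \<longleftrightarrow> dir (A @ B) \<and> A \<noteq> [] \<and> B \<noteq> [] \<and> \<not> spinnable (A @ B) \<and> s \<in> arcs \<and>
     s \<in> out_arcs (hd B) \<and> \<not> (\<exists>e\<in>G. fst e = {last A, hd B} \<or> fst e = {hd A, hd B})"

section \<open>No path edge is charged twice\<close>

lemma arcs_two_path:
  assumes "dir [a, b]" "(a, e) \<in> arcs" "fst e = {a, b}" "(b, e') \<in> arcs" "fst e' = {a, b}"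
  shows False
proof -
  have d: "a \<noteq> b" using dir_distinct[OF assms(1)] by simp
  have ns: "\<not> spinnable [a, b]" "\<not> spinnable [b, a]" by (auto simp: spinnable_def)
  from assms(1) consider "[a, b] \<in># Ps" | "[b, a] \<in># Ps" by (auto simp: dir_def)
  then show False
  proof cases
    case 1
    from assms(4) obtain P where P: "P \<in># Ps" "b \<in> set P" "(b, e') \<in> slots P" by (rule arcsE)
    have "P = [a, b]" using Ps_unique[OF P(1) 1 P(2)] by simp
    with P(3) assms(5) ns show False by (auto simp: slots_def)
  next
    case 2
    from assms(2) obtain P where P: "P \<in># Ps" "a \<in> set P" "(a, e) \<in> slots P" by (rule arcsE)
    have "P = [b, a]" using Ps_unique[OF P(1) 2 P(2)] by simp
    with P(3) assms(3) ns show False by (auto simp: slots_def)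
  qed
qed

text \<open>In opposite directions the two chords form a crossing, so the path is spinnable or has
  two vertices; \<open>slots\<close> keeps the path edge of the latter as a slot of one end only. In
  the same direction, primary edges with equal ends coincide.\<close>

lemma own_own:
  assumes "use_own s A B" "use_own s' A' B'" "{last A, hd B} = {last A', hd B'}"
  shows "s = s'"
proof -
  note 1 = assms(1)[unfolded use_own_def] and 2 = assms(2)[unfolded use_own_def]
  obtain u e u' e' where s: "s = (u, e)" "s' = (u', e')" by (cases s; cases s')
  show ?thesis
  proof (rule edge_same[of A B A' B'])
    assume "A' = A" "B' = B"
    with 1 2 primary_eq[of e e'] s show ?thesis by auto
  next
    assume o: "A' = rev B" "B' = rev A"
    have "adj (hd A) (hd B)" "adj (last A) (last B)"
      using 1 2 s o edge_adj[of e "hd A" "hd B"] edge_adj[of e' "last B" "last A"] adj_sym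
      by (auto simp: hd_rev last_rev)
    then have "crossing (A @ B)" unfolding crossing_def using 1 by blast
    then have "length (A @ B) < 3" using 1 by (auto simp: spinnable_def)
    then have "length A = 1" "length B = 1" using 1 by (cases A; cases B; auto)+
    then obtain a b where ab: "A = [a]" "B = [b]" by (auto simp: length_Suc_conv)
    from arcs_two_path[of a b e e'] 1 2 s o ab show ?thesis by (auto simp: insert_commute)
  qed (use 1 2 assms(3) in auto)
qed

lemma double_data:
  assumes "use_double s A B"
  obtains a b e e' where "s = (a, e)" "A = [a, b]" "fst e = {a, b}" "fst e' = {a, b}" "e \<noteq> e'" "e \<in> G" "e' \<in> G"
    "adj a b" "closed_wrt \<T> {a, b}" "a \<noteq> b" "a \<in> U" "b \<in> U" "slots_at a = {e, e'}" "slots_at b = {e, e'}"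
proof -
  obtain a e where s: "s = (a, e)" by (cases s)
  with assms obtain b where *: "A = [a, b]" "fst e = {a, b}" "e \<in> G" "\<not> primary e"
    by (auto simp: use_double_def)
  define e' where "e' = (fst e, False)"
  have e': "e' \<in> G" "fst e' = {a, b}" "e \<noteq> e'" using not_primary[OF *(4)] *(2) by (auto simp: e'_def)
  have ab: "adj a b" "a \<noteq> b" "a \<in> U" "b \<in> U" using edge_adj[OF *(3,2)] by auto
  have "e \<in> slots_at a" "e' \<in> slots_at a" "e \<in> slots_at b" "e' \<in> slots_at b" using * e' by (auto simp: slots_at_def)
  then have "slots_at a = {e, e'}" "slots_at b = {e, e'}" using slot_pair ab e'(3) by blast+
  then show ?thesis using that[OF s] * e' ab doubled_closed[OF *(3) e'(1,3) *(2) e'(2)] by blast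
qed

text \<open>The parallel edges use up all slots of \<open>a\<close> and \<open>b\<close>, whereas
  the other charge would need an edge of \<open>G\<close> from \<open>a\<close> or \<open>b\<close>
  to a third vertex.\<close>

lemma own_double:
  assumes "use_own s A B" "use_double s' A' B'" "{last A, hd B} = {last A', hd B'}"
  shows False
proof -
  note 1 = assms(1)[unfolded use_own_def] and 2 = assms(2)[unfolded use_double_def]
  from assms(2) obtain a b d d' where *: "s' = (a, d)" "A' = [a, b]" "fst d = {a, b}" "fst d' = {a, b}"
    "slots_at a = {d, d'}" "slots_at b = {d, d'}" by (rule double_data)
  obtain u e where s: "s = (u, e)" by (cases s)
  have dist: "distinct (A @ B)" "distinct (A' @ B')" using 1 2 dir_distinct by blast+
  show ?thesis
  proof (rule edge_same[of A B A' B'])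
    assume o: "A' = A" "B' = B"
    then have "e \<in> slots_at a" using 1 * s by (auto simp: slots_at_def)
    then have "fst e = {a, b}" using * by auto
    moreover have "fst e = {a, hd B}" using 1 * s o by auto
    moreover have "hd B \<in> set B" using 1 by simp
    ultimately show False using dist o * by (auto simp: doubleton_eq_iff)
  next
    assume o: "A' = rev B" "B' = rev A"
    then have B: "B = [b, a]" using * by (metis rev_rev_ident rev.simps append.simps)
    then have "e \<in> slots_at b" using 1 s by (auto simp: slots_at_def)
    then have "fst e = {a, b}" using * by auto
    moreover have "fst e = {hd A, b}" using 1 s B by auto
    moreover have "hd A \<in> set A" using 1 by simp
    ultimately show False using dist B by (auto simp: doubleton_eq_iff)
  qed (use 1 2 * assms(3) in auto)
qed

text \<open>All slots of a double hitter leave its path, whereas the other slot joins the double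
  hitter to a vertex of the same path.\<close>

lemma own_dh:
  assumes "use_own s A B" "use_double_hitter s' A' B'" "{last A, hd B} = {last A', hd B'}"
  shows False
proof -
  note 1 = assms(1)[unfolded use_own_def] and 2 = assms(2)[unfolded use_double_hitter_def]
  obtain u e where s: "s = (u, e)" by (cases s)
  obtain a where a: "A' = [a]" "double_hitter a" using 2 by auto
  have sub: "fst e \<subseteq> set (A @ B)" "hd A \<in> fst e" "hd B \<in> fst e" "e \<in> G" using 1 s by auto
  show ?thesis
  proof (rule edge_same[of A B A' B'])
    assume o: "A' = A" "B' = B"
    then have "e \<in> slots_at a" "a \<in> set (A @ B)" using sub a by (auto simp: slots_at_def)
    with double_hitter_slots[OF a(2), of e "A @ B"] sub 1 show False by blast
  next
    assume o: "A' = rev B" "B' = rev A"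
    then have "B = [a]" using a by (metis rev_rev_ident rev.simps append.simps)
    then have "e \<in> slots_at a" "a \<in> set (A @ B)" using sub by (auto simp: slots_at_def)
    with double_hitter_slots[OF a(2), of e "A @ B"] sub 1 show False by blast
  qed (use 1 2 a assms(3) in auto)
qed

text \<open>In the same direction the edge is not free. In the opposite direction
  \<open>last A\<close> is hit from outside, although a Posa rotation along the chord makes it an
  end.\<close>

lemma own_out:
  assumes "use_own s A B" "use_out s' A' B'" "{last A, hd B} = {last A', hd B'}"
  shows False
proof -
  note 1 = assms(1)[unfolded use_own_def] and 2 = assms(2)[unfolded use_out_def]
  obtain u e where s: "s = (u, e)" by (cases s)
  show ?thesis
  proof (rule edge_same[of A B A' B'])
    assume o: "A' = A" "B' = B"
    then show False using 1 2 s by auto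
  next
    assume o: "A' = rev B" "B' = rev A"
    then have h: "hd B' = last A" using 1 by (simp add: hd_rev)
    have "last A \<in> set (A @ B)" using 1 by auto
    with 1 2 h obtain w d W where W: "dir W" "endable W w" "adj w (last A)" "set W \<noteq> set (A @ B)"
      using out_arcsE[of s' "last A" "A @ B"] by metis
    have "adj (hd A) (hd B)" using edge_adj[of e "hd A" "hd B"] 1 s by auto
    then have "endable (A @ B) (last A)" using 1 by (intro endable_posa_hd) auto
    with endable_not_adj[OF W(1) _ W(4,2)] W(3) 1 show False by blast
  qed (use 1 2 assms(3) in auto)
qed

text \<open>Opposite directions would mean that the path consists of two closed pairs, which could
  become two cycles of length 2.\<close>

lemma double_double:
  assumes "use_double s A B" "use_double s' A' B'" "{last A, hd B} = {last A', hd B'}"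
  shows "s = s'"
proof -
  note 1 = assms(1)[unfolded use_double_def] and 2 = assms(2)[unfolded use_double_def]
  from assms(1) obtain a b e where *: "s = (a, e)" "A = [a, b]" "fst e = {a, b}"
    "adj a b" "closed_wrt \<T> {a, b}" by (rule double_data)
  from assms(2) obtain a' b' e' where **: "s' = (a', e')" "A' = [a', b']" "fst e' = {a', b'}"
    "adj a' b'" "closed_wrt \<T> {a', b'}" by (rule double_data)
  show ?thesis
  proof (rule edge_same[of A B A' B'])
    assume o: "A' = A" "B' = B"
    have "snd e" "snd e'" using not_primary(1)[of e] not_primary(1)[of e'] 1 2 * ** by auto
    with o * ** show ?thesis by (cases e; cases e') auto
  next
    assume o: "A' = rev B" "B' = rev A"
    then have "B = [b', a']" using ** by (metis rev_rev_ident rev.simps append.simps)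
    then have "dir [a, b, b', a']" using 1 * by simp
    from split_close_close_impossible[OF this *(4,5)] **(4,5) adj_sym show ?thesis
      by (auto simp: insert_commute)
  qed (use 1 2 * ** assms(3) in auto)
qed

text \<open>The double hitter \<open>c\<close> could be shifted away, and the closed pair that
  remains could be closed to a cycle.\<close>

lemma double_dh:
  assumes "use_double s A B" "use_double_hitter s' A' B'" "{last A, hd B} = {last A', hd B'}"
  shows False
proof -
  note 1 = assms(1)[unfolded use_double_def] and 2 = assms(2)[unfolded use_double_hitter_def]
  from assms(1) obtain a b e where *: "s = (a, e)" "A = [a, b]" "fst e = {a, b}"
    "adj a b" "closed_wrt \<T> {a, b}" by (rule double_data)
  obtain c where c: "A' = [c]" "double_hitter c" using 2 by auto
  show ?thesis
  proof (rule edge_same[of A B A' B'])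
    assume "A' = A" "B' = B"
    then show False using * c by simp
  next
    assume o: "A' = rev B" "B' = rev A"
    then have "B = [c]" using c by (metis rev_rev_ident rev.simps append.simps)
    then have d: "dir [a, b, c]" using 1 * by simp
    have "rearr 1 [a, b, c] (rev [a, b, c])" by (rule rearr_rev) simp
    from rearr_trans[OF this rearr_refl[of _ 2], of 3] have r: "rearr 3 [a, b, c] (c # [b, a])" by simp
    from c(2) obtain X Y where XY: "dir (X @ Y)" "X \<noteq> []" "Y \<noteq> []" "c \<notin> set (X @ Y)"
      "adj c (last X)" "adj c (hd Y)" by (rule double_hitterE)
    have "set [a, b, c] \<noteq> set (X @ Y)" using XY(4) by auto
    from shift_close_impossible[OF d r _ XY(1) this XY(2,3,5,6)] * show False by (auto simp: insert_commute)
  qed (use 1 2 * c assms(3) in auto)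
qed

text \<open>Either the hit vertex follows the closed pair and becomes an end when the pair is cut
  off, or it is \<open>b\<close>, whose slots are the parallel edges.\<close>

lemma double_out:
  assumes "use_double s A B" "use_out s' A' B'" "{last A, hd B} = {last A', hd B'}"
  shows False
proof -
  note 1 = assms(1)[unfolded use_double_def] and 2 = assms(2)[unfolded use_out_def]
  from assms(1) obtain a b e e' where *: "s = (a, e)" "A = [a, b]" "fst e = {a, b}" "fst e' = {a, b}"
    "adj a b" "closed_wrt \<T> {a, b}" "slots_at b = {e, e'}" by (rule double_data)
  show ?thesis
  proof (rule edge_same[of A B A' B'])
    assume o: "A' = A" "B' = B"
    have "hd B \<in> set (A @ B)" using 1 by auto
    with 1 2 o obtain w W where W: "dir W" "endable W w" "adj w (hd B)" "set W \<noteq> set (A @ B)"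
      using out_arcsE[of s' "hd B" "A @ B"] by metis
    have "A @ B = a # b # hd B # tl B" using * 1 by simp
    with split_close_not_hit[of a b "hd B" "tl B" W w] 1 W * show False by metis
  next
    assume o: "A' = rev B" "B' = rev A"
    then have h: "hd B' = b" using * by simp
    have "b \<in> set (A @ B)" using * by auto
    with 1 2 h obtain w d where "fst d = {w, b}" "d \<in> slots_at b" "w \<notin> set (A @ B)"
      using out_arcsE[of s' b "A @ B"] by metis
    with * show False by (auto simp: doubleton_eq_iff)
  qed (use 1 2 * assms(3) in auto)
qed

text \<open>Charges from opposite directions mean that the path consists of two double hitters, both
  of which could be shifted away.\<close>

lemma dh_dh:
  assumes "use_double_hitter s A B" "use_double_hitter s' A' B'" "{last A, hd B} = {last A', hd B'}"
  shows "s = s'"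
proof -
  note 1 = assms(1)[unfolded use_double_hitter_def] and 2 = assms(2)[unfolded use_double_hitter_def]
  obtain a where a: "A = [a]" "double_hitter a" "s = (a, dropped a)" using 1 by (cases s) auto
  obtain c where c: "A' = [c]" "double_hitter c" "s' = (c, dropped c)" using 2 by (cases s') auto
  show ?thesis
  proof (rule edge_same[of A B A' B'])
    assume "A' = A" "B' = B"
    then show ?thesis using a c by simp
  next
    assume o: "A' = rev B" "B' = rev A"
    then have "B = [c]" using c by (metis rev_rev_ident rev.simps append.simps)
    then have d: "dir [a, c]" using 1 a by simp
    from a(2) obtain X Y where XY: "dir (X @ Y)" "X \<noteq> []" "Y \<noteq> []" "a \<notin> set (X @ Y)"
      "adj a (last X)" "adj a (hd Y)" by (rule double_hitterE)
    from c(2) obtain V W where VW: "dir (V @ W)" "V \<noteq> []" "W \<noteq> []" "c \<notin> set (V @ W)"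
      "adj c (last V)" "adj c (hd W)" by (rule double_hitterE)
    have "set [a, c] \<noteq> set (X @ Y)" "set [a, c] \<noteq> set (V @ W)" using XY(4) VW(4) by auto
    from two_shifts_impossible[OF d XY(1) this(1) XY(2,3,5,6) VW(1) this(2) VW(2,3,5,6)]
    show ?thesis by blast
  qed (use 1 2 a c assms(3) in auto)
qed

text \<open>Either the neighbour of \<open>a\<close> is hit, which a shift of \<open>a\<close> would
  turn into an end, or \<open>a\<close> itself, which is an end already.\<close>

lemma dh_out:
  assumes "use_double_hitter s A B" "use_out s' A' B'" "{last A, hd B} = {last A', hd B'}"
  shows False
proof -
  note 1 = assms(1)[unfolded use_double_hitter_def] and 2 = assms(2)[unfolded use_out_def]
  obtain a where a: "A = [a]" "double_hitter a" "s = (a, dropped a)" using 1 by (cases s) auto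
  have d: "dir (a # B)" using 1 a by auto
  show ?thesis
  proof (rule edge_same[of A B A' B'])
    assume o: "A' = A" "B' = B"
    have "hd B \<in> set (A @ B)" using 1 by auto
    with 1 2 o obtain w e W where W: "dir W" "endable W w" "adj w (hd B)" "set W \<noteq> set (A @ B)" "w \<in> set W"
      "\<not> spinnable W \<Longrightarrow> w = hd W \<or> w = last W"
      using out_arcsE[of s' "hd B" "A @ B"] by metis
    from a(2) obtain X Y where XY: "dir (X @ Y)" "X \<noteq> []" "Y \<noteq> []" "a \<notin> set (X @ Y)"
      "adj a (last X)" "adj a (hd Y)" by (rule double_hitterE)
    have ne: "set (a # B) \<noteq> set (X @ Y)" using XY(4) by auto
    have Bne: "B \<noteq> []" using 1 by simp
    show False
    \<comment> \<open>The hit may come from the very path into which \<open>a\<close> is shifted.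
      That path is not spinnable, since the end \<open>a\<close> is adjacent to one of its vertices;
      so \<open>w\<close> is one of its ends and stays an end after the shift.\<close>
    proof (cases "set W = set (X @ Y)")
      case True
      have "\<not> spinnable (X @ Y)"
        using endable_spinnable[of "X @ Y" "last X"] XY endable_not_adj[OF d XY(1) ne, of a "last X"]
          endable_hd[of "a # B"] by auto
      moreover have "W = X @ Y \<or> W = rev (X @ Y)"
        using dir_same[OF XY(1) W(1), of w] W(5) True by auto
      ultimately have "w = hd X \<or> w = last Y"
        using W(6) spinnable_rev[of "X @ Y"] XY(2,3) by (auto simp: hd_rev last_rev hd_append)
      from shift_nbr_not_hit_same[OF d Bne XY(1) ne XY(2,3,5,6) this] W(3) show False by blast
    next
      case False
      from shift_nbr_not_hit_other[OF d Bne XY(1) ne XY(2,3,5,6) W(1) _ False W(2)] W(3,4) a show False by auto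
    qed
  next
    assume o: "A' = rev B" "B' = rev A"
    then have h: "hd B' = a" using a by simp
    have "a \<in> set (A @ B)" using a by auto
    with 1 2 h obtain w W where W: "dir W" "endable W w" "adj w a" "set W \<noteq> set (A @ B)"
      using out_arcsE[of s' a "A @ B"] by metis
    from endable_not_adj[OF W(1) d _ W(2), of a] W(3,4) a endable_hd[of "a # B"] show False by auto
  qed (use 1 2 a assms(3) in auto)
qed

lemma triangle_rearr:
  assumes "spinnable P" "length P = 3" "distinct P" "u \<in> set P" "w \<in> set P" "u \<noteq> w"
  obtains P' where "rearr 3 P P'" "hd P' = u" "last P' = w" "set P' = set P" "length P' = 3"
proof -
  from assms(2) obtain a b c where P: "P = [a, b, c]"
    by (metis length_0_conv length_Suc_conv numeral_3_eq_3)
  \<comment> \<open>With only three vertices, even a crossing contains the chord from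
    \<open>a\<close> to \<open>c\<close>.\<close>
  have "adj a c"
  proof (cases "adj (hd P) (last P)")
    case False
    then obtain A B where AB: "P = A @ B" "A \<noteq> []" "B \<noteq> []" "adj (hd A) (hd B)" "adj (last A) (last B)"
      using assms(1) unfolding spinnable_def crossing_def by blast
    then show ?thesis using P by (cases A; cases "tl A"; cases "tl (tl A)") auto
  qed (use P in simp)
  then have ca: "adj c a" by (rule adj_sym)
  have r0: "rearr 2 P [a, b, c]" using P by (simp add: rearr_refl)
  have r1: "rearr 2 P [b, c, a]" using rearr_rotate[of "[a]" "[b, c]"] ca P by simp
  have r2: "rearr 2 P [c, a, b]" using rearr_rotate[of "[a, b]" "[c]"] ca P by simp
  have rv: "rearr 3 P (rev Q)" if "rearr 2 P Q" for Q
    using rearr_trans[OF that rearr_rev] that by (simp add: rearr_def)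
  have up: "rearr 3 P Q" if "rearr 2 P Q" for Q
    using rearr_trans[OF that rearr_refl[of Q 0]] that by (simp add: rearr_def)
  have "\<exists>P'. rearr 3 P P' \<and> hd P' = u \<and> last P' = w \<and> set P' = set P \<and> length P' = 3"
    using assms(4-6) P up[OF r0] up[OF r1] up[OF r2] rv[OF r0] rv[OF r1] rv[OF r2]
    by (simp, elim disjE) (force intro: exI)+
  with that show ?thesis by blast
qed

text \<open>Slots from different paths allow a bridge, slots at two vertices of one path the
  insertion of that path between \<open>A\<close> and \<open>B\<close>. If both slots belong to one
  vertex \<open>u\<close>, then \<open>u\<close> forms a path of its own and can be inserted, or it
  is a double hitter, or it lies on a spinnable path.\<close>

lemma out_out_opposite:
  assumes "dir (A @ B)" "A \<noteq> []" "B \<noteq> []" "s \<in> out_arcs (hd B)" "s' \<in> out_arcs (last A)"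
  shows False
proof -
  have in_D: "hd B \<in> set (A @ B)" "last A \<in> set (A @ B)" using assms(2,3) by auto
  from assms(4,1) in_D(1) obtain u e W where W: "s = (u, e)" "W \<in># Ps" "dir W" "u \<in> set W" "endable W u"
    "e \<in> G" "e \<in> slots_at u" "fst e = {u, hd B}" "adj u (hd B)" "set W \<noteq> set (A @ B)" "(u, e) \<in> slots W"
    "\<not> (double_hitter u \<and> e = dropped u)" "\<not> spinnable W \<longrightarrow> u = hd W \<or> u = last W" "u \<notin> set (A @ B)" by (rule out_arcsE) blast
  from assms(5,1) in_D(2) obtain u' e' W' where W': "s' = (u', e')" "W' \<in># Ps" "dir W'" "u' \<in> set W'" "endable W' u'"
    "e' \<in> G" "e' \<in> slots_at u'" "fst e' = {u', last A}" "adj u' (last A)" "set W' \<noteq> set (A @ B)" "(u', e') \<in> slots W'"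
    "\<not> (double_hitter u' \<and> e' = dropped u')" "\<not> spinnable W' \<longrightarrow> u' = hd W' \<or> u' = last W'" by (rule out_arcsE) blast
  have neq: "last A \<noteq> hd B" using dir_distinct[OF assms(1)] assms(2,3)
    by (metis disjoint_iff distinct_append hd_in_set last_in_set)
  show False
  proof (cases "W = W'")
    case False
    have "set W' \<noteq> set W" using Ps_unique[OF W(2) W'(2)] W(4) False by auto
    from bridge_not_adj[OF W'(3) W(3) assms(1) this W'(10) W(10) W'(5) W(5) assms(2,3) W'(9)] W(9)
    show False by blast
  next
    case WW: True
    have Wne: "W \<noteq> []" using W(4) by auto
    show False
    proof (cases "u = u'")
      case uu: True
      have ee: "e \<noteq> e'" using W(8) W'(8) neq uu by (auto simp: doubleton_eq_iff)
      show False
      proof (cases "spinnable W")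
        case True
        \<comment> \<open>Two slots at one vertex are selected only if the path has three vertices
          and the other two form a closed pair: \<open>u\<close> is shifted away and the pair
          closed.\<close>
        have "(u, e) \<in> selection W" "(u, e') \<in> selection W" using True W(11) W'(11) WW uu by (auto simp: slots_def)
        from selection(3)[OF W(2) True this] ee obtain b c where bc: "length W = 3" "set W = {u, b, c}" "adj b c"
          "closed_wrt \<T> {b, c}" by auto
        have dW: "distinct W" using dir_distinct[OF W(3)] .
        have "card {u, b, c} = 3" using bc(1,2) distinct_card[OF dW] by simp
        then have "u \<noteq> b" "u \<noteq> c" "b \<noteq> c" by (auto simp: card_insert_if split: if_splits)
        then obtain P' where P': "rearr 3 W P'" "hd P' = u" "last P' = b" "set P' = set W" "length P' = 3"
          using triangle_rearr[OF True bc(1) dW, of u b] bc by auto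
        then obtain x y z where "P' = [x, y, z]" by (metis length_0_conv length_Suc_conv numeral_3_eq_3)
        with P' bc \<open>u \<noteq> b\<close> \<open>u \<noteq> c\<close> \<open>b \<noteq> c\<close> have "P' = u # [c, b]" by auto
        with P'(1) have r: "rearr 3 W (u # [c, b])" by simp
        from shift_close_impossible[OF W(3) r _ assms(1) W(10) assms(2,3)] W(9) W'(9) uu bc(3,4)
        show False by (auto simp: insert_commute)
      next
        case False
        show False
        proof (cases "length W = 1")
          case True
          then have "W = [u]" using W(4) by (auto simp: length_Suc_conv)
          then have "rearr 0 W [u]" by (simp add: rearr_refl)
          from insert_impossible[OF W(3) assms(1) W(10) this _ assms(2,3)] W(9) W'(9) uu adj_sym show False by auto
        next
          case len: False
          have "\<exists>D. dir (u # D) \<and> D \<noteq> [] \<and> \<not> spinnable (u # D)"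
          proof (cases "u = hd W")
            case True
            then have "W = u # tl W" "tl W \<noteq> []" using Wne len by (cases W; auto)+
            then show ?thesis using W(3) False by metis
          next
            case F: False
            then have "u = last W" using W(13) False by blast
            then have "rev W = u # tl (rev W)" "tl (rev W) \<noteq> []"
              using Wne len by (cases W rule: rev_cases; auto)+
            then show ?thesis using W(3) False dir_rev[of W] spinnable_rev[of W] by metis
          qed
          \<comment> \<open>\<open>u\<close> has no third slot, so one of the two is
            \<open>dropped u\<close>, which \<open>out_arcs\<close> excludes.\<close>
          then have "double_hitter u" unfolding double_hitter_def using assms(1-3) W(6,8,14) W'(6,8) uu by blast
          moreover have "u \<in> U" using dir_subset[OF W(3)] W(4) by blast
          then have "slots_at u = {e, e'}" using W(7) W'(7) ee uu slot_pair by blast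
          ultimately have "e = dropped u \<or> e' = dropped u" using dropped[of u] by auto
          then show False using \<open>double_hitter u\<close> W(12) W'(12) uu by blast
        qed
      qed
    next
      case uu: False
      have "\<exists>P'. rearr 3 W P' \<and> hd P' = u' \<and> last P' = u"
      proof (cases "spinnable W")
        case True
        have "(u, e) \<in> selection W" "(u', e') \<in> selection W" using True W(11) W'(11) WW by (auto simp: slots_def)
        from selection(3)[OF W(2) True this] uu have "length W = 3" by auto
        from triangle_rearr[OF True this dir_distinct[OF W(3)], of u' u] W(4) W'(4) WW uu show ?thesis by metis
      next
        case False
        then have "(u' = hd W \<and> u = last W) \<or> (u' = last W \<and> u = hd W)" using W(13) W'(13) WW uu by auto
        moreover have "rearr 3 W W" using Wne by (rule rearr_refl)
        moreover have "rearr 3 W (rev W)" using rearr_trans[OF rearr_rev[OF Wne] rearr_refl[of "rev W" 2]] Wne by simp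
        ultimately show ?thesis using Wne by (metis hd_rev last_rev)
      qed
      then obtain P' where P': "rearr 3 W P'" "hd P' = u'" "last P' = u" by blast
      from insert_impossible[OF W(3) assms(1) W(10) P'(1) _ assms(2,3)] W(9) W'(9) P' adj_sym show False by auto
    qed
  qed
qed

end

section \<open>Counting the paths of a local optimum\<close>

context local_optimum
begin

definition path_edges :: "'v list \<Rightarrow> 'v set set" where
  "path_edges P = {{last A, hd B} | A B. P = A @ B \<and> A \<noteq> [] \<and> B \<noteq> []}"

lemma card_path_edges: "finite (path_edges P) \<and> card (path_edges P) \<le> length P - 1"
proof -
  have "path_edges P \<subseteq> (\<lambda>i. {P ! i, P ! Suc i}) ` {..<length P - 1}"
  proof
    fix f assume "f \<in> path_edges P"
    then obtain A B where AB: "P = A @ B" "A \<noteq> []" "B \<noteq> []" "f = {last A, hd B}"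
      by (auto simp: path_edges_def)
    then have "f = {P ! (length A - 1), P ! Suc (length A - 1)}"
      by (cases A rule: rev_cases; cases B) (auto simp: nth_append)
    moreover have "length A - 1 < length P - 1" using AB by (cases A; cases B) auto
    ultimately show "f \<in> (\<lambda>i. {P ! i, P ! Suc i}) ` {..<length P - 1}" by blast
  qed
  then show ?thesis using surj_card_le[of "{..<length P - 1}"] finite_surj[of "{..<length P - 1}"] by auto
qed

lemma path_edges_dir:
  assumes "dir (A @ B)" "A \<noteq> []" "B \<noteq> []" "\<not> spinnable (A @ B)"
  shows "\<exists>P\<in>#Ps. \<not> spinnable P \<and> {last A, hd B} \<in> path_edges P"
proof -
  from assms(1) consider "A @ B \<in># Ps" | "rev B @ rev A \<in># Ps" by (auto simp: dir_def)
  then show ?thesis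
  proof cases
    case 1
    then show ?thesis using assms unfolding path_edges_def by blast
  next
    case 2
    have "{last A, hd B} = {last (rev B), hd (rev A)}" using assms by (auto simp: last_rev hd_rev)
    then have "{last A, hd B} \<in> path_edges (rev B @ rev A)" using assms unfolding path_edges_def by force
    moreover have "\<not> spinnable (rev B @ rev A)" using assms(4) spinnable_rev[of "A @ B"] by simp
    ultimately show ?thesis using 2 by blast
  qed
qed

text \<open>Slots from outside are distributed over the free edges at the hit vertex by comparing
  cardinalities; for every other slot the edge is given explicitly.\<close>

lemma arcs_inject:
  "\<exists>\<phi>. inj_on \<phi> arcs \<and> \<phi> ` arcs \<subseteq> (\<Union>P\<in>{P \<in> set_mset Ps. \<not> spinnable P}. path_edges P)"
proof -
  have "\<exists>g. inj_on g (out_arcs x) \<and> g ` out_arcs x \<subseteq> free_edges x" for x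
    using out_arcs_le_free_edges[of x] card_le_inj[of "out_arcs x" "free_edges x"] by blast
  then obtain g where g: "\<And>x. inj_on (g x) (out_arcs x)" "\<And>x. g x ` out_arcs x \<subseteq> free_edges x" by metis
  define use where "use s f \<longleftrightarrow> (\<exists>A B. f = {last A, hd B} \<and> (use_own s A B \<or> use_double s A B \<or> use_double_hitter s A B \<or>
    (use_out s A B \<and> f = g (hd B) s)))" for s f
  have ex: "\<exists>f. use s f" if s: "s \<in> arcs" for s
  proof -
    obtain u e where ue: "s = (u, e)" by (cases s)
    from s[unfolded ue] obtain P where P: "P \<in># Ps" "u \<in> set P" "endable P u" "e \<in> slots_at u" "(u, e) \<in> slots P"
      "\<not> spinnable P \<longrightarrow> u = hd P \<or> u = last P" "spinnable P \<longrightarrow> \<not> fst e \<subseteq> set P" by (rule arcsE) blast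
    have eG: "e \<in> G" "u \<in> fst e" using P(4) by (auto simp: slots_at_def)
    from slotE[OF this] obtain x where x: "fst e = {u, x}" "x \<noteq> u" "adj u x" by metis
    have Pne: "P \<noteq> []" using P(2) by auto
    show ?thesis
    proof (cases "x \<in> set P")
      case True
      then have ns: "\<not> spinnable P" using P(2,7) x(1) by auto
      have "\<exists>D. dir D \<and> hd D = u \<and> set D = set P \<and> \<not> spinnable D \<and> D \<noteq> []"
        using P(1,6) ns dir_mem[OF P(1)] dir_rev[of P] spinnable_rev[of P] Pne
        by (metis hd_rev rev_is_Nil_conv set_rev)
      then obtain D where D: "dir D" "hd D = u" "set D = set P" "\<not> spinnable D" "D \<noteq> []" by blast
      obtain A M where AM: "D = A @ x # M" using True D(3) by (metis in_set_conv_decomp)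
      have A: "A \<noteq> []" "hd A = u" using AM D(2) x(2) by (cases A; auto)+
      show ?thesis
      proof (cases "primary e")
        case True
        then have "use_own s A (x # M)"
          unfolding use_own_def using D AM A ue x s eG by auto
        then show ?thesis unfolding use_def by blast
      next
        case False
        have cl: "closed_wrt \<T> {u, x}"
          using doubled_closed[OF eG(1) not_primary(2,3)[OF False] x(1)] x(1) by simp
        \<comment> \<open>The ends of parallel edges form a closed pair, and by
          \<open>chord_not_closed\<close> such a pair is consecutive.\<close>
        have "\<not> 2 \<le> length A"
          using chord_not_closed[of A "x # M"] D(1) AM A x(3) cl by auto
        then have A1: "A = [u]" using A by (cases A) (auto simp: not_le less_Suc_eq)
        \<comment> \<open>A path consisting of the closed pair alone could be closed to a cycle of
          length 2.\<close>
        have "M \<noteq> []"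
        proof
          assume "M = []"
          with close_impossible[OF D(1)] AM A1 x(3) cl adj_sym show False by auto
        qed
        moreover have "(A @ [x]) @ M = D" using AM by simp
        ultimately have "use_double s (A @ [x]) M"
          unfolding use_double_def using D A1 ue x(1) s eG(1) False by auto
        then show ?thesis unfolding use_def by blast
      qed
    next
      case False
      have not_in: "x \<notin> set D" if "dir D" "u \<in> set D" for D
        using dir_same[OF dir_mem[OF P(1)] that(1) P(2) that(2)] False by auto
      show ?thesis
      proof (cases "double_hitter u \<and> e = dropped u")
        case True
        then obtain D where D: "dir (u # D)" "D \<noteq> []" "\<not> spinnable (u # D)" unfolding double_hitter_def by blast
        then have "use_double_hitter s [u] D" unfolding use_double_hitter_def using True ue s by auto
        then show ?thesis unfolding use_def by blast
      next
        case nrem: False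
        then have O: "s \<in> out_arcs x" unfolding out_arcs_def using ue s x(1) not_in by auto
        then have "g x s \<in> free_edges x" using g(2)[of x] by auto
        then obtain A B where "dir (A @ B)" "A \<noteq> []" "B \<noteq> []" "hd B = x" "g x s = {last A, x}"
          "\<not> (\<exists>e\<in>G. fst e = {last A, x} \<or> fst e = {hd A, x})" "\<not> spinnable (A @ B)"
          unfolding free_edges_def by blast
        then have "use_out s A B" "g x s = {last A, hd B}" "g x s = g (hd B) s"
          unfolding use_out_def using O s by auto
        then show ?thesis unfolding use_def by blast
      qed
    qed
  qed
  have un: "s = s'" if "use s f" "use s' f" for s s' f
  proof -
    from that obtain A B A' B' where AB: "f = {last A, hd B}" "f = {last A', hd B'}" and
      u: "use_own s A B \<or> use_double s A B \<or> use_double_hitter s A B \<or> (use_out s A B \<and> f = g (hd B) s)" and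
      u': "use_own s' A' B' \<or> use_double s' A' B' \<or> use_double_hitter s' A' B' \<or> (use_out s' A' B' \<and> f = g (hd B') s')"
      unfolding use_def by blast
    have eq: "{last A, hd B} = {last A', hd B'}" "{last A', hd B'} = {last A, hd B}" using AB by auto
    have oo: "s = s'" if o: "use_out s A B" "f = g (hd B) s" "use_out s' A' B'" "f = g (hd B') s'"
    proof (rule edge_same[of A B A' B'])
      assume "A' = A" "B' = B"
      then have "s \<in> out_arcs (hd B)" "s' \<in> out_arcs (hd B)" "g (hd B) s = g (hd B) s'"
        using o by (auto simp: use_out_def)
      then show ?thesis using g(1)[of "hd B"] by (auto dest: inj_onD)
    next
      assume "A' = rev B" "B' = rev A"
      then have "s \<in> out_arcs (hd B)" "s' \<in> out_arcs (last A)" "dir (A @ B)" "A \<noteq> []" "B \<noteq> []"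
        using o by (auto simp: use_out_def hd_rev)
      with out_out_opposite show ?thesis by blast
    qed (use o eq(1) in \<open>auto simp: use_out_def\<close>)
    from u u' eq show ?thesis
      using own_own own_double own_dh own_out double_double double_dh double_out dh_dh dh_out oo by metis
  qed
  have cod: "\<exists>P\<in>#Ps. \<not> spinnable P \<and> f \<in> path_edges P" if "use s f" for s f
  proof -
    from that obtain A B where "f = {last A, hd B}" "dir (A @ B)" "A \<noteq> []" "B \<noteq> []" "\<not> spinnable (A @ B)"
      unfolding use_def use_own_def use_double_def use_double_hitter_def use_out_def by blast
    then show ?thesis using path_edges_dir by blast
  qed
  define \<phi> where "\<phi> s = (SOME f. use s f)" for s
  have \<phi>: "use s (\<phi> s)" if "s \<in> arcs" for s
    unfolding \<phi>_def using someI_ex[OF ex[OF that]] .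
  have "inj_on \<phi> arcs" using \<phi> un by (metis inj_onI)
  moreover have "\<phi> ` arcs \<subseteq> (\<Union>P\<in>{P \<in> set_mset Ps. \<not> spinnable P}. path_edges P)"
    using \<phi> cod by blast
  ultimately show ?thesis by blast
qed

definition singles :: "'v list set" where "singles = {P \<in> set_mset Ps. length P = 1}"

definition tight_pairs :: "'v list set" where
  "tight_pairs = {P \<in> set_mset Ps. length P = 2 \<and> (\<exists>e\<in>G. fst e = set P)}"

lemma finite_slots: "P \<in># Ps \<Longrightarrow> finite (slots P)"
proof -
  assume P: "P \<in># Ps"
  have "slots P \<subseteq> set P \<times> G"
    using selection(1)[OF P] nonempty[OF P] by (auto simp: slots_def outs_def slots_at_def)
  then show ?thesis using finite_G finite_subset by blast
qed

lemma slots_disjoint: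
  assumes "P \<in># Ps" "P' \<in># Ps" "P \<noteq> P'" shows "slots P \<inter> slots P' = {}"
proof -
  have "fst s \<in> set P" if "P \<in># Ps" "s \<in> slots P" for P s
    using that selection(1)[OF that(1)] nonempty[OF that(1)]
    by (cases s) (auto simp: slots_def outs_def split: if_splits)
  then show ?thesis using assms Ps_unique by blast
qed

text \<open>Four stands for two slots at either end. A spinnable path keeps only its selection, but
  its \<open>length P - 1\<close> edges are never charged and make up for the rest. The last two
  summands compensate the slots that a one-vertex path and a tight pair do not have.\<close>

lemma slots_card:
  assumes P: "P \<in># Ps"
  shows "4 \<le> card (slots P) + (\<Sum>v\<in>set P. deficit v) + (if spinnable P then length P - 1 else 0) +
    (if P \<in> singles then 2 else 0) + (if P \<in> tight_pairs then 1 else 0)"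
proof (cases "spinnable P")
  case True
  with selection(2)[OF P True] show ?thesis by (auto simp: slots_def spinnable_def)
next
  case False
  have PU: "set P \<subseteq> U" "distinct P" using Ps_vertices[OF P] by auto
  have ne: "P \<noteq> []" using nonempty[OF P] .
  show ?thesis
  proof (cases "length P = 1")
    case True
    then obtain u where u: "P = [u]" by (auto simp: length_Suc_conv)
    have "slots P = {u} \<times> slots_at u" using False u by (auto simp: slots_def)
    then have "card (slots P) + deficit u = 2"
      using card_slots_at_deficit[of u] PU u by (simp add: card_cartesian_product_singleton)
    then show ?thesis using u True P by (simp add: singles_def)
  next
    case len: False
    let ?u = "hd P" and ?v = "last P"
    have uv: "?u \<noteq> ?v" using PU(2) len ne by (cases P) (auto split: if_splits)
    have mem: "?u \<in> set P" "?v \<in> set P" using ne by auto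
    have full: "card (slots_at ?u) + deficit ?u = 2" "card (slots_at ?v) + deficit ?v = 2"
      using card_slots_at_deficit PU(1) mem by blast+
    have d: "deficit ?u + deficit ?v \<le> (\<Sum>v\<in>set P. deficit v)"
      using sum_mono2[of "set P" "{?u, ?v}" "\<lambda>v. deficit v"] mem uv by auto
    let ?X = "{?u} \<times> slots_at ?u \<union> {?v} \<times> slots_at ?v"
    have fX: "finite ?X" using finite_slots_at by simp
    have cX: "card ?X = card (slots_at ?u) + card (slots_at ?v)"
      using uv finite_slots_at[of ?u] finite_slots_at[of ?v]
      by (subst card_Un_disjoint) (auto simp: card_cartesian_product_singleton)
    have sub: "?X - {(?v, e) | e. e \<in> G \<and> length P = 2 \<and> fst e = set P} \<subseteq> slots P"
      using False by (auto simp: slots_def slots_at_def)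
    show ?thesis
    proof (cases "P \<in> tight_pairs")
      case False
      then have "{(?v, e) | e. e \<in> G \<and> length P = 2 \<and> fst e = set P} = {}" using P by (auto simp: tight_pairs_def)
      with sub have "?X \<subseteq> slots P" by (metis (no_types, lifting) Diff_empty)
      then have "card ?X \<le> card (slots P)" using finite_slots[OF P] by (intro card_mono)
      then show ?thesis using cX d full by linarith
    next
      case True
      then obtain e0 where e0: "length P = 2" "e0 \<in> G" "fst e0 = set P" by (auto simp: tight_pairs_def)
      then obtain a b where ab: "P = [a, b]" by (metis length_0_conv length_Suc_conv numeral_2_eq_2)
      \<comment> \<open>A parallel copy would make the pair closed, and the path itself could be
        closed to a cycle.\<close>
      have "e = e0" if "e \<in> G" "fst e = set P" for e
      proof (rule ccontr)
        assume "e \<noteq> e0"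
        then have "closed_wrt \<T> {a, b}" using doubled_closed[of e e0 a b] that e0 ab by auto
        moreover have "adj b a" using edge_adj[of e0 b a] e0 ab by auto
        ultimately show False using close_impossible[OF dir_mem[OF P]] ab by auto
      qed
      then have "{(?v, e) | e. e \<in> G \<and> length P = 2 \<and> fst e = set P} \<subseteq> {(?v, e0)}" by auto
      with sub have "?X - {(?v, e0)} \<subseteq> slots P" by blast
      then have "card (?X - {(?v, e0)}) \<le> card (slots P)" using finite_slots[OF P] by (intro card_mono)
      moreover have "card ?X - 1 \<le> card (?X - {(?v, e0)})" using fX by (simp add: card_Diff_singleton_if)
      ultimately have "3 \<le> card (slots P) + (\<Sum>v\<in>set P. deficit v)" using cX d full by linarith
      then show ?thesis using True by simp
    qed
  qed
qed

lemma sum_paths_vertices: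
  fixes f :: "'v \<Rightarrow> nat"
  shows "(\<Sum>P\<in>set_mset Ps. \<Sum>v\<in>set P. f v) \<le> (\<Sum>v\<in>U. f v)"
proof -
  have "(\<Sum>P\<in>set_mset Ps. \<Sum>v\<in>set P. f v) = (\<Sum>v\<in>(\<Union>P\<in>set_mset Ps. set P). f v)"
    using Ps_unique by (intro sum.UNION_disjoint[symmetric]) auto
  also have "\<dots> \<le> (\<Sum>v\<in>U. f v)"
    using Ps_vertices finite_U by (intro sum_mono2) auto
  finally show ?thesis .
qed

lemma size_Ps: "size Ps = card (set_mset Ps)"
  by (subst Ps_mset_set) simp

lemma count_arcs:
  "5 * size Ps \<le> card U + (\<Sum>v\<in>U. deficit v) + 2 * card singles + card tight_pairs"
proof -
  let ?S = "set_mset Ps"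
  have 0: "card arcs = (\<Sum>P\<in>?S. card (slots P))"
    unfolding arcs_def using finite_slots slots_disjoint by (intro card_UN_disjoint) auto
  obtain \<phi> where \<phi>: "inj_on \<phi> arcs"
    "\<phi> ` arcs \<subseteq> (\<Union>P\<in>{P \<in> ?S. \<not> spinnable P}. path_edges P)"
    using arcs_inject by blast
  have "card arcs \<le> card (\<Union>P\<in>{P \<in> ?S. \<not> spinnable P}. path_edges P)"
    using \<phi> card_path_edges by (intro card_inj_on_le[of \<phi>]) auto
  also have "\<dots> \<le> (\<Sum>P\<in>{P \<in> ?S. \<not> spinnable P}. card (path_edges P))"
    by (intro card_UN_le) auto
  also have "\<dots> \<le> (\<Sum>P\<in>{P \<in> ?S. \<not> spinnable P}. length P - 1)"
    using card_path_edges by (intro sum_mono) auto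
  also have "\<dots> = (\<Sum>P\<in>?S. if spinnable P then 0 else length P - 1)"
    by (intro sum.mono_neutral_cong_left) auto
  finally have 1: "(\<Sum>P\<in>?S. card (slots P)) \<le> (\<Sum>P\<in>?S. if spinnable P then 0 else length P - 1)"
    using 0 by simp
  have "4 * card ?S = (\<Sum>P\<in>?S. 4)" by simp
  also have "\<dots> \<le> (\<Sum>P\<in>?S. card (slots P) + (\<Sum>v\<in>set P. deficit v) + (if spinnable P then length P - 1 else 0) +
    (if P \<in> singles then 2 else 0) + (if P \<in> tight_pairs then 1 else 0))"
    using slots_card by (intro sum_mono) auto
  also have "\<dots> = (\<Sum>P\<in>?S. card (slots P)) + (\<Sum>P\<in>?S. \<Sum>v\<in>set P. deficit v) +
     (\<Sum>P\<in>?S. if spinnable P then length P - 1 else 0) + (\<Sum>P\<in>?S. if P \<in> singles then 2 else 0) +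
     (\<Sum>P\<in>?S. if P \<in> tight_pairs then 1 else 0)"
    by (simp add: sum.distrib)
  also have "(\<Sum>P\<in>?S. if P \<in> singles then 2 else 0) = (2 * card singles :: nat)"
    by (simp add: sum.If_cases Int_absorb1 singles_def Collect_conj_eq)
  also have "(\<Sum>P\<in>?S. if P \<in> tight_pairs then 1 else 0) = card tight_pairs"
    by (simp add: sum.If_cases Int_absorb1 tight_pairs_def Collect_conj_eq)
  finally have 2: "4 * card ?S \<le> (\<Sum>P\<in>?S. card (slots P)) + (\<Sum>P\<in>?S. \<Sum>v\<in>set P. deficit v) +
     (\<Sum>P\<in>?S. if spinnable P then length P - 1 else 0) + 2 * card singles + card tight_pairs" .
  \<comment> \<open>A path has one edge less than vertices, so path edges and paths together number
    at most \<open>card U\<close>; this turns the factor 4 into 5.\<close>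
  have "(\<Sum>P\<in>?S. if spinnable P then 0 else length P - 1) + (\<Sum>P\<in>?S. if spinnable P then length P - 1 else 0) + card ?S
      = (\<Sum>P\<in>?S. (if spinnable P then 0 else length P - 1) + (if spinnable P then length P - 1 else 0) + 1)"
    unfolding sum.distrib by simp
  also have "\<dots> = (\<Sum>P\<in>?S. \<Sum>v\<in>set P. 1)"
    using nonempty Ps_vertices by (intro sum.cong) (auto simp: distinct_card Suc_le_eq)
  also have "\<dots> \<le> card U" using sum_paths_vertices[of "\<lambda>_. 1"] by simp
  finally show ?thesis using 1 2 sum_paths_vertices[of deficit] size_Ps by linarith
qed


section \<open>Adjacencies of one-vertex and two-vertex paths\<close>

definition stars :: "'v list set" where
  "stars = {P \<in> set_mset Ps. length P = 3 \<and> (\<exists>u e. [u] \<in># Ps \<and> e \<in> G \<and> fst e = {u, P ! 1})}"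

definition middling :: "'v list set" where
  "middling = {P \<in> set_mset Ps. 3 \<le> length P \<and> length P \<le> 5}"

text \<open>The slots for which only few targets are possible, namely inner vertices of paths with
  three to five vertices.\<close>

definition leaf_slots :: "'v list \<Rightarrow> ('v \<times> 'v set \<times> bool) set" where
  "leaf_slots P = (if P \<in> singles \<or> P \<in> stars then {(u, e). u \<in> {hd P, last P} \<and> e \<in> slots_at u}
     else if P \<in> tight_pairs then {(u, e). u \<in> set P \<and> e \<in> slots_at u \<and> fst e \<noteq> set P} else {})"

definition hits_center :: "'v \<times> 'v set \<times> bool \<Rightarrow> 'v list \<Rightarrow> 'v \<Rightarrow> bool" where
  "hits_center s Q x \<longleftrightarrow> Q \<in># Ps \<and> fst (snd s) = {fst s, x} \<and> snd s \<in> G \<and> x \<in> set Q \<and>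
     (length Q = 3 \<and> x = Q ! 1 \<or>
      (\<exists>P\<in>tight_pairs. s \<in> leaf_slots P \<and> fst s \<notin> set Q) \<and>
        (\<exists>L M. Q = L @ x # M \<and> length L \<in> {1, 2} \<and> length M \<in> {1, 2}))"

lemma dir_to_Ps:
  assumes "dir (L @ x # M)"
  obtains L' M' where "L' @ x # M' \<in># Ps" "{length L', length M'} = {length L, length M}"
    "length L' + length M' = length L + length M"
proof -
  from assms consider "L @ x # M \<in># Ps" | "rev M @ x # rev L \<in># Ps" by (auto simp: dir_def)
  then show ?thesis using that[of L M] that[of "rev M" "rev L"] by cases auto
qed

lemma hits_three:
  assumes "dir (L @ x # M)" "L \<noteq> []" "M \<noteq> []" "\<not> 4 \<le> length (L @ x # M)"
    "fst (snd s) = {fst s, x}" "snd s \<in> G"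
  shows "\<exists>Q. hits_center s Q x \<and> length Q = 3 \<and> x = Q ! 1"
proof -
  from assms(1) obtain L' M' where Q: "L' @ x # M' \<in># Ps"
    "{length L', length M'} = {length L, length M}" "length L' + length M' = length L + length M" by (rule dir_to_Ps)
  have "0 < length L" "0 < length M" "length L + length M < 3" using assms(2-4) by simp_all
  then have "length L = 1" "length M = 1" by linarith+
  then have "length L' = 1" "length M' = 1" using Q(2) by auto
  then have "hits_center s (L' @ x # M') x" "length (L' @ x # M') = 3" "x = (L' @ x # M') ! 1"
    unfolding hits_center_def using Q(1) assms(5,6) by (auto simp: nth_append)
  then show ?thesis by blast
qed

lemma single_hits:
  assumes "P \<in> singles" "s \<in> leaf_slots P"
  shows "\<exists>Q x. hits_center s Q x \<and> length Q = 3 \<and> Q \<in> stars"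
proof -
  from assms(1) have P: "P \<in># Ps" "length P = 1" by (auto simp: singles_def)
  then obtain u where u: "P = [u]" by (auto simp: length_Suc_conv)
  with assms obtain e where e: "s = (u, e)" "e \<in> G" "u \<in> fst e" by (auto simp: leaf_slots_def slots_at_def)
  from slotE[OF e(2,3)] obtain x where x: "fst e = {u, x}" "x \<noteq> u" "adj u x" by metis
  have d: "dir [u]" using P u dir_mem by blast
  have "endable [u] u" using endable_hd[of "[u]"] by simp
  from d this e(2) x(1) obtain L M where LM: "dir (L @ x # M)" "L \<noteq> []" "M \<noteq> []"
    "set [u] \<noteq> set (L @ x # M)" by (rule locate) (use x(2) in simp)
  have "u \<notin> set (L @ x # M)" using dir_disjoint[OF d LM(1,4)] by auto
  from single_not_adj_long[OF d LM(1) this LM(2,3)] x(3) have "\<not> 4 \<le> length (L @ x # M)" by blast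
  from hits_three[OF LM(1-3) this, of s] e x obtain Q where Q: "hits_center s Q x" "length Q = 3" "x = Q ! 1" by auto
  have "[u] \<in># Ps \<and> e \<in> G \<and> fst e = {u, Q ! 1}" using P(1) u e(2) x(1) Q(3) by simp
  then have "Q \<in> stars" using Q(1,2) unfolding stars_def hits_center_def by blast
  with Q show ?thesis by blast
qed

text \<open>The centre \<open>y\<close> is adjacent to a one-vertex path and hence cannot become an
  end. So the star is not spinnable, and its ends are not adjacent. A slot of an end leads to the
  own centre or outside, and outside it is restricted by the exchange with
  \<open>u0\<close>.\<close>

lemma star_hits:
  assumes "P \<in> stars" "s \<in> leaf_slots P"
  shows "\<exists>Q x. hits_center s Q x \<and> length Q = 3"
proof -
  from assms(1) obtain u0 e0 where P: "P \<in># Ps" "length P = 3" "[u0] \<in># Ps" "e0 \<in> G" "fst e0 = {u0, P ! 1}"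
    by (auto simp: stars_def)
  obtain u e where s: "s = (u, e)" by (cases s)
  have u: "u = hd P \<or> u = last P" "e \<in> G" "u \<in> fst e" using assms s by (auto simp: leaf_slots_def slots_at_def)
  obtain a y b where Payb: "P = [a, y, b]" using P(2) by (metis length_0_conv length_Suc_conv numeral_3_eq_3)
  have "\<exists>r. dir [u, y, r] \<and> (P = [u, y, r] \<or> P = [r, y, u])"
    using u(1) Payb dir_mem[OF P(1)] dir_rev[of P] by auto
  then obtain r where r: "dir [u, y, r]" "P = [u, y, r] \<or> P = [r, y, u]" by blast
  have d0: "dir [u0]" using P(3) by (rule dir_mem)
  have y: "P ! 1 = y" using r(2) by auto
  have a0: "adj u0 y" using edge_adj[OF P(4,5)] y by auto
  have ne0: "u0 \<notin> {u, y, r}"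
  proof
    assume "u0 \<in> {u, y, r}"
    then have "[u0] = P" using Ps_unique[OF P(3,1), of u0] r(2) by auto
    then show False using P(2) by auto
  qed
  have "set [u0] \<noteq> set [u, y, r]" using ne0 by auto
  then have ny: "\<not> endable [u, y, r] y"
    using endable_not_adj[OF d0 r(1), of u0 y] endable_hd[of "[u0]"] a0 by auto
  have ur: "\<not> adj u r" using ny endable_spinnable[of "[u, y, r]" y] by (auto simp: spinnable_def)
  from slotE[OF u(2,3)] obtain x where x: "fst e = {u, x}" "x \<noteq> u" "adj u x" by metis
  show ?thesis
  proof (cases "x \<in> {u, y, r}")
    case True
    then have "x = y" using x ur by auto
    then have "hits_center s P x" unfolding hits_center_def using P(1,2) s x u(2) y Payb by auto
    then show ?thesis using P(2) by blast
  next
    case False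
    have "endable [u, y, r] u" using endable_hd[of "[u, y, r]"] by simp
    from r(1) this u(2) x(1) obtain L M where LM: "dir (L @ x # M)" "L \<noteq> []" "M \<noteq> []"
      "set [u, y, r] \<noteq> set (L @ x # M)" by (rule locate) (use False in simp)
    have "u0 \<notin> set (L @ x # M)"
    proof
      assume "u0 \<in> set (L @ x # M)"
      then have "length (L @ x # M) = 1" using dir_same[OF d0 LM(1), of u0] by auto
      then show False using LM(2) by simp
    qed
    from star_leaf_not_adj_long[OF d0 r(1) a0 ne0 LM(1) this LM(4,2,3)] x(3)
    have "\<not> 4 \<le> length (L @ x # M)" by blast
    from hits_three[OF LM(1-3) this, of s] s x u show ?thesis by auto
  qed
qed

lemma tight_pair_cases:
  assumes "P \<in> tight_pairs" "s \<in> leaf_slots P"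
  obtains u v e e0 x where "s = (u, e)" "e \<in> G" "e0 \<in> G" "P = [u, v] \<or> P = [v, u]" "fst e0 = {u, v}" "fst e = {u, x}" "x \<notin> {u, v}"
    "adj u x" "u \<in> U" "P \<in># Ps" "dir [u, v]" "e \<noteq> e0"
proof -
  from assms(1) obtain e0 where P: "P \<in># Ps" "length P = 2" "e0 \<in> G" "fst e0 = set P" by (auto simp: tight_pairs_def)
  then have np: "P \<notin> singles" "P \<notin> stars" by (auto simp: singles_def stars_def)
  obtain u e where s: "s = (u, e)" by (cases s)
  have u: "u \<in> set P" "e \<in> G" "u \<in> fst e" "fst e \<noteq> set P" using assms np s by (auto simp: leaf_slots_def slots_at_def)
  obtain a b where "P = [a, b]" using P(2) by (metis length_0_conv length_Suc_conv numeral_2_eq_2)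
  then obtain v where v: "P = [u, v] \<or> P = [v, u]" using u(1) by auto
  then have d: "dir [u, v]" using dir_mem[OF P(1)] dir_rev[of P] by auto
  from slotE[OF u(2,3)] obtain x where x: "fst e = {u, x}" "x \<noteq> u" "adj u x" "u \<in> U" by metis
  have Pset: "set P = {u, v}" using v by auto
  show ?thesis using that[OF s u(2) P(3) v _ x(1) _ x(3,4) P(1) d] P(4) Pset x u(4) by auto
qed

text \<open>The cut of \<open>two_path_not_adj_long\<close> is possible on either side of the hit
  vertex, so each side has one or two vertices.\<close>

lemma tight_pair_hits:
  assumes "P \<in> tight_pairs" "s \<in> leaf_slots P"
  shows "\<exists>Q x. hits_center s Q x \<and> 3 \<le> length Q \<and> length Q \<le> 5"
proof -
  from assms obtain u v e e0 x where *: "s = (u, e)" "e \<in> G" "e0 \<in> G" "P = [u, v] \<or> P = [v, u]" "fst e0 = {u, v}"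
    "fst e = {u, x}" "x \<notin> {u, v}" "adj u x" "u \<in> U" "P \<in># Ps" "dir [u, v]" "e \<noteq> e0" by (rule tight_pair_cases)
  have "endable [u, v] u" using endable_hd[of "[u, v]"] by simp
  from *(11) this *(2,6) obtain L M where LM: "dir (L @ x # M)" "L \<noteq> []" "M \<noteq> []"
    "set [u, v] \<noteq> set (L @ x # M)" by (rule locate) (use *(7) in simp)
  have u_out: "u \<notin> set (L @ x # M)" using dir_disjoint[OF *(11) LM(1,4)] by auto
  have d': "dir (rev M @ x # rev L)" using dir_rev[of "L @ x # M"] LM(1) by simp
  have "\<not> 3 \<le> length M" using two_path_not_adj_long[OF *(11) LM(1) u_out] *(8) by blast
  moreover have "\<not> 3 \<le> length L" using two_path_not_adj_long[OF *(11) d'] u_out *(8) by auto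
  ultimately have len: "length L \<in> {1, 2}" "length M \<in> {1, 2}" using LM(2,3) by (simp_all add: not_le less_Suc_eq numeral_eq_Suc)
  show ?thesis
  proof (cases "L @ x # M \<in># Ps")
    case True
    then have "hits_center s (L @ x # M) x" unfolding hits_center_def using * len u_out assms by auto
    then show ?thesis using len by fastforce
  next
    case False
    then have "rev M @ x # rev L \<in># Ps" using LM(1) by (auto simp: dir_def)
    moreover have "\<exists>L' M'. rev M @ x # rev L = L' @ x # M' \<and> length L' \<in> {1, 2} \<and> length M' \<in> {1, 2}"
      using len by (intro exI[of _ "rev M"] exI[of _ "rev L"]) auto
    ultimately have "hits_center s (rev M @ x # rev L) x" unfolding hits_center_def using * u_out assms by auto
    then show ?thesis using len by fastforce
  qed
qed

text \<open>Two different pairs would bridge the edge between \<open>x\<close> and \<open>y\<close>.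
  A pair hitting with both its vertices would be inserted there. A single vertex of a pair has only
  one slot besides the edge of the pair.\<close>

lemma hits_four_impossible:
  assumes "P \<in> tight_pairs" "s \<in> leaf_slots P" "P' \<in> tight_pairs" "s' \<in> leaf_slots P'"
    "[a, x, y, b] \<in># Ps" "fst (snd s) = {fst s, x}" "fst (snd s') = {fst s', y}" "fst s \<notin> set [a, x, y, b]" "fst s' \<notin> set [a, x, y, b]"
  shows False
proof -
  have dQ: "dir ([a, x] @ [y, b])" using assms(5) dir_mem by simp
  have xy: "x \<noteq> y" using dir_distinct[OF dQ] by simp
  from assms(1,2) obtain u v e e0 x1 where *: "s = (u, e)" "e \<in> G" "e0 \<in> G" "P = [u, v] \<or> P = [v, u]" "fst e0 = {u, v}"
    "fst e = {u, x1}" "x1 \<notin> {u, v}" "adj u x1" "u \<in> U" "P \<in># Ps" "dir [u, v]" "e \<noteq> e0" by (rule tight_pair_cases)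
  from assms(3,4) obtain u' v' e' e0' y1 where **: "s' = (u', e')" "e' \<in> G" "e0' \<in> G" "P' = [u', v'] \<or> P' = [v', u']" "fst e0' = {u', v'}"
    "fst e' = {u', y1}" "y1 \<notin> {u', v'}" "adj u' y1" "u' \<in> U" "P' \<in># Ps" "dir [u', v']" "e' \<noteq> e0'" by (rule tight_pair_cases)
  have x1: "x1 = x" "y1 = y" using assms(6,7) * ** by (auto simp: doubleton_eq_iff)
  have ne: "set [u, v] \<noteq> set ([a, x] @ [y, b])" "set [u', v'] \<noteq> set ([a, x] @ [y, b])"
    using assms(8,9) * ** by auto
  have en: "endable [u, v] u" "endable [u', v'] u'" using endable_hd[of "[u, v]"] endable_hd[of "[u', v']"] by auto
  show False
  proof (cases "set [u, v] = set [u', v']")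
    case False
    from bridge_not_adj[OF *(11) **(11) dQ False ne en] *(8) **(8) x1 show False by simp
  next
    case True
    show False
    proof (cases "u = u'")
      case True
      have "v = v'" using \<open>set [u, v] = set [u', v']\<close> True dir_distinct[OF *(11)] dir_distinct[OF **(11)] by auto
      have "e \<noteq> e'" using *(6) **(6) x1 xy True by (auto simp: doubleton_eq_iff)
      moreover have "e0 \<noteq> e'" using *(5) **(6,7) True \<open>v = v'\<close> by (auto simp: doubleton_eq_iff)
      ultimately show False
        using three_slots[of u e e0 e'] * ** True by (auto simp: slots_at_def)
    next
      case False
      then have "u' = v" using True by auto
      have "rearr 0 [u, v] [u, v]" by (rule rearr_refl) simp
      from insert_impossible[OF *(11) dQ ne(1) this] *(8) **(8) x1 \<open>u' = v\<close> adj_sym show False by auto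
    qed
  qed
qed

text \<open>Only a path of four vertices offers two candidates, and there the hits come from tight
  pairs.\<close>

lemma hits_unique:
  assumes "hits_center s Q x" "hits_center s' Q x'" shows "x = x'"
proof -
  have c: "(length Q = 3 \<and> x = Q ! 1) \<or> (length Q = 5 \<and> x = Q ! 2) \<or> (length Q = 4 \<and> (x = Q ! 1 \<or> x = Q ! 2) \<and>
    (\<exists>P\<in>tight_pairs. s \<in> leaf_slots P \<and> fst s \<notin> set Q))" if "hits_center s Q x" for s x
    using that unfolding hits_center_def by (auto simp: nth_append)
  show ?thesis
  proof (cases "length Q = 4")
    case False
    then show ?thesis using c[OF assms(1)] c[OF assms(2)] by auto
  next
    case True
    then obtain a y z b where Q: "Q = [a, y, z, b]" by (auto simp: length_Suc_conv numeral_eq_Suc)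
    from c[OF assms(1)] True obtain P where P: "P \<in> tight_pairs" "s \<in> leaf_slots P" "fst s \<notin> set Q" by auto
    from c[OF assms(2)] True obtain P' where P': "P' \<in> tight_pairs" "s' \<in> leaf_slots P'" "fst s' \<notin> set Q" by auto
    have xx: "x = y \<or> x = z" "x' = y \<or> x' = z" using c[OF assms(1)] c[OF assms(2)] Q by auto
    have f: "fst (snd s) = {fst s, x}" "fst (snd s') = {fst s', x'}" "[a, y, z, b] \<in># Ps" using assms Q by (auto simp: hits_center_def)
    show ?thesis
    proof (rule ccontr)
      assume "x \<noteq> x'"
      with xx consider "x = y" "x' = z" | "x = z" "x' = y" by auto
      then show False
        using hits_four_impossible[OF P(1,2) P'(1,2) f(3)] hits_four_impossible[OF P'(1,2) P(1,2) f(3)]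
          P(3) P'(3) f Q by cases simp_all
    qed
  qed
qed

text \<open>All hits on one path go to the same vertex, which has at most two slots.\<close>

lemma card_hits:
  assumes "finite Y" "\<And>s. s \<in> X \<Longrightarrow> \<exists>Q\<in>Y. \<exists>x. hits_center s Q x"
  shows "card X \<le> 2 * card Y"
proof -
  have one: "finite {s. \<exists>x. hits_center s Q x} \<and> card {s. \<exists>x. hits_center s Q x} \<le> 2" for Q
  proof (cases "{s. \<exists>x. hits_center s Q x} = {}")
    case False
    then obtain s0 x where h: "hits_center s0 Q x" by auto
    have x: "fst (snd s) = {fst s, x}" "snd s \<in> G" if "s \<in> {s. \<exists>x. hits_center s Q x}" for s
    proof -
      from that obtain x' where h': "hits_center s Q x'" by blast
      with hits_unique[OF h h'] show "fst (snd s) = {fst s, x}" "snd s \<in> G" by (simp_all add: hits_center_def)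
    qed
    have "x \<in> set Q" "Q \<in># Ps" using h by (auto simp: hits_center_def)
    then have xU: "x \<in> U" using Ps_vertices by blast
    have inj: "inj_on snd {s. \<exists>x. hits_center s Q x}"
    proof (rule inj_onI)
      fix s s' assume s: "s \<in> {s. \<exists>x. hits_center s Q x}" "s' \<in> {s. \<exists>x. hits_center s Q x}" "snd s = snd s'"
      have "fst s \<noteq> x" "fst s' \<noteq> x" using edge_adj x s by blast+
      then have "fst s = fst s'" using x[OF s(1)] x[OF s(2)] s(3) by (auto simp: doubleton_eq_iff)
      then show "s = s'" using s(3) by (simp add: prod_eq_iff)
    qed
    have sub: "snd ` {s. \<exists>x. hits_center s Q x} \<subseteq> slots_at x" using x unfolding slots_at_def by force
    have "finite {s. \<exists>x. hits_center s Q x}" using finite_imageD[OF finite_subset[OF sub finite_slots_at] inj] .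
    moreover have "card {s. \<exists>x. hits_center s Q x} \<le> card (slots_at x)" by (rule card_inj_on_le[OF inj sub finite_slots_at])
    ultimately show ?thesis using card_slots_at[OF xU] by simp
  next
    case True
    show ?thesis unfolding True by simp
  qed
  have "X \<subseteq> (\<Union>Q\<in>Y. {s. \<exists>x. hits_center s Q x})" using assms(2) by blast
  then have "card X \<le> card (\<Union>Q\<in>Y. {s. \<exists>x. hits_center s Q x})" using one assms(1) by (intro card_mono) auto
  also have "\<dots> \<le> (\<Sum>Q\<in>Y. card {s. \<exists>x. hits_center s Q x})" using assms(1) by (rule card_UN_le)
  also have "\<dots> \<le> (\<Sum>Q\<in>Y. 2)" using one by (intro sum_mono) auto
  finally show ?thesis by simp
qed

lemma leaf_slots_sub: "leaf_slots P \<subseteq> set P \<times> G" if "P \<in># Ps"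
  using nonempty[OF that] by (auto simp: leaf_slots_def slots_at_def split: if_splits)

lemma leaf_slots_card:
  assumes "P \<in># Ps"
  shows "(if P \<in> singles then 2 else 0) + (if P \<in> stars then 4 else 0) + (if P \<in> tight_pairs then 2 else 0)
    \<le> card (leaf_slots P) + (\<Sum>v\<in>set P. deficit v)"
proof -
  have PU: "set P \<subseteq> U" "distinct P" using Ps_vertices[OF assms] by auto
  have fin: "finite (leaf_slots P)" using finite_subset[OF leaf_slots_sub[OF assms]] finite_G by simp
  consider (1) "P \<in> singles" "P \<notin> stars" "P \<notin> tight_pairs" | (2) "P \<in> stars" "P \<notin> singles" "P \<notin> tight_pairs"
    | (3) "P \<in> tight_pairs" "P \<notin> singles" "P \<notin> stars" | (4) "P \<notin> singles" "P \<notin> stars" "P \<notin> tight_pairs"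
    by (auto simp: singles_def stars_def tight_pairs_def)
  then show ?thesis
  proof cases
    case 1
    then obtain u where u: "P = [u]" by (auto simp: singles_def length_Suc_conv)
    have "leaf_slots P = {u} \<times> slots_at u" using 1 u by (auto simp: leaf_slots_def)
    then show ?thesis using 1 u card_slots_at_deficit[of u] PU by (simp add: card_cartesian_product_singleton)
  next
    case 2
    then obtain a y b where P: "P = [a, y, b]" unfolding stars_def by (auto simp: length_Suc_conv numeral_eq_Suc)
    have ab: "a \<noteq> b" "a \<in> U" "b \<in> U" using PU P by auto
    have "leaf_slots P = {a} \<times> slots_at a \<union> {b} \<times> slots_at b" using 2 P by (auto simp: leaf_slots_def)
    moreover have "card ({a} \<times> slots_at a \<union> {b} \<times> slots_at b) = card (slots_at a) + card (slots_at b)"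
      using ab finite_slots_at[of a] finite_slots_at[of b] by (subst card_Un_disjoint) (auto simp: card_cartesian_product_singleton)
    ultimately show ?thesis using 2 P PU(2) card_slots_at_deficit[OF ab(2)] card_slots_at_deficit[OF ab(3)] by simp
  next
    case 3
    then obtain a b where P: "P = [a, b]" unfolding tight_pairs_def by (auto simp: length_Suc_conv numeral_eq_Suc)
    from 3 obtain e0 where e0: "e0 \<in> G" "fst e0 = set P" by (auto simp: tight_pairs_def)
    have ab: "a \<noteq> b" "a \<in> U" "b \<in> U" using PU P by auto
    have un: "e = e0" if "e \<in> G" "fst e = set P" for e
    proof (rule ccontr)
      assume "e \<noteq> e0"
      then have "closed_wrt \<T> {a, b}" using doubled_closed[of e e0 a b] that e0 P by auto
      moreover have "adj b a" using edge_adj[of e0 b a] e0 P by auto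
      ultimately show False using close_impossible[OF dir_mem[OF assms]] P by auto
    qed
    have "{a} \<times> (slots_at a - {e0}) \<union> {b} \<times> (slots_at b - {e0}) \<subseteq> leaf_slots P"
      using 3 P un by (auto simp: leaf_slots_def slots_at_def)
    from card_mono[OF fin this]
    have "card (slots_at a - {e0}) + card (slots_at b - {e0}) \<le> card (leaf_slots P)"
      using ab finite_slots_at[of a] finite_slots_at[of b] by (subst (asm) card_Un_disjoint) (auto simp: card_cartesian_product_singleton)
    moreover have "card (slots_at a) - 1 \<le> card (slots_at a - {e0})" "card (slots_at b) - 1 \<le> card (slots_at b - {e0})"
      using finite_slots_at by (auto simp: card_Diff_singleton_if)
    moreover have "deficit a + deficit b = (\<Sum>v\<in>set P. deficit v)" using P ab by simp
    ultimately show ?thesis using 3 card_slots_at_deficit[OF ab(2)] card_slots_at_deficit[OF ab(3)] by simp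
  qed auto
qed

lemma count_leaves:
  "8 * card singles + 4 * card tight_pairs \<le> 2 * size Ps + 3 * (\<Sum>v\<in>U. deficit v)"
proof -
  let ?S = "set_mset Ps" and ?d = "\<Sum>v\<in>U. deficit v"
  have sub: "singles \<subseteq> ?S" "stars \<subseteq> ?S" "tight_pairs \<subseteq> ?S" "middling \<subseteq> ?S"
    by (auto simp: singles_def stars_def tight_pairs_def middling_def)
  have fin: "finite singles" "finite stars" "finite tight_pairs" "finite middling"
    using sub finite_subset by blast+
  have sumif: "(\<Sum>P\<in>?S. if P \<in> X then c else 0) = c * card X" if "X \<subseteq> ?S" for X and c :: nat
    using that by (simp add: sum.If_cases Int_absorb1)
  have finl: "finite (leaf_slots P)" if "P \<in># Ps" for P
    using finite_subset[OF leaf_slots_sub[OF that]] finite_G by simp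
  have disj: "leaf_slots P \<inter> leaf_slots P' = {}" if "P \<in># Ps" "P' \<in># Ps" "P \<noteq> P'" for P P'
    using leaf_slots_sub[OF that(1)] leaf_slots_sub[OF that(2)] Ps_unique[OF that(1,2)] that(3) by blast
  have "2 * card singles + 4 * card stars + 2 * card tight_pairs =
    (\<Sum>P\<in>?S. (if P \<in> singles then 2 else 0) + (if P \<in> stars then 4 else 0) + (if P \<in> tight_pairs then 2 else 0))"
    using sub by (simp add: sum.distrib sumif)
  also have "\<dots> \<le> (\<Sum>P\<in>?S. card (leaf_slots P) + (\<Sum>v\<in>set P. deficit v))"
    using leaf_slots_card by (intro sum_mono) auto
  also have "\<dots> \<le> (\<Sum>P\<in>?S. card (leaf_slots P)) + ?d"
    using sum_paths_vertices[of deficit] by (simp add: sum.distrib)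
  also have "(\<Sum>P\<in>?S. card (leaf_slots P)) = card (\<Union>P\<in>?S. leaf_slots P)"
    using finl disj by (intro card_UN_disjoint[symmetric]) auto
  also have "\<dots> \<le> 2 * card middling"
  proof (rule card_hits[OF fin(4)])
    fix s assume "s \<in> (\<Union>P\<in>?S. leaf_slots P)"
    then obtain P where P: "s \<in> leaf_slots P" by blast
    then have "P \<in> singles \<or> P \<in> stars \<or> P \<in> tight_pairs"
      by (rule contrapos_pp) (simp add: leaf_slots_def)
    then have "\<exists>Q x. hits_center s Q x \<and> 3 \<le> length Q \<and> length Q \<le> 5"
      using single_hits[OF _ P] star_hits[OF _ P] tight_pair_hits[OF _ P] by fastforce
    then obtain Q x where "hits_center s Q x" "3 \<le> length Q \<and> length Q \<le> 5" by blast
    then show "\<exists>Q\<in>middling. \<exists>x. hits_center s Q x" unfolding middling_def hits_center_def by blast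
  qed
  finally have 1: "2 * card singles + 4 * card stars + 2 * card tight_pairs \<le> 2 * card middling + ?d" by simp
  have "2 * card singles = (\<Sum>P\<in>singles. 2)" by simp
  also have "\<dots> \<le> (\<Sum>P\<in>singles. card (leaf_slots P) + (\<Sum>v\<in>set P. deficit v))"
  proof (rule sum_mono)
    fix P assume "P \<in> singles"
    with leaf_slots_card[of P] sub show "2 \<le> card (leaf_slots P) + (\<Sum>v\<in>set P. deficit v)" by fastforce
  qed
  also have "\<dots> = (\<Sum>P\<in>singles. card (leaf_slots P)) + (\<Sum>P\<in>singles. \<Sum>v\<in>set P. deficit v)" by (simp add: sum.distrib)
  also have "(\<Sum>P\<in>singles. \<Sum>v\<in>set P. deficit v) \<le> (\<Sum>P\<in>?S. \<Sum>v\<in>set P. deficit v)"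
    using sub by (intro sum_mono2) auto
  also have "\<dots> \<le> ?d" by (rule sum_paths_vertices)
  also have "(\<Sum>P\<in>singles. card (leaf_slots P)) = card (\<Union>P\<in>singles. leaf_slots P)"
    using finl disj fin sub by (intro card_UN_disjoint[symmetric]) blast+
  also have "\<dots> \<le> 2 * card stars"
  proof (rule card_hits[OF fin(2)])
    fix s assume "s \<in> (\<Union>P\<in>singles. leaf_slots P)"
    then show "\<exists>Q\<in>stars. \<exists>x. hits_center s Q x" using single_hits by blast
  qed
  finally have 2: "2 * card singles \<le> 2 * card stars + ?d" by simp
  have "card (singles \<union> tight_pairs \<union> middling) = card singles + card tight_pairs + card middling"
    using fin by (subst card_Un_disjoint; (subst card_Un_disjoint)?)
      (auto simp: singles_def tight_pairs_def middling_def)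
  moreover have "card (singles \<union> tight_pairs \<union> middling) \<le> card ?S"
    using sub by (intro card_mono) auto
  \<comment> \<open>The claim is inequality 1 plus twice inequality 2 plus twice the count of
    disjoint classes of paths; \<open>stars\<close> and \<open>middling\<close> cancel.\<close>
  ultimately show ?thesis using 1 2 size_Ps by linarith
qed

text \<open>Four times \<open>count_arcs\<close>, with the short paths eliminated by
  \<open>count_leaves\<close>.\<close>

theorem path_bound: "18 * size Ps \<le> 4 * card U + 7 * (\<Sum>v\<in>U. 2 - card {e \<in> G. v \<in> fst e})"
  using count_arcs count_leaves unfolding deficit_def slots_at_def by linarith

end

section \<open>From local optima to solutions\<close>

text \<open>The flag selects the parallel copy for the closing edge of a cycle of length 2.\<close>

definition cyc_edges :: "nat list \<Rightarrow> edge_code list" where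
  "cyc_edges c = map (\<lambda>i. (c ! i, c ! (Suc i mod length c), length c = 2 \<and> i = 1)) [0..<length c]"

definition cyc_graph :: "nat list \<Rightarrow> nat mgraph" where
  "cyc_graph c = cycle_of (c, cyc_edges c)"

definition cyc_edge :: "nat list \<Rightarrow> nat \<Rightarrow> nat set \<times> bool" where
  "cyc_edge c i = ({c ! i, c ! (Suc i mod length c)}, length c = 2 \<and> i = 1)"

lemma map_edge_of_cyc_edges: "map edge_of (cyc_edges c) = map (cyc_edge c) [0..<length c]"
  by (simp add: cyc_edges_def cyc_edge_def edge_of_def)

lemma cyc_graph_simps [simp]:
  "verts (cyc_graph c) = set c" "edges (cyc_graph c) = cyc_edge c ` {..<length c}"
proof -
  have "set (map edge_of (cyc_edges c)) = cyc_edge c ` {..<length c}"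
    by (simp only: map_edge_of_cyc_edges) (simp add: atLeast0LessThan)
  then show "verts (cyc_graph c) = set c" "edges (cyc_graph c) = cyc_edge c ` {..<length c}"
    by (simp_all add: cyc_graph_def cycle_of_def)
qed

section \<open>Lists of vertices as cycles of the multigraph\<close>

context
  fixes c :: "nat list"
  assumes dist: "distinct c" and len: "2 \<le> length c"
begin

lemma Suc_mod_less: "Suc i mod length c < length c"
  using len by (intro mod_less_divisor) linarith

text \<open>Two positions with the same pair of vertices are each other's successors. This forces
  length 2, where the flag tells them apart.\<close>

lemma inj_cyc_edge: "inj_on (cyc_edge c) {..<length c}"
proof (rule inj_onI, rule ccontr)
  fix i j assume *: "i \<in> {..<length c}" "j \<in> {..<length c}" "cyc_edge c i = cyc_edge c j" "i \<noteq> j"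
  let ?m = "length c"
  have "c ! i \<noteq> c ! j" using * dist by (simp add: nth_eq_iff_index_eq)
  then have "c ! i = c ! (Suc j mod ?m)" "c ! (Suc i mod ?m) = c ! j"
    using *(3) by (auto simp: cyc_edge_def doubleton_eq_iff)
  then have i: "i = Suc j mod ?m" and j: "j = Suc i mod ?m"
    using * dist Suc_mod_less by (auto simp: nth_eq_iff_index_eq)
  have "?m = 2"
  proof (cases "Suc j < ?m")
    case True
    then have ij: "i = Suc j" using i by simp
    show ?thesis
    proof (cases "Suc i < ?m")
      case True
      then have "j = Suc i" using j mod_less[OF True] by metis
      then show ?thesis using ij by linarith
    next
      case False
      then have "Suc i = ?m" using * by simp
      then have "j = 0" using j by simp
      then show ?thesis using ij \<open>Suc i = ?m\<close> by simp
    qed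
  next
    case False
    then have "Suc j = ?m" using * by simp
    then have "i = 0" using i by simp
    then have "j = 1" using j len by simp
    then show ?thesis using \<open>Suc j = ?m\<close> by simp
  qed
  then show False using * by (auto simp: cyc_edge_def)
qed

lemma cyc_degree:
  assumes "v \<in> set c" shows "degree_in (cyc_graph c) v = 2"
proof -
  let ?m = "length c"
  from assms obtain j where j: "j < ?m" "v = c ! j" by (auto simp: in_set_conv_nth)
  \<comment> \<open>The cyclic predecessor of \<open>j\<close>: the edges at \<open>v\<close> have
    the indices \<open>j\<close> and \<open>k\<close>.\<close>
  define k where "k = (if j = 0 then ?m - 1 else j - 1)"
  have k: "k < ?m" "Suc k mod ?m = j" "k \<noteq> j" using j len by (auto simp: k_def)
  have "v \<in> fst (cyc_edge c i) \<longleftrightarrow> i \<in> {j, k}" if "i < ?m" for i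
  proof -
    have "v \<in> fst (cyc_edge c i) \<longleftrightarrow> i = j \<or> Suc i mod ?m = j"
      using that j dist Suc_mod_less[of i] by (auto simp: cyc_edge_def nth_eq_iff_index_eq)
    moreover have "Suc i mod ?m = j \<longleftrightarrow> i = k"
    proof
      assume a: "Suc i mod ?m = j"
      show "i = k"
      proof (cases "Suc i < ?m")
        case True
        then show ?thesis using a by (auto simp: k_def)
      next
        case False
        then have "Suc i = ?m" using that by simp
        then show ?thesis using a by (auto simp: k_def)
      qed
    qed (use k in simp)
    ultimately show ?thesis by auto
  qed
  then have "{e \<in> cyc_edge c ` {..<?m}. v \<in> fst e} = cyc_edge c ` {j, k}"
    using j k by auto
  then have "degree_in (cyc_graph c) v = card (cyc_edge c ` {j, k})" by (simp add: degree_in_def)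
  also have "\<dots> = card {j, k}" using inj_cyc_edge j k by (intro card_image) (auto simp: inj_on_def)
  finally show ?thesis using k by simp
qed

lemma cyc_connected: "connected_mgraph (cyc_graph c)"
proof -
  let ?r = "{(a, b). \<exists>e\<in>edges (cyc_graph c). fst e = {a, b}}"
  have sym: "(b, a) \<in> ?r" if "(a, b) \<in> ?r" for a b using that by (auto simp: insert_commute)
  have step: "(c ! i, c ! Suc i) \<in> ?r" if "Suc i < length c" for i
    using that by (auto simp: cyc_edge_def intro!: bexI[of _ i])
  have up: "(c ! 0, c ! i) \<in> ?r\<^sup>*" if "i < length c" for i
    using that
  proof (induction i)
    case (Suc i)
    then show ?case using step[of i] by (meson Suc_lessD rtrancl.rtrancl_into_rtrancl)
  qed simp
  have "sym (?r\<^sup>*)" using sym by (intro sym_rtrancl symI)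
  then have "(c ! i, c ! j) \<in> ?r\<^sup>*" if "i < length c" "j < length c" for i j
    using up[OF that(1)] up[OF that(2)] by (meson rtrancl_trans symD)
  then have "(u, v) \<in> ?r\<^sup>*" if "u \<in> set c" "v \<in> set c" for u v
    using that unfolding in_set_conv_nth by blast
  then show ?thesis unfolding connected_mgraph_def cyc_graph_simps(1) by blast
qed

lemma cyc_is_cycle:
  assumes "set c \<subseteq> V" "length c = 2 \<Longrightarrow> set c \<in> \<T>"
  shows "is_cycle V \<T> (cyc_graph c)"
proof -
  have "cyc_edge c i \<in> dup_edges V \<T>" if i: "i < length c" for i
  proof -
    have "i \<noteq> Suc i mod length c" using i len by (cases "Suc i < length c") (auto simp: not_less_eq less_Suc_eq)
    then have card: "card {c ! i, c ! (Suc i mod length c)} = 2"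
      using i dist Suc_mod_less by (simp add: nth_eq_iff_index_eq card_insert_if)
    have sub: "{c ! i, c ! (Suc i mod length c)} \<subseteq> set c" using i Suc_mod_less by auto
    show ?thesis
    proof (cases "length c = 2 \<and> i = 1")
      case True
      then obtain a b where "c = [a, b]" by (auto simp: length_Suc_conv numeral_2_eq_2)
      then have "{c ! i, c ! (Suc i mod length c)} = set c" using True by auto
      then show ?thesis using True assms(2) card by (auto simp: cyc_edge_def dup_edges_def)
    next
      case False
      then show ?thesis using sub card assms(1) by (auto simp: cyc_edge_def dup_edges_def complete_edges_def)
    qed
  qed
  then have "is_subgraph V \<T> (cyc_graph c)"
    unfolding is_subgraph_def using assms(1) Suc_mod_less by (auto simp: cyc_edge_def)
  then show ?thesis unfolding is_cycle_def using cyc_connected cyc_degree len by auto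
qed

lemma cyc_cost: "(\<Sum>e\<in>edges (cyc_graph c). w (fst e)) = (\<Sum>i<length c. w {c ! i, c ! (Suc i mod length c)})"
  unfolding cyc_graph_simps by (subst sum.reindex[OF inj_cyc_edge]) (simp add: cyc_edge_def)

end

fun path_cost :: "('v set \<Rightarrow> nat) \<Rightarrow> 'v list \<Rightarrow> nat" where
  "path_cost w (x # y # zs) = w {x, y} + path_cost w (y # zs)"
| "path_cost w _ = 0"

lemma path_cost_append:
  "A \<noteq> [] \<Longrightarrow> B \<noteq> [] \<Longrightarrow> path_cost w (A @ B) = path_cost w A + path_cost w B + w {last A, hd B}"
proof (induction w A rule: path_cost.induct)
  case ("2_2" w x)
  then show ?case by (cases B) auto
qed auto

lemma path_cost_sum: "path_cost w c = (\<Sum>i<length c - 1. w {c ! i, c ! Suc i})"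
proof (induction w c rule: path_cost.induct)
  case (1 w x y zs)
  then show ?case by (simp add: sum.lessThan_Suc_shift del: sum.lessThan_Suc)
qed auto

lemma cyc_sum_path_cost:
  assumes "2 \<le> length c"
  shows "(\<Sum>i<length c. w {c ! i, c ! (Suc i mod length c)}) = path_cost w c + w {last c, hd c}"
proof -
  from assms obtain m where m: "length c = Suc m" "m \<ge> 1" by (cases "length c") auto
  have "c \<noteq> []" using assms by auto
  then have "c ! m = last c" "c ! 0 = hd c" using m by (auto simp: last_conv_nth hd_conv_nth)
  then show ?thesis using m by (simp add: path_cost_sum)
qed

lemma path_cost_successively:
  assumes "\<And>u v. adj u v \<Longrightarrow> w {u, v} = 1" "successively adj c"
  shows "path_cost w c = length c - 1"
  using assms by (induction w c rule: path_cost.induct) auto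

definition valid_state :: "('v \<Rightarrow> 'v \<Rightarrow> bool) \<Rightarrow> 'v set set \<Rightarrow> 'v set \<Rightarrow> 'v state \<Rightarrow> bool" where
  "valid_state adj \<T> U S \<longleftrightarrow>
     (\<forall>P\<in>#fst S. P \<noteq> [] \<and> successively adj P) \<and>
     (\<forall>C\<in>#snd S. C \<noteq> [] \<and> successively adj C \<and> adj (last C) (hd C) \<and> closed_wrt \<T> (set C)) \<and>
     (\<Sum>P\<in>#fst S. mset P) + (\<Sum>C\<in>#snd S. mset C) = mset_set U"

lemma move_vertices:
  "move adj \<T> S S' \<Longrightarrow> (\<Sum>P\<in>#fst S'. mset P) + (\<Sum>C\<in>#snd S'. mset C) =
    (\<Sum>P\<in>#fst S. mset P) + (\<Sum>C\<in>#snd S. mset C)"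
  by (induction rule: move.induct) (simp_all add: ac_simps)

lemma valid_state_move:
  assumes sym: "\<And>u v. adj u v \<Longrightarrow> adj v u" and mv: "move adj \<T> S S'" and v: "valid_state adj \<T> U S"
  shows "valid_state adj \<T> U S'"
proof -
  have "(\<forall>P\<in>#fst S'. P \<noteq> [] \<and> successively adj P) \<and>
     (\<forall>C\<in>#snd S'. C \<noteq> [] \<and> successively adj C \<and> adj (last C) (hd C) \<and> closed_wrt \<T> (set C))"
    using mv v[unfolded valid_state_def, THEN conjunct1] v[unfolded valid_state_def, THEN conjunct2, THEN conjunct1]
  proof (induction rule: move.induct)
    case (reverse P R C)
    have "successively (\<lambda>x y. adj y x) P" if "successively adj P" using that
      by (rule successively_mono) (auto intro: sym)
    with reverse show ?case by (auto simp: successively_rev)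
  next
    case (unclose A B R C)
    then have "successively adj (A @ B)" "adj (last (A @ B)) (hd (A @ B))" by auto
    then have "successively adj (B @ A)"
      by (cases "A = []"; cases "B = []") (auto simp: successively_append_iff)
    with unclose show ?case by auto
  qed (auto simp: successively_append_iff)
  then show ?thesis using v move_vertices[OF mv] by (auto simp: valid_state_def)
qed

lemma valid_state_reach:
  assumes "\<And>u v. adj u v \<Longrightarrow> adj v u"
  shows "reach adj \<T> n S S' \<Longrightarrow> valid_state adj \<T> U S \<Longrightarrow> valid_state adj \<T> U S'"
proof (induction n arbitrary: S')
  case (Suc n)
  then obtain S1 where "reach adj \<T> n S S1" "move adj \<T> S1 S'" by auto
  then show ?case using Suc.IH[OF _ Suc.prems(2)] valid_state_move[of adj \<T> S1 S' U] assms by blast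
qed simp

section \<open>Comparison with an arbitrary solution\<close>

locale instance_12 =
  fixes V :: "'v set" and w :: "'v set \<Rightarrow> nat" and \<T> :: "'v set set" and adj :: "'v \<Rightarrow> 'v \<Rightarrow> bool"
  assumes inst: "smc_instance V \<T>"
    and weights: "\<And>e. e \<in> complete_edges V \<Longrightarrow> w e \<in> {1, 2}"
    and adj_iff: "adj u v \<longleftrightarrow> u \<in> V \<and> v \<in> V \<and> u \<noteq> v \<and> w {u, v} = 1"
begin

lemma adj_symD: "adj u v \<Longrightarrow> adj v u"
  by (auto simp: adj_iff insert_commute)

lemma finite_V: "finite V" and terminals_sub: "\<Union>\<T> \<subseteq> V" and finite_terminals: "finite (\<Union>\<T>)"
proof -
  show "finite V" "\<Union>\<T> \<subseteq> V" using inst by (auto simp: smc_instance_def)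
  then show "finite (\<Union>\<T>)" by (rule rev_finite_subset)
qed

lemma terminal_card: "T \<in> \<T> \<Longrightarrow> 2 \<le> card T"
  using inst by (auto simp: smc_instance_def)

lemma singleton_not_closed: "x \<in> \<Union>\<T> \<Longrightarrow> \<not> closed_wrt \<T> {x}"
proof
  assume "x \<in> \<Union>\<T>" "closed_wrt \<T> {x}"
  then obtain T where "T \<in> \<T>" "T \<subseteq> {x}" by (auto simp: closed_wrt_def)
  then show False using terminal_card[of T] card_mono[of "{x}" T] by simp
qed

context
  fixes \<C> :: "'v mgraph set"
  assumes dc: "disjoint_cycles V \<T> \<C>" and rt: "respects_terminals \<T> \<C>"
begin

definition "all_edges = (\<Union>C\<in>\<C>. edges C)"

definition "good_edges = {e \<in> all_edges. w (fst e) = 1 \<and> fst e \<subseteq> \<Union>\<T>}"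

lemma cycle_in: "C \<in> \<C> \<Longrightarrow> is_cycle V \<T> C" and cyc_disj: "C \<in> \<C> \<Longrightarrow> D \<in> \<C> \<Longrightarrow> x \<in> verts C \<Longrightarrow> x \<in> verts D \<Longrightarrow> C = D"
  using dc unfolding disjoint_cycles_def by auto

lemma edge_props: "C \<in> \<C> \<Longrightarrow> e \<in> edges C \<Longrightarrow> fst e \<subseteq> verts C \<and> fst e \<in> complete_edges V \<and> e \<in> Pow V \<times> UNIV"
  using cycle_in[of C] inst unfolding is_cycle_def is_subgraph_def dup_edges_def complete_edges_def smc_instance_def
  by fastforce

lemma finite_all_edges: "finite all_edges"
proof -
  have "all_edges \<subseteq> Pow V \<times> UNIV" using edge_props unfolding all_edges_def by blast
  then show ?thesis by (rule finite_subset) (use finite_V in simp)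
qed

lemma edges_at: "C \<in> \<C> \<Longrightarrow> v \<in> verts C \<Longrightarrow> {e \<in> all_edges. v \<in> fst e} = {e \<in> edges C. v \<in> fst e}"
  using edge_props cyc_disj unfolding all_edges_def by blast

lemma degree_all: "v \<in> \<Union>\<T> \<Longrightarrow> card {e \<in> all_edges. v \<in> fst e} = 2"
proof -
  assume "v \<in> \<Union>\<T>"
  then obtain C where C: "C \<in> \<C>" "v \<in> verts C" using rt unfolding respects_terminals_def by blast
  then have "degree_in C v = 2" using cycle_in[of C] by (auto simp: is_cycle_def)
  then show ?thesis using edges_at[OF C] by (simp add: degree_in_def)
qed

lemma cost_eq: "cost w \<C> = (\<Sum>e\<in>all_edges. w (fst e))"
proof -
  have "finite (edges C)" if "C \<in> \<C>" for C
    using finite_all_edges that by (auto simp: all_edges_def intro: finite_subset)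
  moreover have "edges C \<inter> edges D = {}" if CD: "C \<in> \<C>" "D \<in> \<C>" "C \<noteq> D" for C D
  proof (rule ccontr)
    assume "edges C \<inter> edges D \<noteq> {}"
    then obtain e where e: "e \<in> edges C" "e \<in> edges D" by auto
    have "fst e \<noteq> {}" using edge_props[OF CD(1) e(1)] by (auto simp: complete_edges_def)
    then show False using edge_props[OF CD(1) e(1)] edge_props[OF CD(2) e(2)] cyc_disj CD by blast
  qed
  moreover have "finite \<C>"
  proof (rule finite_imageD)
    show "finite (verts ` \<C>)"
    proof (rule finite_subset)
      show "verts ` \<C> \<subseteq> Pow V" using cycle_in unfolding is_cycle_def is_subgraph_def by blast
    qed (use finite_V in simp)
    show "inj_on verts \<C>"
    proof (rule inj_onI)
      fix C D assume CD: "C \<in> \<C>" "D \<in> \<C>" "verts C = verts D"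
      then obtain x where "x \<in> verts C" using cycle_in unfolding is_cycle_def by blast
      then show "C = D" using cyc_disj CD by blast
    qed
  qed
  ultimately show ?thesis unfolding cost_def all_edges_def by (intro sum.UNION_disjoint[symmetric]) auto
qed

lemma good_degree: "{e \<in> good_edges. v \<in> fst e} \<subseteq> {e \<in> all_edges. v \<in> fst e}"
  by (auto simp: good_edges_def)

text \<open>Count the pairs of a terminal and an edge of the solution at it. Every edge contributes
  its number of terminal ends, and once more if it is not good. This is at most twice its weight: a
  good edge counts 2, any other edge of weight 1 has at most one terminal end, and an edge of weight
  2 counts at most 4.\<close>

lemma deficit_bound:
  "(\<Sum>v\<in>\<Union>\<T>. 2 - card {e \<in> good_edges. v \<in> fst e}) + 2 * card (\<Union>\<T>) \<le> 2 * cost w \<C>"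
proof -
  let ?U = "\<Union>\<T>"
  have count: "(\<Sum>v\<in>?U. card {e \<in> X. v \<in> fst e}) = (\<Sum>e\<in>X. card (fst e \<inter> ?U))" if "finite X" for X :: "('v set \<times> bool) set"
  proof -
    have "(\<Sum>v\<in>?U. card {e \<in> X. v \<in> fst e}) = (\<Sum>v\<in>?U. \<Sum>e\<in>X. if v \<in> fst e then 1 else 0)"
      using that by (simp add: sum.If_cases Collect_conj_eq Int_commute)
    also have "\<dots> = (\<Sum>e\<in>X. \<Sum>v\<in>?U. if v \<in> fst e then 1 else 0)" by (rule sum.swap)
    also have "\<dots> = (\<Sum>e\<in>X. card (fst e \<inter> ?U))"
      using finite_terminals by (simp add: sum.If_cases Int_commute)
    finally show ?thesis .
  qed
  have "2 - card {e \<in> good_edges. v \<in> fst e} = card {e \<in> all_edges - good_edges. v \<in> fst e}" if "v \<in> ?U" for v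
  proof -
    have "{e \<in> all_edges - good_edges. v \<in> fst e} = {e \<in> all_edges. v \<in> fst e} - {e \<in> good_edges. v \<in> fst e}" by auto
    then show ?thesis using degree_all[OF that] finite_all_edges good_degree[of v]
      by (simp add: card_Diff_subset finite_subset)
  qed
  then have "(\<Sum>v\<in>?U. 2 - card {e \<in> good_edges. v \<in> fst e}) = (\<Sum>e\<in>all_edges - good_edges. card (fst e \<inter> ?U))"
    using count[of "all_edges - good_edges"] finite_all_edges by simp
  also have "\<dots> = (\<Sum>e\<in>all_edges. if e \<in> good_edges then 0 else card (fst e \<inter> ?U))"
    using finite_all_edges by (intro sum.mono_neutral_cong_left) auto
  finally have 1: "(\<Sum>v\<in>?U. 2 - card {e \<in> good_edges. v \<in> fst e}) = (\<Sum>e\<in>all_edges. if e \<in> good_edges then 0 else card (fst e \<inter> ?U))" .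
  have "2 * card ?U = (\<Sum>v\<in>?U. card {e \<in> all_edges. v \<in> fst e})" using degree_all by simp
  also have "\<dots> = (\<Sum>e\<in>all_edges. card (fst e \<inter> ?U))" by (rule count[OF finite_all_edges])
  finally have "(\<Sum>v\<in>?U. 2 - card {e \<in> good_edges. v \<in> fst e}) + 2 * card ?U =
      (\<Sum>e\<in>all_edges. (if e \<in> good_edges then 0 else card (fst e \<inter> ?U)) + card (fst e \<inter> ?U))"
    using 1 by (simp add: sum.distrib)
  also have "\<dots> \<le> (\<Sum>e\<in>all_edges. 2 * w (fst e))"
  proof (rule sum_mono)
    fix e assume e: "e \<in> all_edges"
    then have ce: "fst e \<in> complete_edges V" using edge_props unfolding all_edges_def by blast
    then have c2: "card (fst e) = 2" by (simp add: complete_edges_def)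
    then have fe: "finite (fst e)" using card_gt_0_iff[of "fst e"] by simp
    have le: "card (fst e \<inter> ?U) \<le> 2" using card_mono[OF fe, of "fst e \<inter> ?U"] c2 by simp
    show "(if e \<in> good_edges then 0 else card (fst e \<inter> ?U)) + card (fst e \<inter> ?U) \<le> 2 * w (fst e)"
    proof (cases "w (fst e) = 1 \<and> \<not> fst e \<subseteq> ?U")
      case True
      then have "fst e \<inter> ?U \<subset> fst e" by auto
      then have "card (fst e \<inter> ?U) < 2" using psubset_card_mono[OF fe] c2 by metis
      then show ?thesis using True by auto
    next
      case False
      then show ?thesis using weights[OF ce] le e by (auto simp: good_edges_def)
    qed
  qed
  also have "\<dots> = 2 * cost w \<C>" by (simp add: cost_eq sum_distrib_left)
  finally show ?thesis .
qed

text \<open>All edges of the solution at \<open>X\<close> are good and stay inside, so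
  \<open>X\<close> contains every cycle that it meets; and the cycles respect the terminal
  sets.\<close>

lemma good_closed:
  assumes "X \<subseteq> \<Union>\<T>"
    "\<And>v. v \<in> X \<Longrightarrow> card {e \<in> good_edges. v \<in> fst e} = 2 \<and> (\<forall>e\<in>good_edges. v \<in> fst e \<longrightarrow> fst e \<subseteq> X)"
  shows "closed_wrt \<T> X"
  unfolding closed_wrt_def
proof (intro ballI)
  fix T assume T: "T \<in> \<T>"
  show "T \<subseteq> X \<or> T \<inter> X = {}"
  proof (cases "T \<inter> X = {}")
    case False
    then obtain x where x: "x \<in> T" "x \<in> X" by auto
    obtain C where C: "C \<in> \<C>" "x \<in> verts C" using rt T x unfolding respects_terminals_def by blast
    have "T \<subseteq> verts C" using rt C T x unfolding respects_terminals_def cycle_respects_def by blast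
    \<comment> \<open>The good edges at \<open>v\<close> are already as many as all edges of the
      solution at \<open>v\<close>, so a walk along a cycle cannot leave \<open>X\<close>.\<close>
    have stay: "fst e \<subseteq> X" if "v \<in> X" "e \<in> all_edges" "v \<in> fst e" for v e
    proof -
      have "{e \<in> good_edges. v \<in> fst e} = {e \<in> all_edges. v \<in> fst e}"
        using good_degree[of v] assms(2)[OF that(1)] degree_all[OF subsetD[OF assms(1) that(1)]] finite_all_edges
        by (intro card_subset_eq) auto
      then show ?thesis using assms(2)[OF that(1)] that by blast
    qed
    have "v \<in> X" if "v \<in> verts C" for v
    proof -
      have "(x, v) \<in> {(a, b). \<exists>e\<in>edges C. fst e = {a, b}}\<^sup>*"
        using cycle_in[OF C(1)] C(2) that by (auto simp: is_cycle_def connected_mgraph_def)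
      then show ?thesis
      proof (induction rule: rtrancl_induct)
        case (step y z)
        then obtain e where "e \<in> edges C" "fst e = {y, z}" by auto
        then show ?case using stay[OF step.IH, of e] C(1) by (auto simp: all_edges_def)
      qed (use x in simp)
    qed
    then show ?thesis using \<open>T \<subseteq> verts C\<close> by blast
  qed simp
qed

lemma local_optimum_bound:
  assumes "valid_state adj \<T> (\<Union>\<T>) (Ps, Cs)" "local_opt adj \<T> (Ps, Cs)"
  shows "9 * (card (\<Union>\<T>) + size Ps) \<le> 11 * cost w \<C>"
proof -
  interpret local_optimum adj \<T> "\<Union>\<T>" Ps Cs good_edges
  proof
    show "closed_wrt \<T> X" if "X \<subseteq> \<Union>\<T>"
      "\<And>v. v \<in> X \<Longrightarrow> card {e \<in> good_edges. v \<in> fst e} = 2 \<and> (\<forall>e\<in>good_edges. v \<in> fst e \<longrightarrow> fst e \<subseteq> X)" for X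
      using good_closed[OF that] .
    show "\<exists>u v. fst e = {u, v} \<and> u \<in> \<Union>\<T> \<and> v \<in> \<Union>\<T> \<and> adj u v" if e: "e \<in> good_edges" for e
    proof -
      have ce: "fst e \<in> complete_edges V" using e edge_props unfolding good_edges_def all_edges_def by blast
      then obtain u v where uv: "fst e = {u, v}" "u \<noteq> v" by (auto simp: complete_edges_def card_2_iff)
      then show ?thesis using e ce by (intro exI[of _ u] exI[of _ v]) (auto simp: good_edges_def adj_iff complete_edges_def)
    qed
    show "card {e \<in> good_edges. v \<in> fst e} \<le> 2" if "v \<in> \<Union>\<T>" for v
      using card_mono[OF _ good_degree[of v]] finite_all_edges degree_all[OF that] by simp
    show "finite good_edges" using finite_all_edges by (simp add: good_edges_def)
    show "adj v u" if "adj u v" for u v using adj_symD[OF that] .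
    show "\<not> adj u u" for u by (simp add: adj_iff)
    show "finite (\<Union>\<T>)" by (rule finite_terminals)
    show "\<not> closed_wrt \<T> {x}" if "x \<in> \<Union>\<T>" for x by (rule singleton_not_closed[OF that])
    show "(\<Sum>P\<in>#Ps. mset P) + (\<Sum>C\<in>#Cs. mset C) = mset_set (\<Union>\<T>)"
      using assms(1) by (simp add: valid_state_def)
    show "P \<noteq> []" if "P \<in># Ps" for P using assms(1) that by (simp add: valid_state_def)
    show "local_opt adj \<T> (Ps, Cs)" by (rule assms(2))
  qed
  obtain d where "18 * size Ps \<le> 4 * card (\<Union>\<T>) + 7 * d" "d + 2 * card (\<Union>\<T>) \<le> 2 * cost w \<C>"
    using path_bound deficit_bound by blast
  \<comment> \<open>With \<open>t\<close> terminals, \<open>p\<close> paths and cost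
    \<open>c\<close>: eliminating \<open>d\<close> gives \<open>9 * p \<le> 7 * c - 5 * t\<close>,
    hence \<open>9 * (t + p) \<le> 7 * c + 4 * t\<close>, and the second bound contains
    \<open>t \<le> c\<close>.\<close>
  then show ?thesis by simp
qed

end


text \<open>A closed set contains the whole terminal set of each of its terminals. With two vertices
  it equals this set, so the parallel edge needed for a cycle of length 2 exists.\<close>

lemma closed_length:
  assumes "distinct c" "c \<noteq> []" "set c \<subseteq> \<Union>\<T>" "closed_wrt \<T> (set c)"
  shows "2 \<le> length c \<and> (length c = 2 \<longrightarrow> set c \<in> \<T>)"
proof -
  from assms(2,3) obtain T where T: "T \<in> \<T>" "hd c \<in> T" by (meson UnionE hd_in_set subsetD)
  then have sub: "T \<subseteq> set c" using assms(2,4) unfolding closed_wrt_def by (metis disjoint_iff hd_in_set)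
  have "card T \<le> length c" using card_mono[OF _ sub] distinct_card[OF assms(1)] by simp
  then have "2 \<le> length c" using terminal_card[OF T(1)] by simp
  moreover have "T = set c" if "length c = 2"
    using that sub terminal_card[OF T(1)] distinct_card[OF assms(1)] \<open>card T \<le> length c\<close> by (intro card_subset_eq) auto
  ultimately show ?thesis using T by auto
qed

end

section \<open>Cost of the constructed solution\<close>

definition out_cycles :: "'v list list \<Rightarrow> 'v list list \<Rightarrow> 'v list list" where
  "out_cycles ps cs = (if ps = [] then cs else concat ps # cs)"

lemma mset_concat_sum: "mset (concat xs) = (\<Sum>P\<in>#mset xs. mset P)"
  by (induction xs) auto

text \<open>With \<open>n\<close> vertices in \<open>k\<close> paths, the paths cost
  \<open>n - k\<close> and the \<open>k - 1\<close> joints at most 2 each. The 2 on the left is kept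
  in reserve for the closing edge.\<close>

lemma path_cost_concat:
  assumes "\<And>e. w e \<le> 2 \<or> \<not> e \<subseteq> V" "\<forall>P\<in>set ps. P \<noteq> [] \<and> path_cost w P = length P - 1 \<and> set P \<subseteq> V" "ps \<noteq> []"
  shows "path_cost w (concat ps) + 2 \<le> length (concat ps) + length ps \<and> concat ps \<noteq> []"
  using assms(3,2)
proof (induction ps rule: list_nonempty_induct)
  case (single P)
  then show ?case by (auto simp: Suc_le_eq)
next
  case (cons P ps)
  then have IH: "path_cost w (concat ps) + 2 \<le> length (concat ps) + length ps" "concat ps \<noteq> []" by auto
  have P: "P \<noteq> []" "path_cost w P = length P - 1" "length P \<ge> 1" using cons by (auto simp: Suc_le_eq)
  have "hd (concat ps) \<in> set (concat ps)" using IH(2) by (rule hd_in_set)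
  then have "hd (concat ps) \<in> V" using cons by auto
  then have "{last P, hd (concat ps)} \<subseteq> V" using cons P last_in_set[OF P(1)] by auto
  then have "w {last P, hd (concat ps)} \<le> 2" using assms(1) by blast
  then show ?case using IH P path_cost_append[OF P(1) IH(2), of w] by auto
qed

lemma out_cycles_props:
  fixes V :: "nat set"
  assumes "instance_12 V w \<T> adj" "valid_state adj \<T> (\<Union>\<T>) (mset ps, mset cs)"
  shows "distinct (concat (out_cycles ps cs))" "set (concat (out_cycles ps cs)) = \<Union>\<T>"
    "\<And>c. c \<in> set (out_cycles ps cs) \<Longrightarrow>
      c \<noteq> [] \<and> closed_wrt \<T> (set c) \<and> 2 \<le> length c \<and> (length c = 2 \<longrightarrow> set c \<in> \<T>)"
proof -
  interpret instance_12 V w \<T> adj by fact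
  let ?U = "\<Union>\<T>" and ?L = "out_cycles ps cs"
  have ps: "P \<noteq> []" "successively adj P" if "P \<in> set ps" for P
    using assms(2) that by (auto simp: valid_state_def)
  have cs: "c \<noteq> []" "successively adj c" "adj (last c) (hd c)" "closed_wrt \<T> (set c)" if "c \<in> set cs" for c
    using assms(2) that by (auto simp: valid_state_def)
  have tot: "mset (concat ps) + mset (concat cs) = mset_set ?U"
    using assms(2) unfolding valid_state_def mset_concat_sum by simp
  then have "mset (concat ps @ concat cs) = mset_set ?U" by simp
  then have dU: "distinct (concat ps @ concat cs)" "set (concat ps @ concat cs) = ?U"
    using finite_terminals by (metis distinct_sorted_list_of_set mset_eq_imp_distinct_iff mset_sorted_list_of_multiset sorted_list_of_mset_set,
      metis finite_set_mset_mset_set set_mset_mset)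
  have conc: "concat ?L = concat ps @ concat cs" by (simp add: out_cycles_def)
  have ne: "c \<noteq> []" if "c \<in> set ?L" for c
    using that ps cs by (cases ps) (auto simp: out_cycles_def split: if_splits)
  have dL: "distinct (concat ?L)" "set (concat ?L) = ?U" using dU conc by auto
  have c_dist: "distinct c" "set c \<subseteq> ?U" if "c \<in> set ?L" for c
    using that dL by (auto simp: distinct_concat_iff)
  \<comment> \<open>The cycles and the paths partition the terminals. A terminal set not contained
    in any of the closed cycles is disjoint from all of them, so the merged cycle is closed as
    well.\<close>
  have closed: "closed_wrt \<T> (set c)" if c: "c \<in> set ?L" for c
  proof (cases "c \<in> set cs")
    case False
    with c have ceq: "c = concat ps" by (auto simp: out_cycles_def split: if_splits)
    show ?thesis unfolding closed_wrt_def
    proof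
      fix T assume T: "T \<in> \<T>"
      show "T \<subseteq> set c \<or> T \<inter> set c = {}"
      proof (rule ccontr)
        assume "\<not> ?thesis"
        then obtain x y where xy: "x \<in> T" "x \<notin> set c" "y \<in> T" "y \<in> set c" by auto
        then have "x \<in> set (concat cs)" using dU(2) T ceq by auto
        then obtain d where d: "d \<in> set cs" "x \<in> set d" by auto
        then have "T \<subseteq> set d" using cs(4)[OF d(1)] T xy by (auto simp: closed_wrt_def)
        then have "y \<in> set (concat cs)" using xy d by auto
        then show False using dU(1) xy ceq by auto
      qed
    qed
  qed (use cs in blast)
  have len: "2 \<le> length c" "length c = 2 \<Longrightarrow> set c \<in> \<T>" if "c \<in> set ?L" for c
    using closed_length[OF c_dist(1)[OF that] ne[OF that] c_dist(2)[OF that] closed[OF that]] by auto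
  show "distinct (concat ?L)" "set (concat ?L) = \<Union>\<T>" using dL by auto
  fix c assume c: "c \<in> set ?L"
  show "c \<noteq> [] \<and> closed_wrt \<T> (set c) \<and> 2 \<le> length c \<and> (length c = 2 \<longrightarrow> set c \<in> \<T>)"
    using ne[OF c] closed[OF c] len[OF c] by blast
qed

lemma out_cycles_length:
  fixes V :: "nat set"
  shows "instance_12 V w \<T> adj \<Longrightarrow> valid_state adj \<T> (\<Union>\<T>) (mset ps, mset cs) \<Longrightarrow>
    c \<in> set (out_cycles ps cs) \<Longrightarrow> 2 \<le> length c"
  using out_cycles_props(3) by blast

lemma output_solution:
  fixes V :: "nat set"
  assumes "instance_12 V w \<T> adj" "valid_state adj \<T> (\<Union>\<T>) (mset ps, mset cs)"
    "local_opt adj \<T> (mset ps, mset cs)"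
  shows "\<exists>\<C>. represents_cycles (enc_list enc_cycle (map (\<lambda>c. (c, cyc_edges c)) (out_cycles ps cs))) \<C> \<and>
    disjoint_cycles V \<T> \<C> \<and> respects_terminals \<T> \<C> \<and> real (cost w \<C>) \<le> 11 / 9 * real (opt V w \<T>)"
proof -
  interpret instance_12 V w \<T> adj by fact
  let ?U = "\<Union>\<T>" and ?L = "out_cycles ps cs"
  let ?C = "set (map cyc_graph ?L)"
  have ps: "P \<noteq> []" "successively adj P" if "P \<in> set ps" for P
    using assms(2) that by (auto simp: valid_state_def)
  have cs: "c \<noteq> []" "successively adj c" "adj (last c) (hd c)" if "c \<in> set cs" for c
    using assms(2) that by (auto simp: valid_state_def)
  have dL: "distinct (concat ?L)" "set (concat ?L) = ?U" using out_cycles_props[OF assms(1,2)] by auto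
  have dU: "distinct (concat ps @ concat cs)" "set (concat ps @ concat cs) = ?U"
    using dL by (auto simp: out_cycles_def split: if_splits)
  have c_dist: "distinct c" "set c \<subseteq> ?U" if "c \<in> set ?L" for c
    using that dL by (auto simp: distinct_concat_iff)
  have ne: "c \<noteq> []" and closed: "closed_wrt \<T> (set c)"
    and len: "2 \<le> length c" "length c = 2 \<Longrightarrow> set c \<in> \<T>" if "c \<in> set ?L" for c
    using out_cycles_props(3)[OF assms(1,2) that] by auto
  have distL: "distinct ?L" and disjL: "\<And>c d. c \<in> set ?L \<Longrightarrow> d \<in> set ?L \<Longrightarrow> c \<noteq> d \<Longrightarrow> set c \<inter> set d = {}"
  proof -
    have "removeAll [] ?L = ?L" using ne by (metis removeAll_id)
    then show "distinct ?L" using dL(1) unfolding distinct_concat_iff by simp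
    show "\<And>c d. c \<in> set ?L \<Longrightarrow> d \<in> set ?L \<Longrightarrow> c \<noteq> d \<Longrightarrow> set c \<inter> set d = {}"
      using dL(1) unfolding distinct_concat_iff by blast
  qed
  have inj: "inj_on cyc_graph (set ?L)"
  proof (rule inj_onI)
    fix c d assume cd: "c \<in> set ?L" "d \<in> set ?L" "cyc_graph c = cyc_graph d"
    then have "set c = set d" by (metis cyc_graph_simps(1))
    then show "c = d" using disjL[OF cd(1,2)] ne[OF cd(1)] by (metis inf.idem set_empty)
  qed
  have rep: "represents_cycles (enc_list enc_cycle (map (\<lambda>c. (c, cyc_edges c)) ?L)) ?C"
    unfolding represents_cycles_def
  proof (intro exI[of _ "map (\<lambda>c. (c, cyc_edges c)) ?L"] conjI refl)
    have m: "map cycle_of (map (\<lambda>c. (c, cyc_edges c)) ?L) = map cyc_graph ?L" by (simp add: cyc_graph_def)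
    show "distinct (map cycle_of (map (\<lambda>c. (c, cyc_edges c)) ?L))"
      unfolding m using distL inj by (simp add: distinct_map)
    show "set (map cycle_of (map (\<lambda>c. (c, cyc_edges c)) ?L)) = ?C" unfolding m ..
    have "distinct (map edge_of (cyc_edges c))" if "c \<in> set ?L" for c
      unfolding map_edge_of_cyc_edges using inj_cyc_edge[OF c_dist(1)[OF that] len(1)[OF that]]
      by (simp add: distinct_map atLeast0LessThan)
    then show "\<forall>(vs, es)\<in>set (map (\<lambda>c. (c, cyc_edges c)) ?L). distinct vs \<and> distinct (map edge_of es)"
      using c_dist(1) by auto
  qed
  have dc: "disjoint_cycles V \<T> ?C"
    unfolding disjoint_cycles_def
  proof (intro conjI ballI impI)
    fix C assume "C \<in> ?C"
    then obtain c where c: "c \<in> set ?L" "C = cyc_graph c" by auto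
    then show "is_cycle V \<T> C"
      using cyc_is_cycle[OF c_dist(1)[OF c(1)] len(1)[OF c(1)]] c_dist(2)[OF c(1)] len(2)[OF c(1)] terminals_sub by blast
  next
    fix C D assume "C \<in> ?C" "D \<in> ?C" "C \<noteq> D"
    then obtain c d where "c \<in> set ?L" "d \<in> set ?L" "c \<noteq> d" "C = cyc_graph c" "D = cyc_graph d" by auto
    then show "verts C \<inter> verts D = {}" using disjL by simp
  qed
  have rt: "respects_terminals \<T> ?C"
    unfolding respects_terminals_def
  proof (intro conjI ballI)
    fix C assume "C \<in> ?C"
    then obtain c where "c \<in> set ?L" "C = cyc_graph c" by auto
    then show "cycle_respects \<T> C" using closed[of c] by (simp add: cycle_respects_def closed_wrt_def)
  next
    fix T v assume "T \<in> \<T>" "v \<in> T"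
    then have "v \<in> set (concat ?L)" using dL(2) by auto
    then show "\<exists>C\<in>?C. v \<in> verts C" by auto
  qed
  have w1: "w {u, v} = 1" if "adj u v" for u v using that by (simp add: adj_iff)
  have w2: "w {u, v} \<le> 2" if "u \<in> ?U" "v \<in> ?U" "u \<noteq> v" for u v
  proof -
    have "u \<in> V" "v \<in> V" using that terminals_sub by blast+
    then show ?thesis using weights[of "{u, v}"] that(3) by (auto simp: complete_edges_def)
  qed
  \<comment> \<open>\<open>w\<close> is unspecified on sets that are not edges\<close>
  define w' where "w' e = (if card e = 2 then w e else 0)" for e
  have w'w: "w' {u, v} = w {u, v}" if "u \<noteq> v" for u v using that by (simp add: w'_def)
  have pc: "path_cost w' c = path_cost w c" if "distinct c" for c
    using that
  proof (induction c)
    case (Cons x c)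
    then show ?case by (cases c) (auto simp: w'w)
  qed simp
  have w'2: "w' e \<le> 2 \<or> \<not> e \<subseteq> ?U" for e
    using weights[of e] order_trans[OF _ terminals_sub, of e] by (auto simp: w'_def complete_edges_def)
  have cyc_c: "(\<Sum>e\<in>edges (cyc_graph c). w (fst e)) = path_cost w c + w {last c, hd c}" if "c \<in> set ?L" for c
    using trans[OF cyc_cost[OF c_dist(1)[OF that] len(1)[OF that]] cyc_sum_path_cost[OF len(1)[OF that]]] .
  have cs_cost: "path_cost w c + w {last c, hd c} = length c" if "c \<in> set cs" for c
    using cs[OF that] path_cost_successively[of adj w c, OF w1 cs(2)[OF that]] w1 by (cases c) auto
  have "cost w ?C = (\<Sum>c\<in>set ?L. \<Sum>e\<in>edges (cyc_graph c). w (fst e))"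
    unfolding cost_def set_map by (subst sum.reindex[OF inj]) simp
  also have "\<dots> = (\<Sum>c\<in>set ?L. path_cost w c + w {last c, hd c})" using cyc_c by (intro sum.cong) auto
  also have "\<dots> = (\<Sum>c\<leftarrow>?L. path_cost w c + w {last c, hd c})" using distL by (simp add: sum_list_distinct_conv_sum_set)
  also have "\<dots> \<le> length (concat ?L) + length ps"
  proof (cases "ps = []")
    case True
    then show ?thesis using cs_cost by (simp add: out_cycles_def length_concat cong: map_cong)
  next
    case False
    have "\<forall>P\<in>set ps. P \<noteq> [] \<and> path_cost w' P = length P - 1 \<and> set P \<subseteq> ?U"
    proof
      fix P assume P: "P \<in> set ps"
      have "distinct P" using dU(1) P by (auto simp: distinct_concat_iff)
      then show "P \<noteq> [] \<and> path_cost w' P = length P - 1 \<and> set P \<subseteq> ?U"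
        using ps[OF P] pc path_cost_successively[of adj w P, OF w1 ps(2)[OF P]] dU(2) P by auto
    qed
    from path_cost_concat[OF w'2 this False]
    have 1: "path_cost w' (concat ps) + 2 \<le> length (concat ps) + length ps" "concat ps \<noteq> []" by auto
    have in_L: "concat ps \<in> set ?L" using False by (simp add: out_cycles_def)
    have "last (concat ps) \<noteq> hd (concat ps)"
      using len(1)[OF in_L] c_dist(1)[OF in_L] by (cases "concat ps") (auto split: if_splits)
    moreover have "last (concat ps) \<in> ?U" "hd (concat ps) \<in> ?U"
      using c_dist(2)[OF in_L] 1(2) last_in_set hd_in_set by blast+
    ultimately have "w {last (concat ps), hd (concat ps)} \<le> 2" using w2 by blast
    then have "path_cost w (concat ps) + w {last (concat ps), hd (concat ps)} \<le> length (concat ps) + length ps"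
      using 1 pc[OF c_dist(1)[OF in_L]] by simp
    moreover have "(\<Sum>c\<leftarrow>cs. path_cost w c + w {last c, hd c}) = length (concat cs)"
      using cs_cost by (simp add: length_concat cong: map_cong)
    ultimately show ?thesis using False by (simp add: out_cycles_def)
  qed
  also have "length (concat ?L) = card ?U" using dL distinct_card[OF dL(1)] by simp
  finally have cost_le: "cost w ?C \<le> card ?U + length ps" .
  \<comment> \<open>The minimum in \<open>opt\<close> is attained: the set is finite, and the
    solution just built shows that it is nonempty.\<close>
  let ?S = "{cost w \<C> |\<C>. disjoint_cycles V \<T> \<C> \<and> respects_terminals \<T> \<C>}"
  have "?S = cost w ` {\<C>. disjoint_cycles V \<T> \<C> \<and> respects_terminals \<T> \<C>}" by auto
  then have "finite ?S" using finite_solutions[OF inst] by simp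
  moreover have "?S \<noteq> {}" using dc rt by blast
  ultimately have "opt V w \<T> \<in> ?S" unfolding opt_def by (rule Min_in)
  then obtain \<C> where "disjoint_cycles V \<T> \<C>" "respects_terminals \<T> \<C>" "opt V w \<T> = cost w \<C>" by blast
  from local_optimum_bound[OF this(1,2) assms(2,3)] this(3) cost_le
  have "9 * cost w ?C \<le> 11 * opt V w \<T>" by simp
  then have "real (9 * cost w ?C) \<le> real (11 * opt V w \<T>)" by (simp only: of_nat_le_iff)
  then have "real (cost w ?C) \<le> 11 / 9 * real (opt V w \<T>)" by simp
  with rep dc rt show ?thesis by blast
qed

section \<open>Polynomial-time WHILE programs\<close>

lemma poly_nat_mono: "m \<le> n \<Longrightarrow> poly p m \<le> poly p n" for p :: "nat poly"
  by (induction p) (auto intro!: add_mono mult_mono)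

definition poly_bounded :: "(nat \<Rightarrow> nat) \<Rightarrow> bool" where
  "poly_bounded B \<longleftrightarrow> (\<exists>p. \<forall>n. B n \<le> poly p n)"

lemma poly_boundedI: "(\<And>n. B n \<le> poly p n) \<Longrightarrow> poly_bounded B"
  by (auto simp: poly_bounded_def)

lemma poly_bounded_poly: "poly_bounded (poly p)"
  by (rule poly_boundedI[of _ p]) simp

lemma poly_bounded_const: "poly_bounded (\<lambda>n. c)"
  by (rule poly_boundedI[of _ "[:c:]"]) simp

lemma poly_bounded_id: "poly_bounded (\<lambda>n. n)"
  by (rule poly_boundedI[of _ "[:0, 1:]"]) simp

lemma poly_bounded_add:
  assumes "poly_bounded f" "poly_bounded g" shows "poly_bounded (\<lambda>n. f n + g n)"
proof -
  from assms obtain p q where "\<And>n. f n \<le> poly p n" "\<And>n. g n \<le> poly q n" by (auto simp: poly_bounded_def)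
  then show ?thesis by (intro poly_boundedI[of _ "p + q"]) (simp add: add_mono)
qed

lemma poly_bounded_mult:
  assumes "poly_bounded f" "poly_bounded g" shows "poly_bounded (\<lambda>n. f n * g n)"
proof -
  from assms obtain p q where "\<And>n. f n \<le> poly p n" "\<And>n. g n \<le> poly q n" by (auto simp: poly_bounded_def)
  then show ?thesis by (intro poly_boundedI[of _ "p * q"]) (simp add: mult_mono)
qed

lemma poly_bounded_poly_comp:
  assumes "poly_bounded f" shows "poly_bounded (\<lambda>n. poly q (f n))"
proof -
  from assms obtain p where "\<And>n. f n \<le> poly p n" by (auto simp: poly_bounded_def)
  then show ?thesis by (intro poly_boundedI[of _ "q \<circ>\<^sub>p p"]) (simp add: poly_pcompose poly_nat_mono)
qed

lemma poly_bounded_Suc: "poly_bounded f \<Longrightarrow> poly_bounded (\<lambda>n. Suc (f n))"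
  using poly_bounded_add[OF _ poly_bounded_const[of 1]] by simp

lemmas poly_bounded_intros =
  poly_bounded_Suc poly_bounded_poly poly_bounded_const poly_bounded_id poly_bounded_add poly_bounded_mult poly_bounded_poly_comp

text \<open>Replaces the exact step count of \<open>exec\<close> by a budget, so that bounds can be
  weakened to polynomials.\<close>

definition runs :: "com \<Rightarrow> store \<Rightarrow> nat \<Rightarrow> store \<Rightarrow> bool" where
  "runs P s b s' \<longleftrightarrow> (\<exists>t. exec P s t s' \<and> t \<le> b)"

lemma runs_Assign: "1 + exp_time e \<le> b \<Longrightarrow> s' = s(x := eval_exp e s) \<Longrightarrow> runs (Assign x e) s b s'"
  unfolding runs_def using exec.Assign by blast

lemma runs_Seq: "runs P s a s1 \<Longrightarrow> runs Q s1 b s2 \<Longrightarrow> runs (Seq P Q) s (a + b) s2"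
  unfolding runs_def by (meson add_mono exec.Seq)

lemma runs_mono: "runs P s a s' \<Longrightarrow> a \<le> b \<Longrightarrow> runs P s b s'"
  unfolding runs_def by (meson order_trans)

lemma runs_CondTrue: "eval_exp e s \<noteq> Leaf \<Longrightarrow> runs P s b s' \<Longrightarrow> runs (Cond e P Q) s (1 + exp_time e + b) s'"
  unfolding runs_def by (meson add_left_mono exec.CondTrue)

lemma runs_CondFalse: "eval_exp e s = Leaf \<Longrightarrow> runs Q s b s' \<Longrightarrow> runs (Cond e P Q) s (1 + exp_time e + b) s'"
  unfolding runs_def by (meson add_left_mono exec.CondFalse)

lemma runs_WhileTrue:
  "eval_exp e s \<noteq> Leaf \<Longrightarrow> runs P s a s1 \<Longrightarrow> runs (While e P) s1 b s2 \<Longrightarrow>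
    runs (While e P) s (1 + exp_time e + a + b) s2"
  unfolding runs_def by (meson add_left_mono add_mono exec.WhileTrue)

lemma runs_WhileFalse: "eval_exp e s = Leaf \<Longrightarrow> runs (While e P) s (1 + exp_time e) s"
  unfolding runs_def using exec.WhileFalse by blast

text \<open>The size of the result is bounded separately, since a tree may have exponentially more nodes
  than steps were used to build it. Programs restore all variables but \<open>0\<close>, which makes them
  composable.\<close>

definition clean :: "nat \<Rightarrow> store \<Rightarrow> bool" where
  "clean N s \<longleftrightarrow> (\<forall>i. 0 < i \<longrightarrow> i < N \<longrightarrow> s i = Leaf)"

text \<open>Only variables below \<open>N\<close> have to be empty, and only variable 0 is changed.
  A caller may therefore keep data in positive variables from \<open>N\<close> on while
  \<open>P\<close> runs.\<close>

definition computes :: "com \<Rightarrow> nat \<Rightarrow> nat poly \<Rightarrow> ('a \<Rightarrow> tree) \<Rightarrow> ('b \<Rightarrow> tree) \<Rightarrow> ('a \<Rightarrow> 'b) \<Rightarrow> bool" where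
  "computes P N p ea eb f \<longleftrightarrow>
     (\<forall>x s. s 0 = ea x \<longrightarrow> clean N s \<longrightarrow> runs P s (poly p (size (ea x))) (s(0 := eb (f x)))) \<and>
     (\<forall>x. size (eb (f x)) \<le> poly p (size (ea x)))"

definition polytime :: "('a \<Rightarrow> tree) \<Rightarrow> ('b \<Rightarrow> tree) \<Rightarrow> ('a \<Rightarrow> 'b) \<Rightarrow> bool" where
  "polytime ea eb f \<longleftrightarrow> (\<exists>P N p. computes P N p ea eb f)"

lemma clean_mono: "clean N s \<Longrightarrow> M \<le> N \<Longrightarrow> clean M s"
  by (auto simp: clean_def)

lemma clean_upd: "clean N s \<Longrightarrow> i = 0 \<or> N \<le> i \<or> v = Leaf \<Longrightarrow> clean N (s(i := v))"
  by (auto simp: clean_def)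

lemma polytimeI:
  assumes "\<And>x s. s 0 = ea x \<Longrightarrow> clean N s \<Longrightarrow> runs P s (B (size (ea x))) (s(0 := eb (f x)))"
    "\<And>x. size (eb (f x)) \<le> B' (size (ea x))" "poly_bounded B" "poly_bounded B'"
  shows "polytime ea eb f"
proof -
  from assms(3,4) obtain p q where p: "\<And>n. B n \<le> poly p n" "\<And>n. B' n \<le> poly q n" by (auto simp: poly_bounded_def)
  have "computes P N (p + q) ea eb f"
    unfolding computes_def
  proof (intro conjI allI impI)
    fix x and s :: store assume "s 0 = ea x" "clean N s"
    from assms(1)[OF this] show "runs P s (poly (p + q) (size (ea x))) (s(0 := eb (f x)))"
      by (rule runs_mono) (use p(1)[of "size (ea x)"] in simp)
  next
    fix x show "size (eb (f x)) \<le> poly (p + q) (size (ea x))"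
      using assms(2)[of x] p(2)[of "size (ea x)"] by simp
  qed
  then show ?thesis unfolding polytime_def by blast
qed

lemma computes_runs: "computes P N p ea eb f \<Longrightarrow> s 0 = ea x \<Longrightarrow> clean N s \<Longrightarrow>
    runs P s (poly p (size (ea x))) (s(0 := eb (f x)))"
  by (simp add: computes_def)

lemma computes_size: "computes P N p ea eb f \<Longrightarrow> size (eb (f x)) \<le> poly p (size (ea x))"
  by (simp add: computes_def)

lemma polytime_cong_enc: "polytime ea eb f \<Longrightarrow> (\<And>x. eb (f x) = ec (g x)) \<Longrightarrow> polytime ea ec g"
  unfolding polytime_def computes_def by simp

lemma polytime_exp:
  assumes "\<And>x s. s 0 = ea x \<Longrightarrow> eval_exp e s = eb (f x)" "\<And>x. size (eb (f x)) \<le> B (size (ea x))" "poly_bounded B"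
  shows "polytime ea eb f"
proof (rule polytimeI[where P = "Assign 0 e" and N = 0 and B = "\<lambda>n. 1 + exp_time e"])
  fix x and s :: store assume "s 0 = ea x"
  with assms(1) show "runs (Assign 0 e) s (1 + exp_time e) (s(0 := eb (f x)))"
    by (intro runs_Assign) auto
qed (use assms in \<open>auto intro: poly_bounded_intros\<close>)

lemma polytime_id: "polytime ea ea (\<lambda>x. x)"
  by (rule polytime_exp[where e = "VarE 0" and B = "\<lambda>n. n"]) (auto intro: poly_bounded_intros)

primrec const_exp :: "tree \<Rightarrow> exp" where
  "const_exp Leaf = NilE"
| "const_exp (Node l r) = ConsE (const_exp l) (const_exp r)"

lemma eval_const_exp: "eval_exp (const_exp t) s = t"
  by (induction t) auto

lemma polytime_const: "polytime ea eb (\<lambda>x. c)"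
  by (rule polytime_exp[where e = "const_exp (eb c)" and B = "\<lambda>n. size (eb c)"])
    (auto simp: eval_const_exp intro: poly_bounded_intros)

lemma polytime_comp:
  assumes "polytime ea eb f" "polytime eb ec g" shows "polytime ea ec (\<lambda>x. g (f x))"
proof -
  from assms obtain P N p Q M q where P: "computes P N p ea eb f" and Q: "computes Q M q eb ec g"
    by (auto simp: polytime_def)
  show ?thesis
  proof (rule polytimeI[where P = "Seq P Q" and N = "max N M" and B = "\<lambda>n. poly p n + poly q (poly p n)" and
        B' = "\<lambda>n. poly q (poly p n)"])
    fix x and s :: store assume s: "s 0 = ea x" "clean (max N M) s"
    let ?s = "s(0 := eb (f x))"
    have "runs P s (poly p (size (ea x))) ?s"
      using P s clean_mono[OF s(2)] by (intro computes_runs) auto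
    moreover have "runs Q ?s (poly q (size (eb (f x)))) (?s(0 := ec (g (f x))))"
      using Q clean_mono[OF s(2), of M] by (intro computes_runs clean_upd) auto
    then have "runs Q ?s (poly q (poly p (size (ea x)))) (?s(0 := ec (g (f x))))"
      by (rule runs_mono) (intro poly_nat_mono computes_size[OF P])
    ultimately show "runs (Seq P Q) s (poly p (size (ea x)) + poly q (poly p (size (ea x)))) (s(0 := ec (g (f x))))"
      using runs_Seq by fastforce
  next
    fix x
    show "size (ec (g (f x))) \<le> poly q (poly p (size (ea x)))"
      using computes_size[OF Q, of "f x"] poly_nat_mono[OF computes_size[OF P, of x], of q] by linarith
  qed (auto intro!: poly_bounded_intros)
qed

section \<open>Closure of polynomial time under pairs, case distinctions and list recursion\<close>

definition enc_pair :: "('a \<Rightarrow> tree) \<Rightarrow> ('b \<Rightarrow> tree) \<Rightarrow> 'a \<times> 'b \<Rightarrow> tree" where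
  "enc_pair ea eb = (\<lambda>(x, y). Node (ea x) (eb y))"

lemma enc_pair_simp [simp]: "enc_pair ea eb (x, y) = Node (ea x) (eb y)"
  by (simp add: enc_pair_def)

lemma enc_pair_fst_snd: "enc_pair ea eb p = Node (ea (fst p)) (eb (snd p))"
  by (cases p) simp

lemma polytime_fst_raw: "polytime (enc_pair ea eb) ea fst"
  by (rule polytime_exp[where e = "HdE (VarE 0)" and B = "\<lambda>n. n"]) (auto simp: enc_pair_fst_snd intro: poly_bounded_intros)

lemma polytime_snd_raw: "polytime (enc_pair ea eb) eb snd"
  by (rule polytime_exp[where e = "TlE (VarE 0)" and B = "\<lambda>n. n"]) (auto simp: enc_pair_fst_snd intro: poly_bounded_intros)

lemma polytime_fst: "polytime ea (enc_pair eb ec) f \<Longrightarrow> polytime ea eb (\<lambda>x. fst (f x))"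
  by (rule polytime_comp[OF _ polytime_fst_raw])

lemma polytime_snd: "polytime ea (enc_pair eb ec) f \<Longrightarrow> polytime ea ec (\<lambda>x. snd (f x))"
  by (rule polytime_comp[OF _ polytime_snd_raw])

lemma polytime_pair:
  assumes "polytime ea eb f" "polytime ea ec g" shows "polytime ea (enc_pair eb ec) (\<lambda>x. (f x, g x))"
proof -
  from assms obtain P N p Q M q where P: "computes P N p ea eb f" and Q: "computes Q M q ea ec g"
    by (auto simp: polytime_def)
  \<comment> \<open>Beyond the variables of both programs: \<open>K\<close> keeps the input for
    \<open>Q\<close>, and the next variable keeps the result of \<open>P\<close>.\<close>
  define K where "K = Suc (max N M)"
  let ?P = "Seq (Assign K (VarE 0)) (Seq P (Seq (Assign (Suc K) (VarE 0)) (Seq (Assign 0 (VarE K)) (Seq Q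
    (Seq (Assign 0 (ConsE (VarE (Suc K)) (VarE 0))) (Seq (Assign K NilE) (Assign (Suc K) NilE)))))))"
  show ?thesis
  proof (rule polytimeI[where P = ?P and N = "Suc (Suc K)" and B = "\<lambda>n. poly p n + poly q n + 14" and
        B' = "\<lambda>n. poly p n + poly q n + 1"])
    fix x and s :: store assume s: "s 0 = ea x" "clean (Suc (Suc K)) s"
    have K: "0 < K" "N \<le> K" "M \<le> K" by (auto simp: K_def)
    have sK: "s K = Leaf" "s (Suc K) = Leaf" using s(2) K(1) by (auto simp: clean_def)
    let ?n = "size (ea x)"
    let ?s1 = "s(K := ea x)" and ?s2 = "s(K := ea x, 0 := eb (f x))"
    let ?s3 = "s(K := ea x, 0 := eb (f x), Suc K := eb (f x))"
    let ?s4 = "s(K := ea x, 0 := ea x, Suc K := eb (f x))"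
    let ?s5 = "s(K := ea x, 0 := ec (g x), Suc K := eb (f x))"
    have cN: "clean N s" "clean M s" using clean_mono[OF s(2)] K by auto
    have 1: "runs (Assign K (VarE 0)) s 2 ?s1" using s by (intro runs_Assign) auto
    have 2: "runs P ?s1 (poly p ?n) ?s2"
      using computes_runs[OF P, of ?s1 x] s K clean_upd[OF cN(1), of K] by auto
    have 3: "runs (Assign (Suc K) (VarE 0)) ?s2 2 ?s3" by (intro runs_Assign) auto
    have 4: "runs (Assign 0 (VarE K)) ?s3 2 ?s4" using K by (intro runs_Assign) (auto simp: fun_eq_iff)
    have 5: "runs Q ?s4 (poly q ?n) ?s5"
    proof -
      have "clean M ?s4" using cN(2) K by (intro clean_upd) auto
      moreover have "?s4 0 = ea x" using K by simp
      ultimately have "runs Q ?s4 (poly q ?n) (?s4(0 := ec (g x)))" using computes_runs[OF Q] by blast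
      moreover have "?s4(0 := ec (g x)) = ?s5" by (auto simp: fun_eq_iff)
      ultimately show ?thesis by simp
    qed
    let ?s6 = "s(K := ea x, 0 := Node (eb (f x)) (ec (g x)), Suc K := eb (f x))"
    have 6: "runs (Assign 0 (ConsE (VarE (Suc K)) (VarE 0))) ?s5 4 ?s6"
      using K by (intro runs_Assign) (auto simp: fun_eq_iff)
    have 7: "runs (Assign K NilE) ?s6 2 (?s6(K := Leaf))" by (intro runs_Assign) auto
    have 8: "runs (Assign (Suc K) NilE) (?s6(K := Leaf)) 2 (s(0 := enc_pair eb ec (f x, g x)))"
      using K sK by (intro runs_Assign) (auto simp: fun_eq_iff)
    have "runs ?P s (2 + (poly p ?n + (2 + (2 + (poly q ?n + (4 + (2 + 2)))))))
      (s(0 := enc_pair eb ec (f x, g x)))"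
      by (intro runs_Seq[OF 1] runs_Seq[OF 2] runs_Seq[OF 3] runs_Seq[OF 4] runs_Seq[OF 5] runs_Seq[OF 6]
          runs_Seq[OF 7] 8)
    then show "runs ?P s (poly p ?n + poly q ?n + 14) (s(0 := enc_pair eb ec (f x, g x)))"
      by (rule runs_mono) simp
  next
    fix x
    show "size (enc_pair eb ec (f x, g x)) \<le> poly p (size (ea x)) + poly q (size (ea x)) + 1"
      using computes_size[OF P, of x] computes_size[OF Q, of x] by simp
  qed (auto intro!: poly_bounded_intros)
qed

lemma polytime_if_raw:
  fixes ea :: "'a \<Rightarrow> tree"
  assumes "polytime ea ec f" "polytime ea ec g"
  shows "polytime (enc_pair enc_bool ea) ec (\<lambda>p. if fst p then f (snd p) else g (snd p))"
proof -
  from assms obtain P N p Q M q where P: "computes P N p ea ec f" and Q: "computes Q M q ea ec g"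
    by (auto simp: polytime_def)
  define K where "K = Suc (max N M)"
  have K: "0 < K" "N \<le> K" "M \<le> K" by (auto simp: K_def)
  let ?P = "Seq (Assign K (HdE (VarE 0))) (Seq (Assign 0 (TlE (VarE 0))) (Seq (Cond (VarE K) P Q) (Assign K NilE)))"
  show ?thesis
  proof (rule polytimeI[where P = ?P and N = "Suc K" and B = "\<lambda>n. poly p n + poly q n + 10" and
        B' = "\<lambda>n. poly p n + poly q n"])
    fix y and s :: store assume s: "s 0 = enc_pair enc_bool ea y" "clean (Suc K) s"
    obtain b x where y: "y = (b, x)" by (cases y)
    have sK: "s K = Leaf" using s(2) K(1) by (auto simp: clean_def)
    have cN: "clean N s" "clean M s" using clean_mono[OF s(2)] K by auto
    let ?n = "size (ea x)" and ?r = "if b then f x else g x"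
    let ?s1 = "s(K := enc_bool b)" and ?s2 = "s(K := enc_bool b, 0 := ea x)"
    let ?s3 = "s(K := enc_bool b, 0 := ec ?r)"
    have 1: "runs (Assign K (HdE (VarE 0))) s 3 ?s1" using s y by (intro runs_Assign) auto
    have 2: "runs (Assign 0 (TlE (VarE 0))) ?s1 3 ?s2" using s y K by (intro runs_Assign) auto
    have c2: "clean N ?s2" "clean M ?s2" using cN K by (auto intro!: clean_upd)
    have 3: "runs (Cond (VarE K) P Q) ?s2 (1 + exp_time (VarE K) + (poly p ?n + poly q ?n)) ?s3"
    proof (cases b)
      case True
      have "runs P ?s2 (poly p ?n) ?s3" using computes_runs[OF P _ c2(1), of x] True by simp
      then have "runs P ?s2 (poly p ?n + poly q ?n) ?s3" by (rule runs_mono) simp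
      then show ?thesis by (intro runs_CondTrue) (use True K in \<open>auto simp: enc_bool_def\<close>)
    next
      case False
      have "runs Q ?s2 (poly q ?n) ?s3" using computes_runs[OF Q _ c2(2), of x] False by simp
      then have "runs Q ?s2 (poly p ?n + poly q ?n) ?s3" by (rule runs_mono) simp
      then show ?thesis by (intro runs_CondFalse) (use False K in \<open>auto simp: enc_bool_def\<close>)
    qed
    have 4: "runs (Assign K NilE) ?s3 2 (s(0 := ec ?r))"
      using K sK by (intro runs_Assign) (auto simp: fun_eq_iff)
    have "runs ?P s (3 + (3 + (1 + exp_time (VarE K) + (poly p ?n + poly q ?n) + 2))) (s(0 := ec ?r))"
      by (intro runs_Seq[OF 1] runs_Seq[OF 2] runs_Seq[OF 3] 4)
    moreover have "poly p ?n \<le> poly p (size (enc_pair enc_bool ea y))" "poly q ?n \<le> poly q (size (enc_pair enc_bool ea y))"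
      using y by (auto intro!: poly_nat_mono)
    ultimately show "runs ?P s (poly p (size (enc_pair enc_bool ea y)) + poly q (size (enc_pair enc_bool ea y)) + 10)
      (s(0 := ec (if fst y then f (snd y) else g (snd y))))"
      using y by (auto elim!: runs_mono)
  next
    fix y :: "bool \<times> 'a"
    obtain b x where y: "y = (b, x)" by (cases y)
    have "poly p (size (ea x)) \<le> poly p (size (enc_pair enc_bool ea y))" "poly q (size (ea x)) \<le> poly q (size (enc_pair enc_bool ea y))"
      using y by (auto intro!: poly_nat_mono)
    then show "size (ec (if fst y then f (snd y) else g (snd y))) \<le>
      poly p (size (enc_pair enc_bool ea y)) + poly q (size (enc_pair enc_bool ea y))"
      using computes_size[OF P, of x] computes_size[OF Q, of x] y by (cases b; simp)
  qed (auto intro!: poly_bounded_intros)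
qed

lemma polytime_if:
  "polytime ea enc_bool b \<Longrightarrow> polytime ea ec f \<Longrightarrow> polytime ea ec g \<Longrightarrow> polytime ea ec (\<lambda>x. if b x then f x else g x)"
  using polytime_comp[OF polytime_pair[OF _ polytime_id] polytime_if_raw, of ea b ec f g] by (simp only: fst_conv snd_conv)

lemma polytime_case_raw:
  fixes ea :: "'a \<Rightarrow> tree" and eb :: "'b \<Rightarrow> tree"
  assumes "polytime ea ec f" "polytime (enc_pair eb (enc_pair (enc_list eb) ea)) ec g"
  shows "polytime (enc_pair (enc_list eb) ea) ec (\<lambda>p. case fst p of [] \<Rightarrow> f (snd p) | y # ys \<Rightarrow> g (y, ys, snd p))"
proof -
  from assms obtain P N p Q M q where P: "computes P N p ea ec f" and
    Q: "computes Q M q (enc_pair eb (enc_pair (enc_list eb) ea)) ec g" by (auto simp: polytime_def)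
  let ?Q = "Seq (Assign 0 (ConsE (HdE (HdE (VarE 0))) (ConsE (TlE (HdE (VarE 0))) (TlE (VarE 0))))) Q"
  let ?P = "Seq (Assign 0 (TlE (VarE 0))) P"
  let ?R = "Cond (HdE (VarE 0)) ?Q ?P"
  show ?thesis
  proof (rule polytimeI[where P = ?R and N = "max N M" and B = "\<lambda>n. poly p n + poly q (n + 1) + 20" and
        B' = "\<lambda>n. poly p n + poly q (n + 1)"])
    fix z and s :: store assume s: "s 0 = enc_pair (enc_list eb) ea z" "clean (max N M) s"
    obtain l x where z: "z = (l, x)" by (cases z)
    have cN: "clean N s" "clean M s" using clean_mono[OF s(2)] by auto
    let ?n = "size (enc_pair (enc_list eb) ea z)"
    show "runs ?R s (poly p ?n + poly q (?n + 1) + 20)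
      (s(0 := ec (case fst z of [] \<Rightarrow> f (snd z) | y # ys \<Rightarrow> g (y, ys, snd z))))"
    proof (cases l)
      case Nil
      have 1: "runs (Assign 0 (TlE (VarE 0))) s 3 (s(0 := ea x))" using s z by (intro runs_Assign) auto
      have 2: "runs P (s(0 := ea x)) (poly p (size (ea x))) (s(0 := ec (f x)))"
        using computes_runs[OF P, of "s(0 := ea x)" x] cN by (simp add: clean_upd)
      have "runs ?R s (1 + exp_time (HdE (VarE 0)) + (3 + poly p (size (ea x)))) (s(0 := ec (f x)))"
        by (intro runs_CondFalse runs_Seq[OF 1] 2) (use s z Nil in simp)
      moreover have "poly p (size (ea x)) \<le> poly p ?n" using z by (auto intro!: poly_nat_mono)
      ultimately show ?thesis using z Nil by (auto elim!: runs_mono)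
    next
      case (Cons y ys)
      let ?e = "enc_pair eb (enc_pair (enc_list eb) ea) (y, ys, x)"
      have 1: "runs (Assign 0 (ConsE (HdE (HdE (VarE 0))) (ConsE (TlE (HdE (VarE 0))) (TlE (VarE 0))))) s 12 (s(0 := ?e))"
        using s z Cons by (intro runs_Assign) auto
      have 2: "runs Q (s(0 := ?e)) (poly q (size ?e)) (s(0 := ec (g (y, ys, x))))"
        using computes_runs[OF Q, of "s(0 := ?e)" "(y, ys, x)"] cN by (simp add: clean_upd)
      have "runs ?R s (1 + exp_time (HdE (VarE 0)) + (12 + poly q (size ?e))) (s(0 := ec (g (y, ys, x))))"
        by (intro runs_CondTrue runs_Seq[OF 1] 2) (use s z Cons in simp)
      moreover have "poly q (size ?e) \<le> poly q (?n + 1)" using z Cons by (intro poly_nat_mono) simp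
      ultimately show ?thesis using z Cons by (auto elim!: runs_mono)
    qed
  next
    fix z :: "'b list \<times> 'a"
    obtain l x where z: "z = (l, x)" by (cases z)
    let ?n = "size (enc_pair (enc_list eb) ea z)"
    show "size (ec (case fst z of [] \<Rightarrow> f (snd z) | y # ys \<Rightarrow> g (y, ys, snd z))) \<le> poly p ?n + poly q (?n + 1)"
    proof (cases l)
      case Nil
      have "poly p (size (ea x)) \<le> poly p ?n" using z by (auto intro!: poly_nat_mono)
      then show ?thesis using computes_size[OF P, of x] z Nil by simp
    next
      case (Cons y ys)
      have "poly q (size (enc_pair eb (enc_pair (enc_list eb) ea) (y, ys, x))) \<le> poly q (?n + 1)"
        using z Cons by (intro poly_nat_mono) simp
      then show ?thesis using computes_size[OF Q, of "(y, ys, x)"] z Cons by simp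
    qed
  qed (auto intro!: poly_bounded_intros)
qed

lemma polytime_case_list:
  assumes "polytime ea (enc_list eb) l" "polytime ea ec f"
    "polytime (enc_pair eb (enc_pair (enc_list eb) ea)) ec (\<lambda>p. g (snd (snd p)) (fst p) (fst (snd p)))"
  shows "polytime ea ec (\<lambda>x. case l x of [] \<Rightarrow> f x | y # ys \<Rightarrow> g x y ys)"
  using polytime_comp[OF polytime_pair[OF assms(1) polytime_id] polytime_case_raw[OF assms(2,3)]] unfolding fst_conv snd_conv .

lemma length_le_size_enc_list: "length xs \<le> size (enc_list e xs)"
  by (induction xs) auto

lemma size_enc_list_append: "size (enc_list e (xs @ ys)) = size (enc_list e xs) + size (enc_list e ys)"
  by (induction xs) auto

lemma size_enc_list_rev: "size (enc_list e (rev xs)) = size (enc_list e xs)"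
  by (induction xs) (auto simp: size_enc_list_append)

lemma runs_reverse_loop:
  assumes "L \<noteq> R" "s L = enc_list e xs" "s R = enc_list e zs"
  shows "runs (While (VarE L) (Seq (Assign R (ConsE (HdE (VarE L)) (VarE R))) (Assign L (TlE (VarE L))))) s
    (length xs * 10 + 2) (s(L := Leaf, R := enc_list e (rev xs @ zs)))"
  using assms(2,3)
proof (induction xs arbitrary: s zs)
  case Nil
  have eq: "s(L := Leaf, R := enc_list e (rev [] @ zs)) = s" using Nil by (auto simp: fun_eq_iff)
  show ?case unfolding eq using runs_WhileFalse[of "VarE L" s] Nil by auto
next
  case (Cons x xs)
  let ?s1 = "s(R := enc_list e (x # zs))" and ?s2 = "s(R := enc_list e (x # zs), L := enc_list e xs)"
  have 1: "runs (Assign R (ConsE (HdE (VarE L)) (VarE R))) s 5 ?s1" using Cons by (intro runs_Assign) auto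
  have 2: "runs (Assign L (TlE (VarE L))) ?s1 3 ?s2" using Cons assms(1) by (intro runs_Assign) auto
  have 3: "runs (While (VarE L) (Seq (Assign R (ConsE (HdE (VarE L)) (VarE R))) (Assign L (TlE (VarE L))))) ?s2
    (length xs * 10 + 2) (?s2(L := Leaf, R := enc_list e (rev xs @ x # zs)))"
    using assms(1) by (intro Cons.IH) auto
  have eq: "?s2(L := Leaf, R := enc_list e (rev xs @ x # zs)) = s(L := Leaf, R := enc_list e (rev (x # xs) @ zs))"
    using assms(1) by (auto simp: fun_eq_iff)
  have "eval_exp (VarE L) s \<noteq> Leaf" using Cons(2) by simp
  from runs_WhileTrue[OF this runs_Seq[OF 1 2] 3, unfolded eq]
  show ?case by (rule runs_mono) simp
qed

text \<open>The recursion is evaluated from the end of the list, so the list is reversed first. The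
  bound \<open>B\<close> for all suffixes has to be supplied: steps that merely double the size
  would make it exponential when iterated.\<close>

lemma polytime_list_rec:
  fixes g :: "'a \<Rightarrow> 'b list \<Rightarrow> 'c"
  assumes l: "polytime ea (enc_list eb) l" and i: "polytime ea ec i"
    and h: "polytime (enc_pair eb (enc_pair (enc_list eb) (enc_pair ec ea))) ec
      (\<lambda>p. h (snd (snd (snd p))) (fst p) (fst (snd p)) (fst (snd (snd p))))"
    and g: "\<And>x. g x [] = i x" "\<And>x y ys. g x (y # ys) = h x y ys (g x ys)"
    and B: "\<And>x zs ys. l x = zs @ ys \<Longrightarrow> size (ec (g x ys)) \<le> B (size (ea x))" "poly_bounded B"
  shows "polytime ea ec (\<lambda>x. g x (l x))"
proof -
  from i obtain I N\<^sub>I pI where I: "computes I N\<^sub>I pI ea ec i" by (auto simp: polytime_def)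
  from h obtain H N\<^sub>H pH where H: "computes H N\<^sub>H pH (enc_pair eb (enc_pair (enc_list eb) (enc_pair ec ea))) ec
      (\<lambda>p. h (snd (snd (snd p))) (fst p) (fst (snd p)) (fst (snd (snd p))))" by (auto simp: polytime_def)
  from l obtain E N\<^sub>E pE where E: "computes E N\<^sub>E pE ea (enc_list eb) l" by (auto simp: polytime_def)
  \<comment> \<open>\<open>a\<close> keeps the input, \<open>L\<close> receives the list,
    \<open>R\<close> its reversal and thus the elements still to be treated, \<open>S\<close> the
    suffix already treated, which is an argument of \<open>h\<close>.\<close>
  define a where "a = Suc (max N\<^sub>I (max N\<^sub>H N\<^sub>E))"
  define L where "L = Suc a" define R where "R = Suc L" define S where "S = Suc R"
  have ord: "0 < a" "a < L" "L < R" "R < S" "N\<^sub>I \<le> a" "N\<^sub>H \<le> a" "N\<^sub>E \<le> a" by (auto simp: a_def L_def R_def S_def)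
  let ?body = "Seq (Assign 0 (ConsE (HdE (VarE R)) (ConsE (VarE S) (ConsE (VarE 0) (VarE a)))))
    (Seq (Assign S (ConsE (HdE (VarE R)) (VarE S))) (Seq (Assign R (TlE (VarE R))) H))"
  let ?loop = "While (VarE R) ?body"
  let ?rev = "While (VarE L) (Seq (Assign R (ConsE (HdE (VarE L)) (VarE R))) (Assign L (TlE (VarE L))))"
  let ?P = "Seq (Assign a (VarE 0)) (Seq E (Seq (Assign L (VarE 0)) (Seq ?rev (Seq (Assign 0 (VarE a)) (Seq I
    (Seq ?loop (Seq (Assign a NilE) (Assign S NilE))))))))"
  have loop: "runs ?loop s (length rs * (T + 30) + 2)
      (s(0 := ec (g x (rev rs @ ys)), R := Leaf, S := enc_list eb (rev rs @ ys)))"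
    if "s 0 = ec (g x ys)" "s a = ea x" "s R = enc_list eb rs" "s S = enc_list eb ys" "clean a s"
      "l x = rev rs @ ys"
      "T = poly pH (pE' + B (size (ea x)) + size (ea x) + 3)" "size (enc_list eb (l x)) \<le> pE'" for s x rs ys T pE'
    using that(1-6)
  proof (induction rs arbitrary: s ys)
    case Nil
    have eq: "s(0 := ec (g x (rev [] @ ys)), R := Leaf, S := enc_list eb (rev [] @ ys)) = s"
      using Nil by (auto simp: fun_eq_iff)
    show ?case unfolding eq using runs_WhileFalse[of "VarE R" s] Nil by auto
  next
    case (Cons y rs)
    let ?in = "(y, ys, g x ys, x)"
    let ?e = "enc_pair eb (enc_pair (enc_list eb) (enc_pair ec ea)) ?in"
    let ?s1 = "s(0 := ?e)" and ?s2 = "s(0 := ?e, S := enc_list eb (y # ys))"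
    let ?s3 = "s(0 := ?e, S := enc_list eb (y # ys), R := enc_list eb rs)"
    let ?s4 = "s(0 := ec (g x (y # ys)), S := enc_list eb (y # ys), R := enc_list eb rs)"
    have 1: "runs (Assign 0 (ConsE (HdE (VarE R)) (ConsE (VarE S) (ConsE (VarE 0) (VarE a))))) s 9 ?s1"
      using Cons.prems by (intro runs_Assign) auto
    have 2: "runs (Assign S (ConsE (HdE (VarE R)) (VarE S))) ?s1 5 ?s2"
      using Cons.prems ord by (intro runs_Assign) auto
    have 3: "runs (Assign R (TlE (VarE R))) ?s2 3 ?s3"
      using Cons.prems ord by (intro runs_Assign) auto
    have "clean N\<^sub>H ?s3"
      using clean_mono[OF Cons.prems(5) ord(6)] ord by (intro clean_upd) auto
    moreover have "?s3 0 = ?e" using ord by simp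
    ultimately have "runs H ?s3 (poly pH (size ?e)) (?s3(0 := ec (h x y ys (g x ys))))"
      using computes_runs[OF H, of ?s3 ?in] by simp
    moreover have "?s3(0 := ec (h x y ys (g x ys))) = ?s4" using g ord by (auto simp: fun_eq_iff)
    moreover have "poly pH (size ?e) \<le> T"
    proof -
      have "size (enc_list eb (l x)) = size (enc_list eb rs) + size (eb y) + 1 + size (enc_list eb ys)"
        unfolding Cons.prems(6) by (simp add: size_enc_list_append size_enc_list_rev)
      moreover have "size (ec (g x ys)) \<le> B (size (ea x))" using B(1)[OF Cons.prems(6)] .
      ultimately have "size ?e \<le> pE' + B (size (ea x)) + size (ea x) + 3" using that(8) by simp
      then show ?thesis unfolding that(7) by (rule poly_nat_mono)
    qed
    ultimately have 4: "runs H ?s3 T ?s4" by (auto elim!: runs_mono)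
    have 5: "runs ?loop ?s4 (length rs * (T + 30) + 2)
      (?s4(0 := ec (g x (rev rs @ y # ys)), R := Leaf, S := enc_list eb (rev rs @ y # ys)))"
    proof (rule Cons.IH)
      show "clean a ?s4" using Cons.prems(5) ord by (intro clean_upd) auto
    qed (use Cons.prems ord in auto)
    have eq: "?s4(0 := ec (g x (rev rs @ y # ys)), R := Leaf, S := enc_list eb (rev rs @ y # ys)) =
      s(0 := ec (g x (rev (y # rs) @ ys)), R := Leaf, S := enc_list eb (rev (y # rs) @ ys))"
      by (auto simp: fun_eq_iff)
    have "eval_exp (VarE R) s \<noteq> Leaf" using Cons.prems by simp
    from runs_WhileTrue[OF this runs_Seq[OF 1 runs_Seq[OF 2 runs_Seq[OF 3 4]]] 5, unfolded eq]
    show ?case by (rule runs_mono) (simp add: algebra_simps)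
  qed
  let ?B = "\<lambda>n. poly pE n + poly pI n + poly pE n * (poly pH (poly pE n + B n + n + 3) + 40) + 30"
  have pB: "poly_bounded ?B" using B(2) by (intro poly_bounded_intros)
  show ?thesis
  proof (rule polytimeI[where P = ?P and N = "Suc S" and B = ?B and B' = B])
    fix x and s :: store assume s: "s 0 = ea x" "clean (Suc S) s"
    let ?n = "size (ea x)"
    define T where "T = poly pH (poly pE ?n + B ?n + ?n + 3)"
    have sz: "size (enc_list eb (l x)) \<le> poly pE ?n" by (rule computes_size[OF E])
    have len: "length (l x) \<le> poly pE ?n" using length_le_size_enc_list[of "l x" eb] sz by linarith
    have sL: "s a = Leaf" "s L = Leaf" "s R = Leaf" "s S = Leaf" using s(2) ord by (auto simp: clean_def)
    have ca: "clean a s" using clean_mono[OF s(2), of a] ord by simp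
    let ?l = "enc_list eb (l x)"
    let ?s1 = "s(a := ea x)"
    have 1: "runs (Assign a (VarE 0)) s 2 ?s1" using s by (intro runs_Assign) auto
    have 2: "runs E ?s1 (poly pE ?n) (?s1(0 := ?l))"
      using ord s by (intro computes_runs[OF E]) (auto intro!: clean_upd clean_mono[OF ca])
    let ?s3 = "s(a := ea x, 0 := ?l, L := ?l)"
    have 3: "runs (Assign L (VarE 0)) (?s1(0 := ?l)) 2 ?s3" using ord by (intro runs_Assign) auto
    let ?s4 = "s(a := ea x, 0 := ?l, L := Leaf, R := enc_list eb (rev (l x)))"
    have "runs ?rev ?s3 (length (l x) * 10 + 2) (?s3(L := Leaf, R := enc_list eb (rev (l x) @ [])))"
      using ord sL by (intro runs_reverse_loop) auto
    moreover have "?s3(L := Leaf, R := enc_list eb (rev (l x) @ [])) = ?s4" by (auto simp: fun_eq_iff)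
    ultimately have 4: "runs ?rev ?s3 (length (l x) * 10 + 2) ?s4" by simp
    let ?s5 = "s(a := ea x, 0 := ea x, L := Leaf, R := enc_list eb (rev (l x)))"
    have 5: "runs (Assign 0 (VarE a)) ?s4 2 ?s5" using ord by (intro runs_Assign) (auto simp: fun_eq_iff)
    let ?s6 = "s(a := ea x, 0 := ec (i x), L := Leaf, R := enc_list eb (rev (l x)))"
    have "runs I ?s5 (poly pI ?n) (?s5(0 := ec (i x)))"
      using ord by (intro computes_runs[OF I]) (auto intro!: clean_upd clean_mono[OF ca])
    moreover have "?s5(0 := ec (i x)) = ?s6" using ord by (auto simp: fun_eq_iff)
    ultimately have 6: "runs I ?s5 (poly pI ?n) ?s6" by simp
    let ?s7 = "?s6(0 := ec (g x (l x)), R := Leaf, S := ?l)"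
    have "runs ?loop ?s6 (length (rev (l x)) * (T + 30) + 2)
      (?s6(0 := ec (g x (rev (rev (l x)) @ [])), R := Leaf, S := enc_list eb (rev (rev (l x)) @ [])))"
    proof (rule loop[OF _ _ _ _ _ _ T_def sz])
      show "clean a ?s6" using ord by (auto intro!: clean_upd ca)
    qed (use ord sL g in auto)
    then have 7: "runs ?loop ?s6 (length (l x) * (T + 30) + 2) ?s7" by simp
    have 8: "runs (Assign a NilE) ?s7 2 (?s7(a := Leaf))" by (intro runs_Assign) auto
    have 9: "runs (Assign S NilE) (?s7(a := Leaf)) 2 (s(0 := ec (g x (l x))))"
      using ord sL by (intro runs_Assign) (auto simp: fun_eq_iff)
    have "runs ?P s (2 + (poly pE ?n + (2 + ((length (l x) * 10 + 2) + (2 + (poly pI ?n +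
      ((length (l x) * (T + 30) + 2) + (2 + 2)))))))) (s(0 := ec (g x (l x))))"
      by (intro runs_Seq[OF 1] runs_Seq[OF 2] runs_Seq[OF 3] runs_Seq[OF 4] runs_Seq[OF 5] runs_Seq[OF 6]
          runs_Seq[OF 7] runs_Seq[OF 8] 9)
    then show "runs ?P s (?B ?n) (s(0 := ec (g x (l x))))"
    proof (rule runs_mono)
      have "length (l x) * (T + 40) \<le> poly pE ?n * (T + 40)" using len by (rule mult_le_mono1)
      then show "2 + (poly pE ?n + (2 + ((length (l x) * 10 + 2) + (2 + (poly pI ?n +
        ((length (l x) * (T + 30) + 2) + (2 + 2))))))) \<le> ?B ?n"
        unfolding T_def[symmetric] by (simp add: algebra_simps)
    qed
  next
    fix x show "size (ec (g x (l x))) \<le> B (size (ea x))" using B(1)[of x "[]"] by simp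
  qed (use B(2) pB in auto)
qed

section \<open>Polynomial-time list functions\<close>

lemma polytime_bound: "polytime ea eb f \<Longrightarrow> \<exists>p. \<forall>x. size (eb (f x)) \<le> poly p (size (ea x))"
  unfolding polytime_def computes_def by blast

text \<open>Reduces a function of several arguments to one on tuples, so that its definition is
  treated once, with projections as the only arguments.\<close>

lemma polytime_open2:
  assumes "polytime (enc_pair e1 e2) ec (\<lambda>p. F (fst p) (snd p))" "polytime ea e1 f" "polytime ea e2 g"
  shows "polytime ea ec (\<lambda>x. F (f x) (g x))"
  using polytime_comp[OF polytime_pair[OF assms(2,3)] assms(1)] by simp

lemma polytime_open3:
  assumes "polytime (enc_pair e1 (enc_pair e2 e3)) ec (\<lambda>p. F (fst p) (fst (snd p)) (snd (snd p)))" "polytime ea e1 f" "polytime ea e2 g" "polytime ea e3 h"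
  shows "polytime ea ec (\<lambda>x. F (f x) (g x) (h x))"
  using polytime_comp[OF polytime_pair[OF assms(2) polytime_pair[OF assms(3,4)]] assms(1)] by simp

lemma polytime_Cons: "polytime ea eb f \<Longrightarrow> polytime ea (enc_list eb) g \<Longrightarrow> polytime ea (enc_list eb) (\<lambda>x. f x # g x)"
  by (rule polytime_cong_enc[OF polytime_pair[of ea eb f "enc_list eb" g]]) auto

lemma polytime_tl: "polytime ea (enc_list eb) f \<Longrightarrow> polytime ea (enc_list eb) (\<lambda>x. tl (f x))"
proof -
  assume f: "polytime ea (enc_list eb) f"
  have tl: "right (enc_list eb xs) = enc_list eb (tl xs)" for xs by (cases xs) auto
  have "size (enc_list eb (tl xs)) \<le> size (enc_list eb xs)" for xs by (cases xs) auto
  then have "polytime (enc_list eb) (enc_list eb) tl"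
    by (intro polytime_exp[where e = "TlE (VarE 0)" and B = "\<lambda>n. n"]) (auto simp: tl intro: poly_bounded_intros)
  from polytime_comp[OF f this] show ?thesis .
qed

lemma polytime_append:
  assumes "polytime ea (enc_list eb) f" "polytime ea (enc_list eb) g"
  shows "polytime ea (enc_list eb) (\<lambda>x. f x @ g x)"
proof -
  obtain p q where p: "\<And>x. size (enc_list eb (f x)) \<le> poly p (size (ea x))"
    and q: "\<And>x. size (enc_list eb (g x)) \<le> poly q (size (ea x))"
    using polytime_bound[OF assms(1)] polytime_bound[OF assms(2)] by blast
  show ?thesis
  proof (rule polytime_list_rec[OF assms(1,2), where h = "\<lambda>x y ys acc. y # acc" and g = "\<lambda>x ys. ys @ g x" and
        B = "\<lambda>n. poly p n + poly q n"])
    show "polytime (enc_pair eb (enc_pair (enc_list eb) (enc_pair (enc_list eb) ea))) (enc_list eb) (\<lambda>p. fst p # fst (snd (snd p)))"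
      by (rule polytime_Cons polytime_fst polytime_snd polytime_id)+
    fix x zs ys assume "f x = zs @ ys"
    with p[of x] q[of x] show "size (enc_list eb (ys @ g x)) \<le> poly p (size (ea x)) + poly q (size (ea x))"
      by (simp add: size_enc_list_append)
  qed (auto intro: poly_bounded_intros)
qed

lemma polytime_rev:
  assumes "polytime ea (enc_list eb) f" shows "polytime ea (enc_list eb) (\<lambda>x. rev (f x))"
proof -
  obtain p where p: "\<And>x. size (enc_list eb (f x)) \<le> poly p (size (ea x))" using polytime_bound[OF assms] by blast
  show ?thesis
  proof (rule polytime_list_rec[OF assms polytime_const, where h = "\<lambda>x y ys acc. acc @ [y]" and g = "\<lambda>x ys. rev ys" and B = "poly p"])
    show "polytime (enc_pair eb (enc_pair (enc_list eb) (enc_pair (enc_list eb) ea))) (enc_list eb) (\<lambda>p. fst (snd (snd p)) @ [fst p])"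
      by (rule polytime_append polytime_Cons polytime_fst polytime_snd polytime_id polytime_const)+
    fix x zs ys assume "f x = zs @ ys"
    with p[of x] show "size (enc_list eb (rev ys)) \<le> poly p (size (ea x))"
      by (simp add: size_enc_list_append size_enc_list_rev)
  qed (auto intro: poly_bounded_intros)
qed

lemma size_elem_enc_list: "y \<in> set ys \<Longrightarrow> size (e y) \<le> size (enc_list e ys)"
  by (induction ys) auto

lemma size_enc_list_le: "(\<And>y. y \<in> set ys \<Longrightarrow> size (e y) \<le> c) \<Longrightarrow> size (enc_list e ys) \<le> length ys * (c + 1)"
proof (induction ys)
  case (Cons y ys)
  have "size (e y) \<le> c" using Cons.prems[of y] by simp
  moreover have "size (enc_list e ys) \<le> length ys * (c + 1)" using Cons by simp
  ultimately show ?case by simp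
qed simp

lemma polytime_map:
  assumes "polytime ea (enc_list eb) l" "polytime (enc_pair eb ea) ec (\<lambda>p. h (snd p) (fst p))"
  shows "polytime ea (enc_list ec) (\<lambda>x. map (h x) (l x))"
proof -
  obtain p where p: "\<And>x. size (enc_list eb (l x)) \<le> poly p (size (ea x))" using polytime_bound[OF assms(1)] by blast
  obtain q where q: "\<And>x y. size (ec (h x y)) \<le> poly q (size (enc_pair eb ea (y, x)))"
    using polytime_bound[OF assms(2)] by fastforce
  show ?thesis
  proof (rule polytime_list_rec[OF assms(1) polytime_const, where h = "\<lambda>x y ys acc. h x y # acc" and g = "\<lambda>x ys. map (h x) ys" and
      B = "\<lambda>n. poly p n * (poly q (poly p n + n + 1) + 1)"])
    have "polytime (enc_pair eb (enc_pair (enc_list eb) (enc_pair (enc_list ec) ea))) (enc_pair eb ea) (\<lambda>p. (fst p, snd (snd (snd p))))"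
      by (rule polytime_pair polytime_fst polytime_snd polytime_id)+
    from polytime_comp[OF this assms(2)]
    have hh: "polytime (enc_pair eb (enc_pair (enc_list eb) (enc_pair (enc_list ec) ea))) ec (\<lambda>p. h (snd (snd (snd p))) (fst p))" by simp
    show "polytime (enc_pair eb (enc_pair (enc_list eb) (enc_pair (enc_list ec) ea))) (enc_list ec)
      (\<lambda>p. h (snd (snd (snd p))) (fst p) # fst (snd (snd p)))"
      by (rule hh polytime_Cons polytime_fst polytime_snd polytime_id)+
    fix x zs ys assume lx: "l x = zs @ ys"
    let ?n = "size (ea x)"
    have "size (ec y) \<le> poly q (poly p ?n + ?n + 1)" if "y \<in> set (map (h x) ys)" for y
    proof -
      from that obtain z where z: "z \<in> set ys" "y = h x z" by auto
      then have "size (eb z) \<le> size (enc_list eb (l x))" using lx by (intro size_elem_enc_list) auto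
      then have "size (enc_pair eb ea (z, x)) \<le> poly p ?n + ?n + 1" using p[of x] by simp
      then show ?thesis using q[of x z] z poly_nat_mono order_trans by blast
    qed
    then have "size (enc_list ec (map (h x) ys)) \<le> length (map (h x) ys) * (poly q (poly p ?n + ?n + 1) + 1)"
      by (rule size_enc_list_le)
    also have "\<dots> \<le> poly p ?n * (poly q (poly p ?n + ?n + 1) + 1)"
      using lx p[of x] length_le_size_enc_list[of "l x" eb] by (intro mult_right_mono) auto
    finally show "size (enc_list ec (map (h x) ys)) \<le> poly p ?n * (poly q (poly p ?n + ?n + 1) + 1)" .
  qed (auto intro!: poly_bounded_intros)
qed

lemma size_enc_list_concat: "size (enc_list e (concat xss)) \<le> size (enc_list (enc_list e) xss)"
  by (induction xss) (auto simp: size_enc_list_append)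

lemma polytime_concat:
  assumes "polytime ea (enc_list (enc_list eb)) f" shows "polytime ea (enc_list eb) (\<lambda>x. concat (f x))"
proof -
  obtain p where p: "\<And>x. size (enc_list (enc_list eb) (f x)) \<le> poly p (size (ea x))" using polytime_bound[OF assms] by blast
  show ?thesis
  proof (rule polytime_list_rec[OF assms polytime_const, where h = "\<lambda>x y ys acc. y @ acc" and g = "\<lambda>x ys. concat ys" and B = "poly p"])
    show "polytime (enc_pair (enc_list eb) (enc_pair (enc_list (enc_list eb)) (enc_pair (enc_list eb) ea))) (enc_list eb) (\<lambda>p. fst p @ fst (snd (snd p)))"
      by (rule polytime_append polytime_fst polytime_snd polytime_id)+
    fix x zs ys assume "f x = zs @ ys"
    with p[of x] size_enc_list_concat[of eb ys] show "size (enc_list eb (concat ys)) \<le> poly p (size (ea x))"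
      by (simp add: size_enc_list_append)
  qed (auto intro: poly_bounded_intros)
qed

lemma polytime_filter:
  assumes "polytime ea (enc_list eb) l" "polytime (enc_pair eb ea) enc_bool (\<lambda>p. h (snd p) (fst p))"
  shows "polytime ea (enc_list eb) (\<lambda>x. filter (h x) (l x))"
proof -
  have "polytime ea (enc_list eb) (\<lambda>x. concat (map (\<lambda>y. if h x y then [y] else []) (l x)))"
    by (rule polytime_concat polytime_map polytime_if assms polytime_Cons polytime_fst polytime_id polytime_const)+
  moreover have "concat (map (\<lambda>y. if P y then [y] else []) ys) = filter P ys" for P and ys :: "'b list"
    by (induction ys) auto
  ultimately show ?thesis by simp
qed

lemma size_enc_bool: "size (enc_bool b) \<le> 1"
  by (auto simp: enc_bool_def)

lemma polytime_not: "polytime ea enc_bool b \<Longrightarrow> polytime ea enc_bool (\<lambda>x. \<not> b x)"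
  by (rule polytime_cong_enc[OF polytime_if[of ea b enc_bool "\<lambda>_. False" "\<lambda>_. True"]]) (auto intro: polytime_const)

lemma polytime_conj: "polytime ea enc_bool b \<Longrightarrow> polytime ea enc_bool c \<Longrightarrow> polytime ea enc_bool (\<lambda>x. b x \<and> c x)"
  by (rule polytime_cong_enc[OF polytime_if[of ea b enc_bool c "\<lambda>_. False"]]) (auto intro: polytime_const)

lemma polytime_disj: "polytime ea enc_bool b \<Longrightarrow> polytime ea enc_bool c \<Longrightarrow> polytime ea enc_bool (\<lambda>x. b x \<or> c x)"
  using polytime_not[OF polytime_conj[OF polytime_not polytime_not], of ea b c] by simp

lemma polytime_list_all:
  assumes "polytime ea (enc_list eb) l" "polytime (enc_pair eb ea) enc_bool (\<lambda>p. h (snd p) (fst p))"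
  shows "polytime ea enc_bool (\<lambda>x. list_all (h x) (l x))"
proof (rule polytime_list_rec[OF assms(1) polytime_const, where h = "\<lambda>x y ys acc. h x y \<and> acc" and g = "\<lambda>x ys. list_all (h x) ys" and B = "\<lambda>n. 1"])
  have "polytime (enc_pair eb (enc_pair (enc_list eb) (enc_pair enc_bool ea))) (enc_pair eb ea) (\<lambda>p. (fst p, snd (snd (snd p))))"
    by (rule polytime_pair polytime_fst polytime_snd polytime_id)+
  from polytime_comp[OF this assms(2)]
  have hh: "polytime (enc_pair eb (enc_pair (enc_list eb) (enc_pair enc_bool ea))) enc_bool (\<lambda>p. h (snd (snd (snd p))) (fst p))" by simp
  show "polytime (enc_pair eb (enc_pair (enc_list eb) (enc_pair enc_bool ea))) enc_bool
    (\<lambda>p. h (snd (snd (snd p))) (fst p) \<and> fst (snd (snd p)))"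
    by (rule hh polytime_conj polytime_fst polytime_snd polytime_id)+
qed (use size_enc_bool in \<open>auto intro: poly_bounded_intros\<close>)

lemma polytime_list_ex:
  assumes "polytime ea (enc_list eb) l" "polytime (enc_pair eb ea) enc_bool (\<lambda>p. h (snd p) (fst p))"
  shows "polytime ea enc_bool (\<lambda>x. list_ex (h x) (l x))"
proof -
  have "polytime ea enc_bool (\<lambda>x. \<not> list_all (\<lambda>y. \<not> h x y) (l x))"
    by (rule polytime_not polytime_list_all assms)+
  then show ?thesis by (simp add: list_ex_iff list_all_iff)
qed

text \<open>Numerals as lists of units: addition, comparison and bounded iteration become
  \<open>append\<close>, \<open>drop\<close> and list recursion.\<close>

abbreviation enc_unary :: "unit list \<Rightarrow> tree" where
  "enc_unary \<equiv> enc_list (\<lambda>_. Leaf)"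

lemma enc_list_const: "length xs = length ys \<Longrightarrow> enc_list (\<lambda>_. c) xs = enc_list (\<lambda>_. c) ys"
  by (induction xs ys rule: list_induct2) auto

lemma enc_nat_unary: "enc_nat n = enc_unary (replicate n ())"
  unfolding enc_nat_def by (rule enc_list_const) simp

lemma size_enc_nat: "size (enc_nat n) = n"
  unfolding enc_nat_unary by (induction n) auto

lemma polytime_replicate: "polytime ea enc_nat f \<Longrightarrow> polytime ea enc_unary (\<lambda>x. replicate (f x) ())"
  by (erule polytime_cong_enc) (auto simp: enc_nat_unary)

lemma polytime_length: "polytime ea (enc_list eb) f \<Longrightarrow> polytime ea enc_nat (\<lambda>x. length (f x))"
proof -
  assume f: "polytime ea (enc_list eb) f"
  have "polytime ea enc_unary (\<lambda>x. map (\<lambda>_. ()) (f x))" by (rule f polytime_map polytime_const)+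
  then show ?thesis
    by (rule polytime_cong_enc) (auto simp: enc_nat_unary intro: enc_list_const)
qed

lemma polytime_add: "polytime ea enc_nat f \<Longrightarrow> polytime ea enc_nat g \<Longrightarrow> polytime ea enc_nat (\<lambda>x. f x + g x)"
  using polytime_length[OF polytime_append[OF polytime_replicate polytime_replicate], of ea f g] by simp

text \<open>The recursion is over the numeral, with one \<open>tl\<close> per unit.\<close>

lemma polytime_drop:
  assumes "polytime ea enc_nat f" "polytime ea (enc_list eb) l" shows "polytime ea (enc_list eb) (\<lambda>x. drop (f x) (l x))"
proof -
  obtain p where p: "\<And>x. size (enc_list eb (l x)) \<le> poly p (size (ea x))" using polytime_bound[OF assms(2)] by blast
  have d: "size (enc_list eb (drop k xs)) \<le> size (enc_list eb xs)" for k and xs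
    using size_enc_list_append[of eb "take k xs" "drop k xs"] by simp
  have "polytime ea (enc_list eb) (\<lambda>x. drop (length (replicate (f x) ())) (l x))"
  proof (rule polytime_list_rec[OF polytime_replicate[OF assms(1)] assms(2), where h = "\<lambda>x y ys acc. tl acc" and
        g = "\<lambda>x ys. drop (length ys) (l x)" and B = "poly p"])
    show "polytime (enc_pair (\<lambda>_. Leaf) (enc_pair enc_unary (enc_pair (enc_list eb) ea))) (enc_list eb) (\<lambda>p. tl (fst (snd (snd p))))"
      by (rule polytime_tl polytime_fst polytime_snd polytime_id)+
    fix x zs ys
    show "size (enc_list eb (drop (length (ys :: unit list)) (l x))) \<le> poly p (size (ea x))"
      using d p[of x] order_trans by blast
  qed (auto intro: poly_bounded_intros simp: drop_Suc tl_drop)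
  then show ?thesis by simp
qed

lemma polytime_isnil: "polytime ea (enc_list eb) f \<Longrightarrow> polytime ea enc_bool (\<lambda>x. f x = [])"
proof -
  assume f: "polytime ea (enc_list eb) f"
  have "polytime ea enc_bool (\<lambda>x. case f x of [] \<Rightarrow> True | _ # _ \<Rightarrow> False)"
    by (rule f polytime_case_list polytime_const)+
  then show ?thesis by (rule polytime_cong_enc) (auto split: list.splits)
qed

lemma polytime_le: "polytime ea enc_nat f \<Longrightarrow> polytime ea enc_nat g \<Longrightarrow> polytime ea enc_bool (\<lambda>x. f x \<le> g x)"
  using polytime_isnil[OF polytime_drop[OF _ polytime_replicate], of ea g f] by simp

lemma polytime_less: "polytime ea enc_nat f \<Longrightarrow> polytime ea enc_nat g \<Longrightarrow> polytime ea enc_bool (\<lambda>x. f x < g x)"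
  using polytime_not[OF polytime_le, of ea g f] by (simp add: not_le)

lemma polytime_nat_eq: "polytime ea enc_nat f \<Longrightarrow> polytime ea enc_nat g \<Longrightarrow> polytime ea enc_bool (\<lambda>x. f x = g x)"
  using polytime_conj[OF polytime_le polytime_le, of ea f g g f] by (simp add: eq_iff)

lemma polytime_sum_list:
  assumes "polytime ea (enc_list enc_nat) f" shows "polytime ea enc_nat (\<lambda>x. sum_list (f x))"
proof -
  obtain p where p: "\<And>x. size (enc_list enc_nat (f x)) \<le> poly p (size (ea x))" using polytime_bound[OF assms] by blast
  have le: "sum_list ys \<le> size (enc_list enc_nat ys)" for ys by (induction ys) (auto simp: size_enc_nat)
  show ?thesis
  proof (rule polytime_list_rec[OF assms polytime_const, where h = "\<lambda>x y ys acc. y + acc" and g = "\<lambda>x ys. sum_list ys" and B = "poly p"])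
    show "polytime (enc_pair enc_nat (enc_pair (enc_list enc_nat) (enc_pair enc_nat ea))) enc_nat (\<lambda>p. fst p + fst (snd (snd p)))"
      by (rule polytime_add polytime_fst polytime_snd polytime_id)+
    fix x zs ys assume "f x = zs @ ys"
    with p[of x] le[of ys] show "size (enc_nat (sum_list ys)) \<le> poly p (size (ea x))"
      by (simp add: size_enc_list_append size_enc_nat)
  qed (auto intro: poly_bounded_intros)
qed

section \<open>Decompositions of lists\<close>

fun splits :: "'a list \<Rightarrow> ('a list \<times> 'a list) list" where
  "splits [] = [([], [])]"
| "splits (x # xs) = ([], x # xs) # map (\<lambda>q. (x # fst q, snd q)) (splits xs)"

lemma set_splits: "set (splits xs) = {(A, B). xs = A @ B}"
  by (induction xs) (auto simp: Cons_eq_append_conv image_iff)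

lemma length_splits: "length (splits xs) = Suc (length xs)"
  by (induction xs) auto

lemma polytime_splits:
  assumes "polytime ea (enc_list eb) f" shows "polytime ea (enc_list (enc_pair (enc_list eb) (enc_list eb))) (\<lambda>x. splits (f x))"
proof -
  let ?e = "enc_pair (enc_list eb) (enc_list eb)"
  obtain p where p: "\<And>x. size (enc_list eb (f x)) \<le> poly p (size (ea x))" using polytime_bound[OF assms] by blast
  have sz: "size (enc_list ?e (splits ys)) \<le> (size (enc_list eb ys) + 1) * (size (enc_list eb ys) + 2)" for ys
  proof -
    have "size (?e q) \<le> size (enc_list eb ys) + 1" if "q \<in> set (splits ys)" for q
      using that unfolding set_splits by (auto simp: size_enc_list_append)
    then have "size (enc_list ?e (splits ys)) \<le> length (splits ys) * (size (enc_list eb ys) + 1 + 1)"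
      by (rule size_enc_list_le)
    also have "\<dots> \<le> (size (enc_list eb ys) + 1) * (size (enc_list eb ys) + 2)"
      using length_le_size_enc_list[of ys eb] unfolding length_splits by (intro mult_mono) auto
    finally show ?thesis .
  qed
  show ?thesis
  proof (rule polytime_list_rec[OF assms polytime_const, where h = "\<lambda>x y ys acc. ([], y # ys) # map (\<lambda>q. (y # fst q, snd q)) acc" and
        g = "\<lambda>x ys. splits ys" and B = "\<lambda>n. (poly p n + 1) * (poly p n + 2)"])
    show "polytime (enc_pair eb (enc_pair (enc_list eb) (enc_pair (enc_list ?e) ea))) (enc_list ?e)
      (\<lambda>p. ([], fst p # fst (snd p)) # map (\<lambda>q. (fst p # fst q, snd q)) (fst (snd (snd p))))"
      by (rule polytime_Cons polytime_pair polytime_map polytime_fst polytime_snd polytime_id polytime_const)+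
    fix x zs ys assume "f x = zs @ ys"
    then have "size (enc_list eb ys) \<le> poly p (size (ea x))" using p[of x] by (simp add: size_enc_list_append)
    then have "(size (enc_list eb ys) + 1) * (size (enc_list eb ys) + 2) \<le> (poly p (size (ea x)) + 1) * (poly p (size (ea x)) + 2)"
      by (intro mult_mono) auto
    then show "size (enc_list ?e (splits ys)) \<le> (poly p (size (ea x)) + 1) * (poly p (size (ea x)) + 2)"
      using sz order_trans by blast
  qed (auto intro!: poly_bounded_intros)
qed

text \<open>All ways to single out one element. As multisets of paths are represented by lists, this
  takes the place of matching against \<open>add_mset\<close>.\<close>

definition picks :: "'a list \<Rightarrow> ('a \<times> 'a list) list" where
  "picks xs = concat (map (\<lambda>q. case snd q of [] \<Rightarrow> [] | y # ys \<Rightarrow> [(y, fst q @ ys)]) (splits xs))"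

lemma set_picks: "set (picks xs) = {(y, A @ B) | y A B. xs = A @ y # B}"
  unfolding picks_def by (auto simp: set_splits split: list.splits) force

lemma picks_mset: "(y, ys) \<in> set (picks xs) \<Longrightarrow> mset xs = add_mset y (mset ys)"
  by (auto simp: set_picks)

lemma picks_complete:
  assumes "mset xs = add_mset y R" shows "\<exists>ys. (y, ys) \<in> set (picks xs) \<and> mset ys = R"
proof -
  have "y \<in> set xs" using assms by (metis set_mset_mset union_single_eq_member)
  then obtain A B where "xs = A @ y # B" by (auto simp: in_set_conv_decomp)
  with assms show ?thesis by (intro exI[of _ "A @ B"]) (auto simp: set_picks)
qed

lemma polytime_picks:
  assumes "polytime ea (enc_list eb) f" shows "polytime ea (enc_list (enc_pair eb (enc_list eb))) (\<lambda>x. picks (f x))"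
  unfolding picks_def
  by (rule polytime_concat polytime_map polytime_splits assms polytime_case_list polytime_snd polytime_fst polytime_id polytime_const polytime_Cons polytime_pair polytime_append)+

section \<open>The algorithm\<close>

abbreviation enc_lists :: "nat list list \<Rightarrow> tree" where
  "enc_lists \<equiv> enc_list (enc_list enc_nat)"

text \<open>Entries out of range count as not adjacent. \<open>polytime\<close> quantifies over all
  pairs of lists, so the function must be total and cannot rely on a well-formed matrix.\<close>

definition matrix_adj :: "nat list list \<Rightarrow> nat \<Rightarrow> nat \<Rightarrow> bool" where
  "matrix_adj M u v = (case drop u M of [] \<Rightarrow> False | r # _ \<Rightarrow> (case drop v r of [] \<Rightarrow> False | a # _ \<Rightarrow> a = 1))"

lemmas polytime_basic = polytime_fst polytime_snd polytime_id polytime_const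

lemma polytime_matrix_adj:
  assumes "polytime ea enc_lists M" "polytime ea enc_nat u" "polytime ea enc_nat v"
  shows "polytime ea enc_bool (\<lambda>x. matrix_adj (M x) (u x) (v x))"
  by (rule polytime_open3[OF _ assms]) (unfold matrix_adj_def, (rule polytime_case_list polytime_drop polytime_nat_eq polytime_basic)+)

definition joinable :: "nat list list \<Rightarrow> nat list \<Rightarrow> nat list \<Rightarrow> bool" where
  "joinable M X Y = (case rev X of [] \<Rightarrow> False | a # _ \<Rightarrow> (case Y of [] \<Rightarrow> False | b # _ \<Rightarrow> matrix_adj M a b))"

lemma joinable_iff: "joinable M X Y \<longleftrightarrow> X \<noteq> [] \<and> Y \<noteq> [] \<and> matrix_adj M (last X) (hd Y)"
  unfolding joinable_def by (cases X rule: rev_cases; cases Y) auto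

lemma polytime_joinable:
  assumes "polytime ea enc_lists M" "polytime ea (enc_list enc_nat) X" "polytime ea (enc_list enc_nat) Y"
  shows "polytime ea enc_bool (\<lambda>x. joinable (M x) (X x) (Y x))"
  by (rule polytime_open3[OF _ assms]) (unfold joinable_def, (rule polytime_case_list polytime_rev polytime_matrix_adj polytime_basic)+)

definition list_mem :: "nat \<Rightarrow> nat list \<Rightarrow> bool" where
  "list_mem v P = list_ex (\<lambda>u. u = v) P"

lemma list_mem_iff: "list_mem v P \<longleftrightarrow> v \<in> set P"
  by (auto simp: list_mem_def list_ex_iff)

lemma polytime_list_mem:
  assumes "polytime ea enc_nat v" "polytime ea (enc_list enc_nat) P" shows "polytime ea enc_bool (\<lambda>x. list_mem (v x) (P x))"
  by (rule polytime_open2[OF _ assms]) (unfold list_mem_def, (rule polytime_list_ex polytime_nat_eq polytime_basic)+)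

definition closedl :: "nat list list \<Rightarrow> nat list \<Rightarrow> bool" where
  "closedl Ts P = list_all (\<lambda>T. list_all (\<lambda>v. list_mem v P) T \<or> list_all (\<lambda>v. \<not> list_mem v P) T) Ts"

lemma closedl_iff: "closedl Ts P \<longleftrightarrow> closed_wrt (set (map set Ts)) (set P)"
  by (auto simp: closedl_def closed_wrt_def list_all_iff list_mem_iff)

lemma polytime_closedl:
  assumes "polytime ea enc_lists Ts" "polytime ea (enc_list enc_nat) P" shows "polytime ea enc_bool (\<lambda>x. closedl (Ts x) (P x))"
  by (rule polytime_open2[OF _ assms]) (unfold closedl_def, (rule polytime_list_all polytime_disj polytime_not polytime_list_mem polytime_basic)+)

type_synonym list_state = "nat list list \<times> nat list list"

abbreviation enc_state :: "list_state \<Rightarrow> tree" where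
  "enc_state \<equiv> enc_pair enc_lists enc_lists"

text \<open>The instance is passed around as the pair of the weight matrix and the list of terminal sets.\<close>

definition rev_nbrs :: "list_state \<Rightarrow> list_state list" where
  "rev_nbrs s = map (\<lambda>q. (rev (fst q) # snd q, snd s)) (picks (fst s))"

definition split_nbrs :: "list_state \<Rightarrow> list_state list" where
  "split_nbrs s = concat (map (\<lambda>q. concat (map (\<lambda>r.
     if fst r = [] \<or> snd r = [] then [] else [(fst r # snd r # snd q, snd s)]) (splits (fst q)))) (picks (fst s)))"

definition join_nbrs :: "list_state \<Rightarrow> list_state \<Rightarrow> list_state list" where
  "join_nbrs E s = concat (map (\<lambda>q. concat (map (\<lambda>r.
     if joinable (fst E) (fst q) (fst r) then [((fst q @ fst r) # snd r, snd s)] else []) (picks (snd q)))) (picks (fst s)))"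

definition close_nbrs :: "list_state \<Rightarrow> list_state \<Rightarrow> list_state list" where
  "close_nbrs E s = concat (map (\<lambda>q.
     if joinable (fst E) (fst q) (fst q) \<and> closedl (snd E) (fst q) then [(snd q, fst q # snd s)] else []) (picks (fst s)))"

definition unclose_nbrs :: "list_state \<Rightarrow> list_state list" where
  "unclose_nbrs s = concat (map (\<lambda>q. concat (map (\<lambda>r.
     if fst q = [] then [] else [((snd r @ fst r) # fst s, snd q)]) (splits (fst q)))) (picks (snd s)))"

definition nbrs :: "list_state \<Rightarrow> list_state \<Rightarrow> list_state list" where
  "nbrs E s = s # rev_nbrs s @ split_nbrs s @ join_nbrs E s @ close_nbrs E s @ unclose_nbrs s"

lemmas nbrs_defs = rev_nbrs_def split_nbrs_def join_nbrs_def close_nbrs_def unclose_nbrs_def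

lemma polytime_nbrs:
  assumes "polytime ea enc_state E" "polytime ea enc_state s" shows "polytime ea (enc_list enc_state) (\<lambda>x. nbrs (E x) (s x))"
  by (rule polytime_open2[OF _ assms]) (unfold nbrs_def nbrs_defs, (rule polytime_Cons polytime_pair polytime_append polytime_concat polytime_map polytime_picks polytime_splits
      polytime_if polytime_conj polytime_disj polytime_isnil polytime_joinable polytime_closedl polytime_rev polytime_basic)+)

definition abs_state :: "list_state \<Rightarrow> nat state" where
  "abs_state s = (mset (fst s), mset (snd s))"

lemma concat_mapI: "q \<in> set xs \<Longrightarrow> y \<in> set (f q) \<Longrightarrow> y \<in> set (concat (map f xs))"
  by auto

lemma concat_mapE: "y \<in> set (concat (map f xs)) \<Longrightarrow> (\<And>q. q \<in> set xs \<Longrightarrow> y \<in> set (f q) \<Longrightarrow> thesis) \<Longrightarrow> thesis"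
  by auto

lemma nbrs_sound:
  assumes "s' \<in> set (nbrs (M, Ts) s)" shows "move (matrix_adj M) (set (map set Ts)) (abs_state s) (abs_state s')"
proof -
  obtain ps cs where s: "s = (ps, cs)" by (cases s)
  let ?mv = "move (matrix_adj M) (set (map set Ts))"
  have 1: "?mv (abs_state s) (abs_state (rev P # R, cs))" if "(P, R) \<in> set (picks ps)" for P R
    using picks_mset[OF that] s by (simp add: abs_state_def move.reverse)
  have 2: "?mv (abs_state s) (abs_state (A # B # R, cs))" if "(A @ B, R) \<in> set (picks ps)" "A \<noteq> []" "B \<noteq> []" for A B R
    using picks_mset[OF that(1)] s that by (simp add: abs_state_def move.split)
  have 3: "?mv (abs_state s) (abs_state ((P @ Q) # R', cs))"
    if "(P, R) \<in> set (picks ps)" "(Q, R') \<in> set (picks R)" "joinable M P Q" for P Q R R'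
    using picks_mset[OF that(1)] picks_mset[OF that(2)] s that(3) by (simp add: abs_state_def move.join joinable_iff)
  have 4: "?mv (abs_state s) (abs_state (R, P # cs))"
    if "(P, R) \<in> set (picks ps)" "joinable M P P" "closedl Ts P" for P R
    using picks_mset[OF that(1)] s that(2,3) by (simp add: abs_state_def move.close joinable_iff closedl_iff)
  have 5: "?mv (abs_state s) (abs_state ((B @ A) # ps, R))" if "(A @ B, R) \<in> set (picks cs)" "A @ B \<noteq> []" for A B R
    using picks_mset[OF that(1)] s move.unclose[OF that(2)] by (simp add: abs_state_def)
  from assms consider "s' = s" | "s' \<in> set (rev_nbrs s)" | "s' \<in> set (split_nbrs s)" | "s' \<in> set (join_nbrs (M, Ts) s)"
    | "s' \<in> set (close_nbrs (M, Ts) s)" | "s' \<in> set (unclose_nbrs s)"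
    unfolding nbrs_def by auto
  then show ?thesis
  proof cases
    case 1
    then show ?thesis using move.stay by simp
  next
    case 2
    then show ?thesis using 1 by (auto simp: rev_nbrs_def s)
  next
    case 3
    then obtain q r where qr: "q \<in> set (picks ps)" "r \<in> set (splits (fst q))" "fst r \<noteq> []" "snd r \<noteq> []"
      "s' = (fst r # snd r # snd q, cs)"
      unfolding split_nbrs_def s by (auto elim!: concat_mapE split: if_splits)
    from qr(2) have "(fst r @ snd r, snd q) = q" by (auto simp: set_splits prod_eq_iff)
    then show ?thesis using 2[of "fst r" "snd r" "snd q"] qr by simp
  next
    case 4
    then obtain q r where "q \<in> set (picks ps)" "r \<in> set (picks (snd q))" "joinable M (fst q) (fst r)"
      "s' = ((fst q @ fst r) # snd r, cs)"
      unfolding join_nbrs_def s by (auto elim!: concat_mapE split: if_splits)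
    then show ?thesis using 3[of "fst q" "snd q" "fst r" "snd r"] by simp
  next
    case 5
    then obtain q where "q \<in> set (picks ps)" "joinable M (fst q) (fst q)" "closedl Ts (fst q)" "s' = (snd q, fst q # cs)"
      unfolding close_nbrs_def s by (auto elim!: concat_mapE split: if_splits)
    then show ?thesis using 4[of "fst q" "snd q"] by simp
  next
    case 6
    then obtain q r where qr: "q \<in> set (picks cs)" "r \<in> set (splits (fst q))" "fst q \<noteq> []" "s' = ((snd r @ fst r) # ps, snd q)"
      unfolding unclose_nbrs_def s by (auto elim!: concat_mapE split: if_splits)
    from qr(2) have "(fst r @ snd r, snd q) = q" "fst r @ snd r = fst q" by (auto simp: set_splits prod_eq_iff)
    then show ?thesis using 5[of "fst r" "snd r" "snd q"] qr by simp
  qed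
qed

text \<open>Completeness turns an unsuccessful search of the list into local optimality; soundness
  keeps the states valid.\<close>

lemma nbrs_complete:
  assumes "move (matrix_adj M) (set (map set Ts)) S S'" "S = abs_state s"
  shows "\<exists>s'\<in>set (nbrs (M, Ts) s). abs_state s' = S'"
proof -
  obtain ps cs where s: "s = (ps, cs)" by (cases s)
  from assms show ?thesis unfolding s
  proof (induction rule: move.induct)
    case (stay S)
    then show ?case by (auto simp: nbrs_def)
  next
    case (reverse P R C)
    then have "mset ps = add_mset P R" "C = mset cs" by (auto simp: abs_state_def)
    from picks_complete[OF this(1)] this(2) obtain ys where "(P, ys) \<in> set (picks ps)" "mset ys = R" by blast
    then have "(rev P # ys, cs) \<in> set (rev_nbrs (ps, cs))" unfolding rev_nbrs_def by force
    then show ?case using \<open>C = mset cs\<close> \<open>mset ys = R\<close>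
      by (intro bexI[of _ "(rev P # ys, cs)"]) (auto simp: nbrs_def abs_state_def)
  next
    case (split A B R C)
    then have "mset ps = add_mset (A @ B) R" "C = mset cs" by (auto simp: abs_state_def)
    from picks_complete[OF this(1)] this(2) obtain ys where ys: "(A @ B, ys) \<in> set (picks ps)" "mset ys = R" by blast
    have "(A # B # ys, cs) \<in> set (split_nbrs (ps, cs))"
      unfolding split_nbrs_def fst_conv snd_conv
      by (rule concat_mapI[OF ys(1)], rule concat_mapI[of "(A, B)"]) (use split(1,2) in \<open>auto simp: set_splits\<close>)
    then show ?case using ys \<open>C = mset cs\<close> by (intro bexI[of _ "(A # B # ys, cs)"]) (auto simp: abs_state_def nbrs_def)
  next
    case (join A B R C)
    then have "mset ps = add_mset A (add_mset B R)" "C = mset cs" by (auto simp: abs_state_def)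
    from picks_complete[OF this(1)] obtain ys where ys: "(A, ys) \<in> set (picks ps)" "mset ys = add_mset B R" by blast
    from picks_complete[OF ys(2)] obtain zs where zs: "(B, zs) \<in> set (picks ys)" "mset zs = R" by blast
    have "joinable M A B" using join by (simp add: joinable_iff)
    then have "((A @ B) # zs, cs) \<in> set (join_nbrs (M, Ts) (ps, cs))"
      unfolding join_nbrs_def fst_conv snd_conv
      by (intro concat_mapI[OF ys(1)] concat_mapI[of "(B, zs)"]) (use zs(1) in auto)
    then show ?case using zs \<open>C = mset cs\<close> by (intro bexI[of _ "((A @ B) # zs, cs)"]) (auto simp: abs_state_def nbrs_def)
  next
    case (close P R C)
    then have "mset ps = add_mset P R" "C = mset cs" by (auto simp: abs_state_def)
    from picks_complete[OF this(1)] this(2) obtain ys where ys: "(P, ys) \<in> set (picks ps)" "mset ys = R" by blast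
    have "joinable M P P" "closedl Ts P" using close by (auto simp: joinable_iff closedl_iff)
    then have "(ys, P # cs) \<in> set (close_nbrs (M, Ts) (ps, cs))"
      unfolding close_nbrs_def fst_conv snd_conv by (intro concat_mapI[OF ys(1)]) auto
    then show ?case using ys \<open>C = mset cs\<close> by (intro bexI[of _ "(ys, P # cs)"]) (auto simp: abs_state_def nbrs_def)
  next
    case (unclose A B R C)
    then have "mset cs = add_mset (A @ B) C" "R = mset ps" by (auto simp: abs_state_def)
    from picks_complete[OF this(1)] this(2) obtain ys where ys: "(A @ B, ys) \<in> set (picks cs)" "mset ys = C" by blast
    have "((B @ A) # ps, ys) \<in> set (unclose_nbrs (ps, cs))"
      unfolding unclose_nbrs_def fst_conv snd_conv
      by (rule concat_mapI[OF ys(1)], rule concat_mapI[of "(A, B)"]) (use unclose(1) in \<open>auto simp: set_splits\<close>)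
    then show ?case using ys \<open>R = mset ps\<close> by (intro bexI[of _ "((B @ A) # ps, ys)"]) (auto simp: abs_state_def nbrs_def)
  qed
qed

section \<open>Exhaustive search for improvements and its iteration\<close>

primrec reach_list :: "nat \<Rightarrow> list_state \<Rightarrow> list_state \<Rightarrow> list_state list" where
  "reach_list 0 E s = [s]"
| "reach_list (Suc d) E s = concat (map (nbrs E) (reach_list d E s))"

text \<open>The polynomial depends on \<open>d\<close>. The depth is therefore not part of the
  input, and the induction on \<open>d\<close> takes place outside \<open>polytime\<close>.\<close>

lemma polytime_reach_list:
  assumes "polytime ea enc_state E" "polytime ea enc_state s" shows "polytime ea (enc_list enc_state) (\<lambda>x. reach_list d (E x) (s x))"
proof -
  have "polytime (enc_pair enc_state enc_state) (enc_list enc_state) (\<lambda>p. reach_list d (fst p) (snd p))"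
  proof (induction d)
    case 0
    show ?case unfolding reach_list.simps by (rule polytime_Cons polytime_basic)+
  next
    case (Suc d)
    show ?case unfolding reach_list.simps by (rule polytime_concat polytime_map polytime_nbrs Suc polytime_basic)+
  qed
  from polytime_open2[OF this assms] show ?thesis .
qed

lemma reach_list_sound:
  "s' \<in> set (reach_list d (M, Ts) s) \<Longrightarrow> reach (matrix_adj M) (set (map set Ts)) d (abs_state s) (abs_state s')"
proof (induction d arbitrary: s')
  case (Suc d)
  then obtain s1 where "s1 \<in> set (reach_list d (M, Ts) s)" "s' \<in> set (nbrs (M, Ts) s1)" by auto
  with Suc.IH nbrs_sound show ?case unfolding reach.simps by blast
qed (simp add: reach.simps)

lemma reach_list_complete:
  "reach (matrix_adj M) (set (map set Ts)) d (abs_state s) S' \<Longrightarrow> \<exists>s'\<in>set (reach_list d (M, Ts) s). abs_state s' = S'"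
proof (induction d arbitrary: S')
  case (Suc d)
  then obtain S1 where S1: "reach (matrix_adj M) (set (map set Ts)) d (abs_state s) S1"
    "move (matrix_adj M) (set (map set Ts)) S1 S'" unfolding reach.simps by blast
  from Suc.IH[OF S1(1)] obtain s1 where s1: "s1 \<in> set (reach_list d (M, Ts) s)" "abs_state s1 = S1" by blast
  from nbrs_complete[OF S1(2) s1(2)[symmetric]] s1(1) show ?case by auto
qed (simp add: reach.simps)

definition unlockedl :: "nat list list \<Rightarrow> nat list \<Rightarrow> nat" where
  "unlockedl Ts P = unlocked (set (map set Ts)) P"

lemma unlockedl_Cons:
  "unlockedl Ts [] = 0"
  "unlockedl Ts (x # ys) = (case ys of [] \<Rightarrow> 0 | y # _ \<Rightarrow> (if closedl Ts [x, y] then 0 else 1) + unlockedl Ts ys)"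
  unfolding unlockedl_def by (auto simp: closedl_iff split: list.splits)

lemma unlockedl_le: "unlockedl Ts P \<le> length P"
proof (induction P)
  case (Cons x ys)
  then show ?case using unlockedl_Cons(2)[of Ts x ys] by (cases ys) (auto split: if_splits)
qed (simp add: unlockedl_Cons)

lemma polytime_unlockedl:
  assumes "polytime ea enc_lists Ts" "polytime ea (enc_list enc_nat) P" shows "polytime ea enc_nat (\<lambda>x. unlockedl (Ts x) (P x))"
proof (rule polytime_open2[OF _ assms])
  let ?e = "enc_pair enc_lists (enc_list enc_nat)"
  show "polytime ?e enc_nat (\<lambda>p. unlockedl (fst p) (snd p))"
  proof (rule polytime_list_rec[where l = snd and i = "\<lambda>_. 0" and g = "\<lambda>p ys. unlockedl (fst p) ys" and B = "\<lambda>n. n" and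
        h = "\<lambda>p x ys acc. case ys of [] \<Rightarrow> 0 | y # _ \<Rightarrow> (if closedl (fst p) [x, y] then 0 else 1) + acc"])
    show "polytime ?e (enc_list enc_nat) snd" by (rule polytime_snd_raw)
    show "polytime (enc_pair enc_nat (enc_pair (enc_list enc_nat) (enc_pair enc_nat ?e))) enc_nat
      (\<lambda>p. case fst (snd p) of [] \<Rightarrow> 0 | y # _ \<Rightarrow>
        (if closedl (fst (snd (snd (snd p)))) [fst p, y] then 0 else 1) + fst (snd (snd p)))"
      by (rule polytime_case_list polytime_add polytime_if polytime_closedl polytime_Cons polytime_basic)+
    fix p :: "nat list list \<times> nat list" and zs ys assume "snd p = zs @ ys"
    then have "length ys \<le> size (enc_list enc_nat (snd p))" using length_le_size_enc_list[of "snd p" enc_nat] by simp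
    then show "size (enc_nat (unlockedl (fst p) ys)) \<le> size (?e p)"
      using unlockedl_le[of "fst p" ys] by (simp add: size_enc_nat enc_pair_fst_snd)
  qed (auto simp: unlockedl_Cons intro: polytime_const poly_bounded_intros)
qed

definition path_costl :: "nat list list \<Rightarrow> nat list \<Rightarrow> nat" where
  "path_costl Ts P = 200000 + (if length P \<le> 1 then 20 else if length P = 2 then 10 else 0) + unlockedl Ts P"

definition list_potential :: "nat list list \<Rightarrow> list_state \<Rightarrow> nat" where
  "list_potential Ts s = sum_list (map (path_costl Ts) (fst s)) + sum_list (map (\<lambda>C. 1000 + unlockedl Ts C) (snd s))"

lemma list_potential_eq: "list_potential Ts s = potential (set (map set Ts)) (abs_state s)"
proof -
  have "sum_list (map (path_costl Ts) ps) = 200000 * length ps + (\<Sum>P\<in>#mset ps. path_weight (set (map set Ts)) P)" for ps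
    by (induction ps) (auto simp: path_costl_def path_weight_def unlockedl_def)
  moreover have "sum_list (map (\<lambda>C. 1000 + unlockedl Ts C) cs) = 1000 * length cs + (\<Sum>C\<in>#mset cs. unlocked (set (map set Ts)) C)" for cs
    by (induction cs) (auto simp: unlockedl_def)
  ultimately show ?thesis by (simp add: list_potential_def potential_def rest_weight_def abs_state_def)
qed

lemma polytime_list_potential:
  assumes "polytime ea enc_lists Ts" "polytime ea enc_state s" shows "polytime ea enc_nat (\<lambda>x. list_potential (Ts x) (s x))"
  by (rule polytime_open2[OF _ assms]) (unfold list_potential_def path_costl_def, (rule polytime_add polytime_sum_list polytime_map polytime_if polytime_le polytime_nat_eq
      polytime_length polytime_unlockedl polytime_basic)+)

definition improve :: "list_state \<Rightarrow> list_state \<Rightarrow> list_state" where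
  "improve E s = (case filter (\<lambda>s'. list_potential (snd E) s' < list_potential (snd E) s) (reach_list 100 E s) of [] \<Rightarrow> s | s' # _ \<Rightarrow> s')"

lemma polytime_improve:
  assumes "polytime ea enc_state E" "polytime ea enc_state s" shows "polytime ea enc_state (\<lambda>x. improve (E x) (s x))"
  by (rule polytime_open2[OF _ assms]) (unfold improve_def, (rule polytime_case_list polytime_filter polytime_reach_list polytime_less polytime_list_potential polytime_basic)+)

definition start :: "nat list list \<Rightarrow> list_state" where
  "start Ts = (map (\<lambda>v. [v]) (concat Ts), [])"

lemma polytime_start: "polytime ea enc_lists Ts \<Longrightarrow> polytime ea enc_state (\<lambda>x. start (Ts x))"
  by (rule polytime_comp[of _ enc_lists]) (simp, unfold start_def, (rule polytime_pair polytime_map polytime_concat polytime_Cons polytime_basic)+)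

primrec iterate :: "list_state \<Rightarrow> unit list \<Rightarrow> list_state" where
  "iterate E [] = start (snd E)"
| "iterate E (u # us) = improve E (iterate E us)"

lemma improve_cases:
  obtains "improve E s = s" "\<And>s'. s' \<in> set (reach_list 100 E s) \<Longrightarrow> list_potential (snd E) s \<le> list_potential (snd E) s'"
  | "improve E s \<in> set (reach_list 100 E s)" "list_potential (snd E) (improve E s) < list_potential (snd E) s"
proof (cases "filter (\<lambda>s'. list_potential (snd E) s' < list_potential (snd E) s) (reach_list 100 E s)")
  case Nil
  then show ?thesis using that(1) by (auto simp: improve_def filter_empty_conv not_less)
next
  case (Cons s' t)
  then have "s' \<in> set (filter (\<lambda>s'. list_potential (snd E) s' < list_potential (snd E) s) (reach_list 100 E s))" by simp
  then have "s' \<in> set (reach_list 100 E s)" "list_potential (snd E) s' < list_potential (snd E) s" by auto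
  moreover have "improve E s = s'" using Cons by (simp add: improve_def)
  ultimately show ?thesis using that(2) by simp
qed

text \<open>What remains of \<open>valid_state\<close> for arbitrary input, even if the terminal
  lists overlap. The running time has to be bounded for every input, and this much is enough to
  bound the size of a state.\<close>

definition proper :: "nat list list \<Rightarrow> nat state \<Rightarrow> bool" where
  "proper Ts S \<longleftrightarrow> [] \<notin># fst S \<and> [] \<notin># snd S \<and>
     (\<Sum>P\<in>#fst S. mset P) + (\<Sum>C\<in>#snd S. mset C) = mset (concat Ts)"

lemma proper_move: "move adj \<T> S S' \<Longrightarrow> proper Ts S \<Longrightarrow> proper Ts S'"
proof -
  assume m: "move adj \<T> S S'" and p: "proper Ts S"
  have "[] \<notin># fst S' \<and> [] \<notin># snd S'"
    using m p unfolding proper_def by (induction rule: move.induct) auto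
  then show ?thesis using p move_vertices[OF m] by (auto simp: proper_def)
qed

lemma proper_reach: "reach adj \<T> d S S' \<Longrightarrow> proper Ts S \<Longrightarrow> proper Ts S'"
proof (induction d arbitrary: S')
  case (Suc d)
  then obtain S1 where "reach adj \<T> d S S1" "move adj \<T> S1 S'" unfolding reach.simps by blast
  with Suc proper_move show ?case by blast
qed (simp add: reach.simps)

lemma proper_iterate: "proper Ts (abs_state (iterate (M, Ts) us))"
proof (induction us)
  case Nil
  have "(\<Sum>P\<in>#image_mset (\<lambda>v. [v]) X. mset P) = X" for X :: "nat multiset" by (induction X) auto
  then show ?case by (auto simp: proper_def start_def abs_state_def)
next
  case (Cons u us)
  let ?s = "iterate (M, Ts) us"
  show ?case
  proof (cases rule: improve_cases[of "(M, Ts)" ?s])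
    case 1
    then show ?thesis using Cons by simp
  next
    case 2
    from proper_reach[OF reach_list_sound[OF 2(1)] Cons] show ?thesis by simp
  qed
qed

text \<open>Each inner list costs one extra node in the outer list; being nonempty, it has at least
  one node of its own to pay for it.\<close>

lemma size_enc_lists_nonempty: "[] \<notin> set ps \<Longrightarrow> size (enc_lists ps) \<le> 2 * size (enc_list enc_nat (concat ps))"
proof (induction ps)
  case (Cons P ps)
  then have "1 \<le> size (enc_list enc_nat P)" by (cases P) auto
  with Cons show ?case by (simp add: size_enc_list_append)
qed simp

lemma size_enc_list_mset: "size (enc_list e xs) = (\<Sum>x\<in>#mset xs. size (e x) + 1)"
  by (induction xs) auto

text \<open>The moves preserve the multiset of vertex names, so only the list structure around them
  varies.\<close>

lemma size_proper: "proper Ts (abs_state s) \<Longrightarrow> size (enc_state s) \<le> 2 * size (enc_lists Ts) + 1"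
proof -
  assume p: "proper Ts (abs_state s)"
  obtain ps cs where s: "s = (ps, cs)" by (cases s)
  have "mset (concat ps @ concat cs) = mset (concat Ts)"
    using p s by (simp add: proper_def abs_state_def mset_concat_sum)
  then have "size (enc_list enc_nat (concat ps @ concat cs)) = size (enc_list enc_nat (concat Ts))"
    unfolding size_enc_list_mset by simp
  moreover have "size (enc_lists ps) \<le> 2 * size (enc_list enc_nat (concat ps))"
    "size (enc_lists cs) \<le> 2 * size (enc_list enc_nat (concat cs))"
    using p s by (auto intro!: size_enc_lists_nonempty simp: proper_def abs_state_def)
  moreover have "size (enc_list enc_nat (concat Ts)) \<le> size (enc_lists Ts)" by (rule size_enc_list_concat)
  ultimately show ?thesis using s by (simp add: size_enc_list_append)
qed

text \<open>Each actual improvement lowers the potential by at least 1, so its initial value bounds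
  their number. This value is linear in the number of listed terminals and can be written in
  unary.\<close>

definition search :: "list_state \<Rightarrow> list_state" where
  "search E = iterate E (replicate (list_potential (snd E) (start (snd E))) ())"

lemma polytime_search: "polytime enc_state enc_state search"
  unfolding search_def
proof (rule polytime_list_rec[where h = "\<lambda>E u us s. improve E s" and i = "\<lambda>E. start (snd E)" and B = "\<lambda>n. 2 * n + 1"])
  show "polytime enc_state enc_unary (\<lambda>E. replicate (list_potential (snd E) (start (snd E))) ())"
    by (rule polytime_replicate polytime_list_potential polytime_start polytime_basic)+
  show "polytime enc_state enc_state (\<lambda>E. start (snd E))" by (rule polytime_start polytime_basic)+
  show "polytime (enc_pair (\<lambda>_. Leaf) (enc_pair enc_unary (enc_pair enc_state enc_state))) enc_state
    (\<lambda>p. improve (snd (snd (snd p))) (fst (snd (snd p))))"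
    by (rule polytime_improve polytime_basic)+
  show "size (enc_state (iterate E us)) \<le> 2 * size (enc_state E) + 1" for E us
    using size_proper[OF proper_iterate[of "snd E" "fst E" us]] by (simp add: enc_pair_fst_snd)
qed (auto intro!: poly_bounded_intros)

lemma search_local_opt: "local_opt (matrix_adj M) (set (map set Ts)) (abs_state (search (M, Ts)))"
proof -
  let ?stuck = "\<lambda>s. \<forall>s'\<in>set (reach_list 100 (M, Ts) s). list_potential Ts s \<le> list_potential Ts s'"
  \<comment> \<open>Either the search is stuck, and \<open>improve\<close> is idle from then on, or
    every iteration so far has lowered the potential.\<close>
  have "?stuck (iterate (M, Ts) us) \<or> list_potential Ts (iterate (M, Ts) us) + length us \<le> list_potential Ts (start Ts)" for us
  proof (induction us)
    case (Cons u us)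
    show ?case
    proof (cases rule: improve_cases[of "(M, Ts)" "iterate (M, Ts) us"])
      case 1
      then show ?thesis by simp
    next
      case 2
      then have "\<not> ?stuck (iterate (M, Ts) us)" by (auto simp: not_le)
      with Cons 2 show ?thesis by auto
    qed
  qed simp
  \<comment> \<open>If every iteration was an improvement, then the potential is now 0, and the
    state is stuck all the same.\<close>
  from this[of "replicate (list_potential Ts (start Ts)) ()"] have st: "?stuck (search (M, Ts))"
    by (auto simp: search_def)
  show ?thesis unfolding local_opt_def
  proof (intro allI impI)
    fix S' assume "reach (matrix_adj M) (set (map set Ts)) 100 (abs_state (search (M, Ts))) S'"
    from reach_list_complete[OF this] obtain s' where "s' \<in> set (reach_list 100 (M, Ts) (search (M, Ts)))" "abs_state s' = S'" by blast
    with st show "potential (set (map set Ts)) (abs_state (search (M, Ts))) \<le> potential (set (map set Ts)) S'"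
      using list_potential_eq by metis
  qed
qed

lemma search_valid:
  assumes "\<And>u v. matrix_adj M u v \<Longrightarrow> matrix_adj M v u" "valid_state (matrix_adj M) (set (map set Ts)) U (abs_state (start Ts))"
  shows "valid_state (matrix_adj M) (set (map set Ts)) U (abs_state (search (M, Ts)))"
proof -
  have "valid_state (matrix_adj M) (set (map set Ts)) U (abs_state (iterate (M, Ts) us))" for us
  proof (induction us)
    case (Cons u us)
    show ?case
    proof (cases rule: improve_cases[of "(M, Ts)" "iterate (M, Ts) us"])
      case 2
      from valid_state_reach[OF assms(1) reach_list_sound[OF 2(1)] Cons] show ?thesis by simp
    qed (use Cons in simp)
  qed (use assms(2) in simp)
  then show ?thesis by (simp add: search_def)
qed

section \<open>Output of the cycles\<close>

fun pairs :: "nat list \<Rightarrow> edge_code list" where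
  "pairs [] = []"
| "pairs (x # ys) = (case ys of [] \<Rightarrow> [] | y # _ \<Rightarrow> (x, y, False) # pairs ys)"

declare pairs.simps(2) [simp del]

lemma enc_edge_eq: "enc_edge = enc_pair enc_nat (enc_pair enc_nat enc_bool)"
  by (auto simp: enc_edge_def fun_eq_iff)

lemma size_pairs: "size (enc_list enc_edge (pairs P)) \<le> 4 * size (enc_list enc_nat P)"
proof -
  \<comment> \<open>The head is added for the sake of the induction, since each inner vertex occurs
    in two triples.\<close>
  have "size (enc_list enc_edge (pairs P)) + (case P of [] \<Rightarrow> 0 | x # _ \<Rightarrow> x) \<le> 4 * size (enc_list enc_nat P)"
  proof (induction P)
    case (Cons x ys)
    then show ?case using pairs.simps(2)[of x ys]
      by (cases ys) (auto simp: enc_edge_eq size_enc_nat enc_bool_def)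
  qed simp
  then show ?thesis by simp
qed

lemma polytime_pairs: "polytime ea (enc_list enc_nat) P \<Longrightarrow> polytime ea (enc_list enc_edge) (\<lambda>x. pairs (P x))"
proof (erule polytime_comp)
  show "polytime (enc_list enc_nat) (enc_list enc_edge) pairs"
  proof (rule polytime_list_rec[where l = "\<lambda>x. x" and i = "\<lambda>_. []" and g = "\<lambda>_ ys. pairs ys" and B = "\<lambda>n. 4 * n" and
        h = "\<lambda>p x ys acc. case ys of [] \<Rightarrow> [] | y # _ \<Rightarrow> (x, y, False) # acc"])
    show "polytime (enc_pair enc_nat (enc_pair (enc_list enc_nat) (enc_pair (enc_list enc_edge) (enc_list enc_nat)))) (enc_list enc_edge)
      (\<lambda>p. case fst (snd p) of [] \<Rightarrow> [] | y # _ \<Rightarrow> (fst p, y, False) # fst (snd (snd p)))"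
      unfolding enc_edge_eq by (rule polytime_case_list polytime_Cons polytime_pair polytime_basic)+
    fix x zs ys :: "nat list" assume "x = zs @ ys"
    then show "size (enc_list enc_edge (pairs ys)) \<le> 4 * size (enc_list enc_nat x)"
      using size_pairs[of ys] by (simp add: size_enc_list_append)
  qed (auto simp: pairs.simps(2) intro: polytime_id polytime_const poly_bounded_intros)
qed

lemma pairs_nth: "pairs c = map (\<lambda>i. (c ! i, c ! Suc i, False)) [0..<length c - 1]"
proof (induction c)
  case (Cons x ys)
  show ?case
  proof (cases ys)
    case ys: (Cons y zs)
    have "[0..<length (x # ys) - 1] = 0 # map Suc [0..<length ys - 1]"
      using ys by (simp add: map_Suc_upt upt_conv_Cons del: upt_Suc)
    then show ?thesis using Cons ys pairs.simps(2)[of x ys] by (simp del: upt_Suc)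
  qed (simp add: pairs.simps)
qed simp

text \<open>Computes \<open>cyc_edges\<close> by list recursion, without access by index; the two
  agree from length 2 on.\<close>

definition edge_list :: "nat list \<Rightarrow> edge_code list" where
  "edge_list c = (case c of [] \<Rightarrow> [] | a # _ \<Rightarrow> (case rev c of [] \<Rightarrow> [] | z # _ \<Rightarrow> pairs c @ [(z, a, length c = 2)]))"

lemma edge_list_eq: "2 \<le> length c \<Longrightarrow> edge_list c = cyc_edges c"
proof -
  assume len: "2 \<le> length c"
  then obtain m where m: "length c = Suc m" "1 \<le> m" by (cases "length c") auto
  have ne: "c \<noteq> []" using len by auto
  then have "edge_list c = pairs c @ [(last c, hd c, length c = 2)]"
  proof -
    from ne obtain a as where a: "c = a # as" by (cases c) auto
    have r: "rev c = last c # tl (rev c)" using ne by (simp add: hd_rev[symmetric] del: hd_rev)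
    have "edge_list c = (case rev c of [] \<Rightarrow> [] | z # _ \<Rightarrow> pairs c @ [(z, hd c, length c = 2)])"
      unfolding edge_list_def a by (simp split: list.split)
    then show ?thesis by (subst (asm) r) simp
  qed
  moreover have "c ! m = last c" "c ! 0 = hd c" using ne m by (auto simp: last_conv_nth hd_conv_nth)
  ultimately show ?thesis using m by (simp add: cyc_edges_def pairs_nth)
qed

lemma polytime_edge_list: "polytime ea (enc_list enc_nat) P \<Longrightarrow> polytime ea (enc_list enc_edge) (\<lambda>x. edge_list (P x))"
proof (erule polytime_comp)
  show "polytime (enc_list enc_nat) (enc_list enc_edge) (\<lambda>c. edge_list c)"
    unfolding edge_list_def enc_edge_eq
    by (rule polytime_case_list polytime_rev polytime_append polytime_pairs[unfolded enc_edge_eq] polytime_Cons polytime_pair polytime_nat_eq polytime_length polytime_basic)+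
qed

definition algorithm :: "list_state \<Rightarrow> cycle_code list" where
  "algorithm E = map (\<lambda>c. (c, edge_list c)) (out_cycles (fst (search E)) (snd (search E)))"

lemma enc_cycle_eq: "enc_cycle = enc_pair (enc_list enc_nat) (enc_list enc_edge)"
  by (auto simp: enc_cycle_def fun_eq_iff)

lemma polytime_algorithm: "polytime enc_state (enc_list enc_cycle) algorithm"
proof -
  have "polytime enc_state (enc_list enc_cycle) (\<lambda>s. map (\<lambda>c. (c, edge_list c)) (out_cycles (fst s) (snd s)))"
    unfolding out_cycles_def enc_cycle_eq
    by (rule polytime_map polytime_if polytime_isnil polytime_Cons polytime_concat polytime_pair polytime_edge_list polytime_basic)+
  from polytime_comp[OF polytime_search this] show ?thesis by (simp add: algorithm_def[abs_def])
qed

definition matrix :: "nat \<Rightarrow> (nat set \<Rightarrow> nat) \<Rightarrow> nat list list" where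
  "matrix n w = map (\<lambda>i. map (\<lambda>j. if i = j then 0 else w {i, j}) [0..<n]) [0..<n]"

lemma enc_list_map: "enc_list e (map f xs) = enc_list (\<lambda>x. e (f x)) xs"
  by (induction xs) auto

lemma enc_instance_eq: "enc_instance n w Ts = enc_state (matrix n w, Ts)"
  by (simp add: enc_instance_def enc_matrix_def matrix_def enc_list_map)

lemma matrix_adj_iff: "matrix_adj (matrix n w) u v \<longleftrightarrow> u < n \<and> v < n \<and> u \<noteq> v \<and> w {u, v} = 1"
proof (cases "u < n \<and> v < n")
  case True
  then have "drop u (matrix n w) = (map (\<lambda>j. if u = j then 0 else w {u, j}) [0..<n]) # drop (Suc u) (matrix n w)"
    by (simp add: matrix_def Cons_nth_drop_Suc[symmetric])
  moreover have "drop v (map (\<lambda>j. if u = j then 0 else w {u, j}) [0..<n]) =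
    (if u = v then 0 else w {u, v}) # drop (Suc v) (map (\<lambda>j. if u = j then 0 else w {u, j}) [0..<n])"
    using True by (simp add: Cons_nth_drop_Suc[symmetric])
  ultimately show ?thesis using True by (simp add: matrix_adj_def)
next
  case False
  show ?thesis
  proof (cases "u < n")
    case True
    then have "drop u (matrix n w) = (map (\<lambda>j. if u = j then 0 else w {u, j}) [0..<n]) # drop (Suc u) (matrix n w)"
      by (simp add: matrix_def Cons_nth_drop_Suc[symmetric])
    then show ?thesis using False True by (simp add: matrix_adj_def)
  qed (simp add: matrix_adj_def matrix_def)
qed


theorem theorem2:
  "\<exists>(P :: com) (p :: nat poly). \<forall>(n :: nat) (w :: nat set \<Rightarrow> nat) (\<T> :: nat set set) (Ts :: nat list list).
     smc_instance {..<n} \<T> \<longrightarrow>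
     (\<forall>e\<in>complete_edges {..<n}. w e \<in> {1, 2}) \<longrightarrow>
     lists_terminals Ts \<T> \<longrightarrow>
     (\<exists>y \<C>. outputs_within P (enc_instance n w Ts) (poly p (size (enc_instance n w Ts))) y \<and>
        represents_cycles y \<C> \<and>
        disjoint_cycles {..<n} \<T> \<C> \<and>
        respects_terminals \<T> \<C> \<and>
        real (cost w \<C>) \<le> 11 / 9 * real (opt {..<n} w \<T>))"
proof -
  from polytime_algorithm obtain P N p where P: "computes P N p enc_state (enc_list enc_cycle) algorithm"
    by (auto simp: polytime_def)
  show ?thesis
  proof (intro exI[of _ P] exI[of _ p] allI impI)
    fix n :: nat and w :: "nat set \<Rightarrow> nat" and \<T> :: "nat set set" and Ts :: "nat list list"
    assume inst: "smc_instance {..<n} \<T>" and wt: "\<forall>e\<in>complete_edges {..<n}. w e \<in> {1, 2}"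
      and Ts: "lists_terminals Ts \<T>"
    let ?M = "matrix n w"
    let ?s = "search (?M, Ts)"
    let ?y = "enc_list enc_cycle (algorithm (?M, Ts))"
    have T: "\<T> = set (map set Ts)" using Ts by (simp add: lists_terminals_def)
    interpret instance_12 "{..<n}" w \<T> "matrix_adj ?M"
      by unfold_locales (use inst wt in \<open>auto simp: matrix_adj_iff\<close>)
    \<comment> \<open>\<open>distinct_concat_iff\<close> disregards empty lists, which do not occur
      here because terminal sets have at least two elements.\<close>
    have "distinct (concat Ts)"
    proof -
      have "set T \<noteq> {}" if "T \<in> set Ts" for T
        using terminal_card[of "set T"] that T by auto
      then have "removeAll [] Ts = Ts" by (intro removeAll_id) auto
      moreover have "set A \<inter> set B = {}" if "A \<in> set Ts" "B \<in> set Ts" "A \<noteq> B" for A B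
      proof -
        have "set A \<noteq> set B" using that Ts by (auto simp: lists_terminals_def distinct_map inj_on_def)
        then show ?thesis using inst that T by (auto simp: smc_instance_def disjoint_def)
      qed
      ultimately show ?thesis using Ts
        by (auto simp: distinct_concat_iff lists_terminals_def distinct_map)
    qed
    moreover have "set (concat Ts) = \<Union>\<T>" using T by simp
    ultimately have cover: "mset (concat Ts) = mset_set (\<Union>\<T>)" by (metis mset_set_set)
    have "proper Ts (abs_state (start Ts))" using proper_iterate[of Ts ?M "[]"] by simp
    then have "valid_state (matrix_adj ?M) \<T> (\<Union>\<T>) (abs_state (start Ts))"
      using cover by (auto simp: valid_state_def proper_def abs_state_def start_def)
    then have valid: "valid_state (matrix_adj ?M) \<T> (\<Union>\<T>) (mset (fst ?s), mset (snd ?s))"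
      using search_valid[of ?M Ts "\<Union>\<T>"] adj_symD unfolding T[symmetric] by (auto simp: abs_state_def)
    have opt: "local_opt (matrix_adj ?M) \<T> (mset (fst ?s), mset (snd ?s))"
      using search_local_opt[of ?M Ts] unfolding T[symmetric] by (simp add: abs_state_def)
    obtain \<C> where \<C>: "represents_cycles (enc_list enc_cycle (map (\<lambda>c. (c, cyc_edges c)) (out_cycles (fst ?s) (snd ?s)))) \<C>"
      "disjoint_cycles {..<n} \<T> \<C>" "respects_terminals \<T> \<C>" "real (cost w \<C>) \<le> 11 / 9 * real (opt {..<n} w \<T>)"
      using output_solution[OF instance_12_axioms valid opt] by blast
    have "2 \<le> length c" if "c \<in> set (out_cycles (fst ?s) (snd ?s))" for c
      using out_cycles_length[OF instance_12_axioms valid that] .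
    then have "algorithm (?M, Ts) = map (\<lambda>c. (c, cyc_edges c)) (out_cycles (fst ?s) (snd ?s))"
      by (simp add: algorithm_def edge_list_eq)
    then have rep: "represents_cycles ?y \<C>" using \<C>(1) by simp
    let ?x = "enc_instance n w Ts"
    have x: "?x = enc_state (?M, Ts)" by (rule enc_instance_eq)
    have "runs P ((\<lambda>_. Leaf)(0 := ?x)) (poly p (size ?x)) (((\<lambda>_. Leaf)(0 := ?x))(0 := ?y))"
      using computes_runs[OF P, of "(\<lambda>_. Leaf)(0 := ?x)" "(?M, Ts)"] x by (simp add: clean_def)
    then have "outputs_within P ?x (poly p (size ?x)) ?y"
      unfolding outputs_within_def runs_def by (metis fun_upd_same)
    with rep \<C> show "\<exists>y \<C>. outputs_within P ?x (poly p (size ?x)) y \<and> represents_cycles y \<C> \<and>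
        disjoint_cycles {..<n} \<T> \<C> \<and> respects_terminals \<T> \<C> \<and>
        real (cost w \<C>) \<le> 11 / 9 * real (opt {..<n} w \<T>)" by blast
  qed
qed

end
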